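(* Let $X_1,\dots,X_n$ be i.i.d. with Laplace density $f(x\mid\theta)=\tfrac12\exp\{-|x-\theta|\}$, $x\in\mathbb{R}$, and consider testing $H_0:\theta=0$ versus $H_1:\theta>0$ with the sign statistic $V_n=\sum_{i=1}^n\mathbf{1}\{X_i>0\}$. Let the prior on the alternative have density $\pi_1(\theta)\propto\theta^{\lambda-1}e^{-\gamma\theta}$, $\theta>0$, with $\lambda,\gamma>0$ (so that $\Pi_1([0,\varepsilon])\asymp\varepsilon^\lambda$ for small $\varepsilon$). Then the Bayes-risk minimising sign-test threshold has the form $$V_n\ \text{rejects}\ H_0\ \text{if}\ \ V_n\ge\frac n2+\frac12\sqrt{\lambda\,n\log n}\,(1+o(1)).$$ Equivalently, in terms of the standardised threshold $z_n$ (reject when $V_n\ge n/2+z_n\sqrt n/2$), $z_n=\sqrt{\lambda\log n}\,(1+o(1))$. The Type I error decays polynomially as $\alpha_n^*\asymp n^{-\lambda/2}\times\mathrm{polylog}(n)$. The critical alternative scale is $\theta\asymp\sqrt{\log n/n}$.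
   Context: The Bayes risk of the test rejecting when $V_n\ge v$ is $$\pi_0L_0\,\mathbb{P}_0(V_n\ge v)+\pi_1L_1\int_0^\infty\mathbb{P}_\theta(V_n<v)\,\Pi_1(d\theta),$$ where in this formula $\pi_0,\pi_1>0$ with $\pi_0+\pi_1=1$ are the prior probabilities of $H_0,H_1$; $L_0,L_1>0$ are the Type I and Type II losses; and $\Pi_1$ is the probability measure on $(0,\infty)$ with the prior density $\pi_1(\theta)$. Under $H_0$, $V_n\sim\mathrm{Bin}(n,1/2)$. $\alpha_n^*$ is the Type I error at the Bayes-optimal threshold. The critical alternative scale is the order of magnitude of $\theta$ up to which alternatives are not reliably detected at the Bayes-optimal threshold and on which the prior-averaged Type II error concentrates. The notation $f\asymp g$ means $c\,g\le f\le C\,g$ for positive constants $c,C$ independent of $n$; $\mathrm{polylog}(n)$ denotes a factor that is a power of $\log n$. *)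

theory Defs
  imports "HOL-Probability.Probability" "HOL-Library.Landau_Symbols"
begin

definition laplace_density :: "real \<Rightarrow> real \<Rightarrow> real" where
  "laplace_density \<theta> x = 1 / 2 * exp (- \<bar>x - \<theta>\<bar>)"

text \<open>The observations are \<open>X 0, X 1, \<dots>\<close>, so a sample of size \<open>n\<close> is \<open>X 0, \<dots>, X (n - 1)\<close>;
  \<open>P \<theta>\<close> is the law on the sample space under the parameter \<open>\<theta>\<close>.
  Only \<open>\<theta> \<ge> 0\<close> is part of the testing problem.\<close>

definition laplace_model :: "(real \<Rightarrow> 'a measure) \<Rightarrow> (nat \<Rightarrow> 'a \<Rightarrow> real) \<Rightarrow> bool" where
  "laplace_model P X \<longleftrightarrow>
     (\<forall>\<theta>\<ge>0. prob_space (P \<theta>)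
        \<and> prob_space.indep_vars (P \<theta>) (\<lambda>_. borel) X UNIV
        \<and> (\<forall>i. distributed (P \<theta>) lborel (X i) (\<lambda>x. ennreal (laplace_density \<theta> x))))"

definition sign_stat :: "(nat \<Rightarrow> 'a \<Rightarrow> real) \<Rightarrow> nat \<Rightarrow> 'a \<Rightarrow> real" where
  "sign_stat X n \<omega> = (\<Sum>i<n. indicator {0<..} (X i \<omega>))"

definition type1_error :: "(real \<Rightarrow> 'a measure) \<Rightarrow> (nat \<Rightarrow> 'a \<Rightarrow> real) \<Rightarrow> nat \<Rightarrow> real \<Rightarrow> real" where
  "type1_error P X n v = measure (P 0) {\<omega> \<in> space (P 0). sign_stat X n \<omega> \<ge> v}"

definition type2_error ::
    "(real \<Rightarrow> 'a measure) \<Rightarrow> (nat \<Rightarrow> 'a \<Rightarrow> real) \<Rightarrow> nat \<Rightarrow> real \<Rightarrow> real \<Rightarrow> real" where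
  "type2_error P X n v \<theta> = measure (P \<theta>) {\<omega> \<in> space (P \<theta>). sign_stat X n \<omega> < v}"

text \<open>The constant \<open>\<gamma> powr \<lambda> / Gamma \<lambda>\<close> normalises \<open>\<theta>\<^bsup>\<lambda>-1\<^esup> e\<^bsup>-\<gamma>\<theta>\<^esup>\<close> on \<open>(0, \<infinity>)\<close>.\<close>

definition gamma_prior :: "real \<Rightarrow> real \<Rightarrow> real measure" where
  "gamma_prior lam gam = density lborel (\<lambda>\<theta>. ennreal (indicator {0<..} \<theta> *
     (gam powr lam / Gamma lam * \<theta> powr (lam - 1) * exp (- gam * \<theta>))))"

text \<open>The integrals are restricted to \<open>\<theta> > 0\<close> because \<open>P \<theta>\<close> is arbitrary for negative \<open>\<theta>\<close>.\<close>

definition bayes_risk ::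
    "(real \<Rightarrow> 'a measure) \<Rightarrow> (nat \<Rightarrow> 'a \<Rightarrow> real) \<Rightarrow> real measure
      \<Rightarrow> real \<Rightarrow> real \<Rightarrow> real \<Rightarrow> real \<Rightarrow> nat \<Rightarrow> real \<Rightarrow> real" where
  "bayes_risk P X Q p0 p1 L0 L1 n v =
     p0 * L0 * type1_error P X n v + p1 * L1 * (LINT \<theta>:{0<..}|Q. type2_error P X n v \<theta>)"

definition bayes_threshold ::
    "(real \<Rightarrow> 'a measure) \<Rightarrow> (nat \<Rightarrow> 'a \<Rightarrow> real) \<Rightarrow> real measure
      \<Rightarrow> real \<Rightarrow> real \<Rightarrow> real \<Rightarrow> real \<Rightarrow> nat \<Rightarrow> real \<Rightarrow> bool" where
  "bayes_threshold P X Q p0 p1 L0 L1 n v \<longleftrightarrow>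
     is_arg_min (bayes_risk P X Q p0 p1 L0 L1 n) (\<lambda>_. True) v"

definition standardised_threshold :: "nat \<Rightarrow> real \<Rightarrow> real" where
  "standardised_threshold n v = (v - real n / 2) / (sqrt (real n) / 2)"

text \<open>Let \<open>\<beta> n \<theta>\<close> be the Type II error of the \<open>n\<close>-th test at \<open>\<theta>\<close>. A positive sequence \<open>s\<close> is the
  critical scale if alternatives up to a constant multiple of \<open>s n\<close> have Type II error bounded away
  from 0, alternatives beyond some constant multiple of \<open>s n\<close> have uniformly vanishing
  Type II error, and all but an arbitrarily small fraction of the prior-averaged Type II error comes
  from \<open>\<theta>\<close> between constant multiples of \<open>s n\<close>. The first three conditions determine \<open>s\<close> up to
  constant factors.\<close>

definition critical_scale :: "real measure \<Rightarrow> (nat \<Rightarrow> real \<Rightarrow> real) \<Rightarrow> (nat \<Rightarrow> real) \<Rightarrow> bool" where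
  "critical_scale Q \<beta> s \<longleftrightarrow>
     (\<forall>\<^sub>F n in sequentially. 0 < s n)
   \<and> (\<exists>c>0. \<exists>\<delta>>0. \<forall>\<^sub>F n in sequentially. \<forall>\<theta>. 0 < \<theta> \<and> \<theta> \<le> c * s n \<longrightarrow> \<delta> \<le> \<beta> n \<theta>)
   \<and> (\<exists>C>0. \<forall>\<epsilon>>0. \<forall>\<^sub>F n in sequentially. \<forall>\<theta>. C * s n \<le> \<theta> \<longrightarrow> \<beta> n \<theta> \<le> \<epsilon>)
   \<and> (\<forall>\<epsilon>>0. \<exists>a>0. \<exists>b>a. \<forall>\<^sub>F n in sequentially.
        (1 - \<epsilon>) * (LINT \<theta>:{0<..}|Q. \<beta> n \<theta>) \<le> (LINT \<theta>:{a * s n..b * s n}|Q. \<beta> n \<theta>))"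

end

theory Submission
  imports Defs "HOL-Probability.Hoeffding" "HOL-Real_Asymp.Real_Asymp"
begin

text \<open>Under \<open>\<theta> \<ge> 0\<close> the statistic \<open>V\<^sub>n\<close> is binomial with success probability
\<open>1 - e\<^bsup>-\<theta>\<^esup>/2\<close> (\<open>prob_sign_stat\<close>), so its law has density
\<open>(2 - e\<^bsup>-\<theta>\<^esup>)\<^sup>k e\<^bsup>-\<theta>(n-k)\<^esup>\<close> at \<open>k\<close> with respect to the null law. Averaging this likelihood ratio
over the prior gives a Bayes factor that increases with \<open>k\<close>, and the Bayes risk of a threshold is
a sum over \<open>k\<close> in which each \<open>k\<close> contributes either its Type I or its Type II cost
(\<open>bayes_risk_eq_sum\<close>). Hence an optimal threshold sits where the Bayes factor crosses the
constant \<open>p0 L0 / (p1 L1)\<close> (\<open>bayes_threshold_le_imp\<close>, \<open>bayes_threshold_gt_imp\<close>).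

The Bayes factor is evaluated by Laplace's method. Write \<open>d = 2k - n\<close>. The logarithm of the
likelihood ratio is \<open>d\<theta> - n\<theta>\<^sup>2/2\<close>, up to a bounded error for \<open>\<theta> \<le> 4d/n\<close> if \<open>d\<^sup>3 \<le> n\<^sup>2\<close>; it peaks near \<open>d/n\<close>,
with width \<open>1/sqrt n\<close>, where the prior density is of order \<open>(d/n)\<^bsup>\<lambda>-1\<^esup>\<close>. So the Bayes factor is of
order \<open>(d/n)\<^bsup>\<lambda>-1\<^esup> exp (d\<^sup>2/(2n)) / sqrt n\<close> (\<open>bayes_factor_lower\<close>, \<open>bayes_factor_upper\<close>). For
\<open>d = sqrt (a n log n)\<close> this is \<open>n\<^bsup>(a-\<lambda>)/2\<^esup>\<close> up to powers of \<open>log n\<close>: it tends to infinity if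
\<open>a > \<lambda>\<close> and to \<open>0\<close> if \<open>a < \<lambda>\<close>, which pins the optimal threshold to \<open>d \<sim> sqrt (\<lambda> n log n)\<close>
(\<open>threshold_limit\<close>).

At the threshold the Bayes factor is of order 1, which determines \<open>exp (-d\<^sup>2/(2n))\<close> up to constants as
\<open>(d/n)\<^bsup>\<lambda>-1\<^esup> / sqrt n\<close>, a much finer statement than the first-order location. The null tail
beyond \<open>k\<close> is of order \<open>(sqrt n / d) exp (-d\<^sup>2/(2n))\<close> (\<open>null_tail_moderate\<close>), so the Type I
error is of order \<open>d\<^bsup>\<lambda>-2\<^esup> n\<^bsup>1-\<lambda>\<^esup>\<close>, that is \<open>n\<^bsup>-\<lambda>/2\<^esup> (log n)\<^bsup>\<lambda>/2-1\<^esup>\<close>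
(\<open>threshold_type1_bigtheta\<close>).

For the critical scale put \<open>t = sqrt (log n / n)\<close>. Hoeffding's inequality shows that the Type II error is at least
\<open>1/2\<close> for \<open>\<theta>\<close> below a small multiple of \<open>t\<close>, and smaller than any prescribed power of \<open>n\<close> above
a large multiple. The prior-averaged Type II error is therefore of order \<open>t\<^sup>\<lambda>\<close>, up to an arbitrarily small
fraction all of it comes from \<open>\<theta>\<close> comparable with \<open>t\<close>, and no scale of a different order can
separate the two regimes (\<open>critical_scale_gamma_prior_iff\<close>).\<close>

section \<open>The law of the sign statistic\<close>

lemma nn_integral_laplace_density_pos:
  assumes "\<theta> \<ge> 0"
  shows "(\<integral>\<^sup>+x. ennreal (laplace_density \<theta> x) * indicator {0<..} x \<partial>lborel) = ennreal (1 - exp (- \<theta>) / 2)"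
proof -
  have 1: "(\<integral>\<^sup>+x. ennreal (exp (x - \<theta>) / 2) * indicator {0..\<theta>} x \<partial>lborel)
      = ennreal (exp (\<theta> - \<theta>) / 2 - exp (0 - \<theta>) / 2)"
    using assms by (intro nn_integral_FTC_Icc) (auto intro!: derivative_eq_intros)
  have lim: "((\<lambda>x. - exp (\<theta> - x) / 2) \<longlongrightarrow> 0) at_top" by real_asymp
  have 2: "(\<integral>\<^sup>+x. ennreal (exp (\<theta> - x) / 2) * indicator {\<theta>..} x \<partial>lborel)
      = ennreal (0 - (- exp (\<theta> - \<theta>) / 2))"
    by (intro nn_integral_FTC_atLeast[OF _ _ _ lim]) (auto intro!: derivative_eq_intros)
  have "AE x in lborel. x \<noteq> 0 \<and> x \<noteq> \<theta>"
    using AE_lborel_singleton[of 0] AE_lborel_singleton[of \<theta>] by eventually_elim auto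
  then have "(\<integral>\<^sup>+x. ennreal (laplace_density \<theta> x) * indicator {0<..} x \<partial>lborel)
     = (\<integral>\<^sup>+x. ennreal (exp (x - \<theta>) / 2) * indicator {0..\<theta>} x
           + ennreal (exp (\<theta> - x) / 2) * indicator {\<theta>..} x \<partial>lborel)"
    by (intro nn_integral_cong_AE, eventually_elim)
       (use assms in \<open>auto simp: laplace_density_def indicator_def\<close>)
  also have "\<dots> = ennreal (exp (\<theta> - \<theta>) / 2 - exp (0 - \<theta>) / 2) + ennreal (0 - (- exp (\<theta> - \<theta>) / 2))"
    by (subst nn_integral_add) (simp_all only: 1 2, auto)
  also have "\<dots> = ennreal (1 - exp (- \<theta>) / 2)"
    using assms by (subst ennreal_plus[symmetric]) auto
  finally show ?thesis .
qed

definition null_pmf :: "nat \<Rightarrow> nat \<Rightarrow> real" where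
  "null_pmf n k = real (n choose k) / 2 ^ n"

text \<open>The likelihood ratio of \<open>V\<^sub>n = k\<close> at \<open>\<theta>\<close> against \<open>\<theta> = 0\<close>: both success and failure
probabilities are divided by their null value \<open>1/2\<close>.\<close>

definition lik_ratio :: "nat \<Rightarrow> nat \<Rightarrow> real \<Rightarrow> real" where
  "lik_ratio n k \<theta> = (2 - exp (- \<theta>)) ^ k * exp (- \<theta>) ^ (n - k)"

lemma prob_pos_in_unit: "\<theta> \<ge> 0 \<Longrightarrow> 1 - exp (- \<theta>) / 2 \<in> {0..1::real}"
  using exp_ge_zero[of "-\<theta>"] exp_le_one_iff[of "-\<theta>"] unfolding atLeastAtMost_iff
  by linarith

text \<open>All later estimates concern the two factors separately: the null probability carries the
combinatorics, the likelihood ratio carries the dependence on \<open>\<theta>\<close>.\<close>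

lemma pmf_sign_stat:
  assumes "\<theta> \<ge> 0" "k \<le> n"
  shows "pmf (binomial_pmf n (1 - exp (- \<theta>) / 2)) k = null_pmf n k * lik_ratio n k \<theta>"
proof -
  have "(2::real) ^ n = 2 ^ k * 2 ^ (n - k)"
    using assms(2) by (simp flip: power_add)
  moreover have "(1 - exp (- \<theta>) / 2) ^ k = (2 - exp (-\<theta>)) ^ k / 2 ^ k"
    unfolding power_divide[symmetric] by (simp add: diff_divide_distrib)
  moreover have "pmf (binomial_pmf n (1 - exp (- \<theta>) / 2)) k
      = (n choose k) * (1 - exp (- \<theta>) / 2) ^ k * (exp (- \<theta>) / 2) ^ (n - k)"
    using prob_pos_in_unit[OF assms(1)] by simp
  ultimately show ?thesis
    by (simp add: null_pmf_def lik_ratio_def power_divide)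
qed

text \<open>Induction on the sample size: the last sign is independent of the sum of the earlier ones, so
the distribution of the sum satisfies Pascal's recurrence.\<close>

lemma prob_sign_stat:
  assumes model: "laplace_model P X" and \<theta>: "\<theta> \<ge> 0"
  shows "measure (P \<theta>) {\<omega> \<in> space (P \<theta>). sign_stat X n \<omega> = real k}
           = pmf (binomial_pmf n (1 - exp (- \<theta>) / 2)) k"
proof -
  define p where "p = 1 - exp (- \<theta>) / 2"
  have p: "p \<in> {0..1}" using prob_pos_in_unit[OF \<theta>] by (simp add: p_def)
  interpret prob_space "P \<theta>" using model \<theta> by (simp add: laplace_model_def)
  have ind: "indep_vars (\<lambda>_. borel) X UNIV"
    and dist: "\<And>i. distributed (P \<theta>) lborel (X i) (\<lambda>x. ennreal (laplace_density \<theta> x))"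
    using model \<theta> by (auto simp: laplace_model_def)
  have X[measurable]: "random_variable borel (X i)" for i
    using distributed_measurable[OF dist] by simp
  define Y where "Y = (\<lambda>i \<omega>. indicator {0<..} (X i \<omega>) :: real)"
  have indY: "indep_vars (\<lambda>_. borel) Y UNIV"
    unfolding Y_def by (rule indep_vars_compose2[OF ind]) auto
  have S[measurable]: "random_variable borel (sign_stat X m)" for m
    unfolding sign_stat_def[abs_def] by measurable
  have pos: "prob {\<omega> \<in> space (P \<theta>). 0 < X i \<omega>} = p" for i
  proof -
    have "{\<omega> \<in> space (P \<theta>). 0 < X i \<omega>} = X i -` {0<..} \<inter> space (P \<theta>)" by auto
    then have "emeasure (P \<theta>) {\<omega> \<in> space (P \<theta>). 0 < X i \<omega>} = ennreal p"
      using distributed_emeasure[OF dist, of "{0<..}" i] nn_integral_laplace_density_pos[OF \<theta>]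
      by (simp add: p_def)
    then show ?thesis using p by (simp add: measure_def)
  qed
  have nonpos: "prob {\<omega> \<in> space (P \<theta>). X i \<omega> \<le> 0} = 1 - p" for i
  proof -
    have "{\<omega> \<in> space (P \<theta>). X i \<omega> \<le> 0} = space (P \<theta>) - {\<omega> \<in> space (P \<theta>). 0 < X i \<omega>}" by auto
    then show ?thesis by (simp add: prob_compl pos)
  qed
  have indS: "indep_var borel (Y n) borel (sign_stat X n)" for n
    using indep_vars_sum[of "{..<n}" n Y] indep_vars_subset[OF indY, of "insert n {..<n}"]
    by (simp add: sign_stat_def[abs_def] Y_def)
  have step: "prob {\<omega> \<in> space (P \<theta>). Y n \<omega> = y \<and> sign_stat X n \<omega> = s}
      = prob {\<omega> \<in> space (P \<theta>). Y n \<omega> = y} * prob {\<omega> \<in> space (P \<theta>). sign_stat X n \<omega> = s}"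
    for n y s
  proof -
    have "(\<lambda>x. (Y n x, sign_stat X n x)) -` ({y} \<times> {s}) \<inter> space (P \<theta>)
        = {\<omega> \<in> space (P \<theta>). Y n \<omega> = y \<and> sign_stat X n \<omega> = s}"
      "Y n -` {y} \<inter> space (P \<theta>) = {\<omega> \<in> space (P \<theta>). Y n \<omega> = y}"
      "sign_stat X n -` {s} \<inter> space (P \<theta>) = {\<omega> \<in> space (P \<theta>). sign_stat X n \<omega> = s}"
      by auto
    then show ?thesis
      using indep_varD[OF indS, of "{y}" "{s}" n] by simp
  qed
  have Y1: "prob {\<omega> \<in> space (P \<theta>). Y n \<omega> = 1} = p" for n
    using pos[of n] by (simp add: Y_def indicator_def)
  have Y0: "prob {\<omega> \<in> space (P \<theta>). Y n \<omega> = 0} = 1 - p" for n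
    using nonpos[of n] by (simp add: Y_def indicator_def not_less)
  have [measurable]: "random_variable borel (Y m)" for m
    unfolding Y_def by measurable
  have S_ge: "sign_stat X n \<omega> \<ge> 0" for n \<omega>
    by (auto simp: sign_stat_def intro!: sum_nonneg)
  have "prob {\<omega> \<in> space (P \<theta>). sign_stat X n \<omega> = real k} = (n choose k) * p ^ k * (1 - p) ^ (n - k)"
  proof (induction n arbitrary: k)
    case 0
    have "{\<omega> \<in> space (P \<theta>). (0::real) = real k} = (if k = 0 then space (P \<theta>) else {})"
      by auto
    then show ?case by (simp add: sign_stat_def prob_space)
  next
    case (Suc n)
    have S_Suc: "sign_stat X (Suc n) \<omega> = sign_stat X n \<omega> + Y n \<omega>" for \<omega>
      by (simp add: sign_stat_def Y_def)
    define E1 where "E1 = {\<omega> \<in> space (P \<theta>). Y n \<omega> = 1 \<and> sign_stat X n \<omega> = real k - 1}"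
    define E0 where "E0 = {\<omega> \<in> space (P \<theta>). Y n \<omega> = 0 \<and> sign_stat X n \<omega> = real k}"
    have "{\<omega> \<in> space (P \<theta>). sign_stat X (Suc n) \<omega> = real k} = E1 \<union> E0"
      by (auto simp: S_Suc Y_def indicator_def E0_def E1_def)
    moreover have "E1 \<in> events" "E0 \<in> events" "E1 \<inter> E0 = {}"
      unfolding E0_def E1_def by (measurable, measurable, auto)
    ultimately have "prob {\<omega> \<in> space (P \<theta>). sign_stat X (Suc n) \<omega> = real k} = prob E1 + prob E0"
      by (simp add: finite_measure_Union)
    also have "\<dots> = p * prob {\<omega> \<in> space (P \<theta>). sign_stat X n \<omega> = real k - 1}
        + (1 - p) * prob {\<omega> \<in> space (P \<theta>). sign_stat X n \<omega> = real k}"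
      unfolding E1_def E0_def step Y0 Y1 ..
    also have "\<dots> = (Suc n choose k) * p ^ k * (1 - p) ^ (Suc n - k)"
    proof (cases k)
      case 0
      have "sign_stat X n \<omega> \<noteq> - 1" for \<omega>
        using S_ge[of n \<omega>] by linarith
      then have "prob {\<omega> \<in> space (P \<theta>). sign_stat X n \<omega> = - 1} = 0"
        by simp
      then show ?thesis using Suc.IH[of 0] by (simp add: 0)
    next
      case (Suc j)
      have eq: "(1 - p) * ((n choose Suc j) * p ^ Suc j * (1 - p) ^ (n - Suc j))
          = (n choose Suc j) * p ^ Suc j * (1 - p) ^ (n - j)"
      proof (cases "Suc j \<le> n")
        case True
        then have "n - j = Suc (n - Suc j)" by simp
        then show ?thesis by simp
      qed simp
      have "real (Suc j) - 1 = real j" by simp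
      then show ?thesis
        using Suc.IH[of j] Suc.IH[of "Suc j"] eq
        by (simp add: Suc algebra_simps)
    qed
    finally show ?case .
  qed
  then show ?thesis using p by (simp flip: p_def)
qed

text \<open>The first form gives access to Hoeffding's inequality for binomial variables, the second to
the decomposition of the Bayes risk.\<close>

lemma prob_sign_stat_Collect:
  assumes model: "laplace_model P X" and \<theta>: "\<theta> \<ge> 0"
  shows "measure (P \<theta>) {\<omega> \<in> space (P \<theta>). R (sign_stat X n \<omega>)}
           = measure_pmf.prob (binomial_pmf n (1 - exp (- \<theta>) / 2)) {k. R (real k)}"
    and "measure (P \<theta>) {\<omega> \<in> space (P \<theta>). R (sign_stat X n \<omega>)}
           = (\<Sum>k | k \<le> n \<and> R (real k). null_pmf n k * lik_ratio n k \<theta>)"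
proof -
  interpret prob_space "P \<theta>" using model \<theta> by (simp add: laplace_model_def)
  have X[measurable]: "random_variable borel (X i)" for i
    using model \<theta> distributed_measurable by (fastforce simp: laplace_model_def)
  have [measurable]: "random_variable borel (sign_stat X m)" for m
    unfolding sign_stat_def[abs_def] by measurable
  have range: "\<exists>k\<le>n. sign_stat X n \<omega> = real k" for \<omega>
  proof -
    have "sign_stat X n \<omega> = real (card {i\<in>{..<n}. X i \<omega> > 0})"
      by (simp add: sign_stat_def indicator_def sum.If_cases Int_def flip: sum.inter_filter)
    moreover have "card {i\<in>{..<n}. X i \<omega> > 0} \<le> n"
      using card_mono[of "{..<n}" "{i\<in>{..<n}. X i \<omega> > 0}"] by auto
    ultimately show ?thesis by blast
  qed
  let ?K = "{k. k \<le> n \<and> R (real k)}"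
  have "{\<omega> \<in> space (P \<theta>). R (sign_stat X n \<omega>)}
      = (\<Union>k\<in>?K. {\<omega> \<in> space (P \<theta>). sign_stat X n \<omega> = real k})"
  proof (rule set_eqI)
    fix \<omega>
    from range obtain k where "k \<le> n" "sign_stat X n \<omega> = real k" by blast
    then show "\<omega> \<in> {\<omega> \<in> space (P \<theta>). R (sign_stat X n \<omega>)}
      \<longleftrightarrow> \<omega> \<in> (\<Union>k\<in>?K. {\<omega> \<in> space (P \<theta>). sign_stat X n \<omega> = real k})"
      by auto
  qed
  also have "prob \<dots> = (\<Sum>k\<in>?K. prob {\<omega> \<in> space (P \<theta>). sign_stat X n \<omega> = real k})"
    by (intro finite_measure_finite_Union) (auto simp: disjoint_family_on_def)
  finally have 1: "prob {\<omega> \<in> space (P \<theta>). R (sign_stat X n \<omega>)}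
     = (\<Sum>k\<in>?K. pmf (binomial_pmf n (1 - exp (- \<theta>) / 2)) k)"
    by (simp add: prob_sign_stat[OF model \<theta>])
  then show "prob {\<omega> \<in> space (P \<theta>). R (sign_stat X n \<omega>)}
      = (\<Sum>k\<in>?K. null_pmf n k * lik_ratio n k \<theta>)"
    using pmf_sign_stat[OF \<theta>] by simp
  have "measure_pmf.prob (binomial_pmf n (1 - exp (- \<theta>) / 2)) {k. R (real k)}
     = measure_pmf.prob (binomial_pmf n (1 - exp (- \<theta>) / 2)) ?K"
    using prob_pos_in_unit[OF \<theta>]
    by (intro measure_pmf.finite_measure_eq_AE)
       (auto simp: AE_measure_pmf_iff set_pmf_binomial_eq split: if_splits)
  also have "\<dots> = (\<Sum>k\<in>?K. pmf (binomial_pmf n (1 - exp (- \<theta>) / 2)) k)"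
    by (intro measure_measure_pmf_finite) auto
  finally show "prob {\<omega> \<in> space (P \<theta>). R (sign_stat X n \<omega>)}
     = measure_pmf.prob (binomial_pmf n (1 - exp (- \<theta>) / 2)) {k. R (real k)}"
    using 1 by simp
qed

lemma lik_ratio_nonneg: "\<theta> \<ge> 0 \<Longrightarrow> 0 \<le> lik_ratio n k \<theta>"
proof -
  assume "\<theta> \<ge> 0"
  then have "exp (-\<theta>) \<le> 1" by simp
  then have "0 \<le> 2 - exp (-\<theta>)" by linarith
  then show ?thesis by (simp add: lik_ratio_def)
qed

lemma null_pmf_pos: "k \<le> n \<Longrightarrow> 0 < null_pmf n k"
  by (simp add: null_pmf_def)

lemma type1_error_eq_sum:
  assumes "laplace_model P X"
  shows "type1_error P X n v = (\<Sum>k | k \<le> n \<and> v \<le> real k. null_pmf n k)"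
  using prob_sign_stat_Collect(2)[OF assms, of 0 "\<lambda>x. v \<le> x" n]
  by (simp add: type1_error_def lik_ratio_def)

lemma type2_error_eq_sum:
  assumes "laplace_model P X" "\<theta> \<ge> 0"
  shows "type2_error P X n v \<theta> = (\<Sum>k | k \<le> n \<and> real k < v. null_pmf n k * lik_ratio n k \<theta>)"
  using prob_sign_stat_Collect(2)[OF assms, of "\<lambda>x. x < v" n]
  by (simp add: type2_error_def)

section \<open>Quadratic bounds for the log-likelihood ratio\<close>

text \<open>The Taylor expansion of \<open>ln (2 - e\<^bsup>-\<theta>\<^esup>)\<close> starts with \<open>\<theta> - \<theta>\<^sup>2 + \<theta>\<^sup>3\<close>. For all
\<open>\<theta> \<ge> 0\<close>, its derivative \<open>1/(2e\<^sup>\<theta> - 1)\<close> lies between \<open>1 - 2\<theta>\<close> and \<open>1 - 2\<theta> + 4\<theta>\<^sup>2\<close>; integrating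
gives this bound and the next.\<close>

lemma ln_two_minus_exp_lower:
  assumes "\<theta> \<ge> (0::real)"
  shows "\<theta> - \<theta>\<^sup>2 \<le> ln (2 - exp (- \<theta>))"
proof -
  define f where "f = (\<lambda>t::real. ln (2 - exp (- t)) - (t - t\<^sup>2))"
  have "f 0 \<le> f \<theta>"
  proof (rule DERIV_nonneg_imp_nondecreasing[OF assms])
    fix t :: real assume t: "0 \<le> t" "t \<le> \<theta>"
    define y where "y = exp (- t)"
    have y: "0 < y" "y \<le> 1" "1 - t \<le> y"
      using t exp_ge_add_one_self[of "-t"] by (auto simp: y_def)
    have "exp (- t) < 2" using y by (simp add: y_def del: exp_le_one_iff)
    then have "(f has_real_derivative y / (2 - y) - (1 - 2 * t)) (at t)"
      unfolding f_def by (auto intro!: derivative_eq_intros simp: y_def)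
    moreover have "1 - 2 * t \<le> y * (1 - t)"
    proof (cases "t \<le> 1")
      case True
      then have "(1 - t) * (1 - t) \<le> y * (1 - t)" using y by (intro mult_right_mono) auto
      then show ?thesis by (simp add: algebra_simps) (smt (verit) zero_le_square)
    next
      case False
      then have "1 * (1 - t) \<le> y * (1 - t)" using y by (intro mult_right_mono_neg) auto
      then show ?thesis using t by simp
    qed
    then have "(1 - 2 * t) * (2 - y) \<le> y" by (simp add: algebra_simps)
    then have "1 - 2 * t \<le> y / (2 - y)" using y by (simp add: pos_le_divide_eq)
    ultimately show "\<exists>y. (f has_real_derivative y) (at t) \<and> 0 \<le> y" by auto
  qed
  then show ?thesis by (simp add: f_def)
qed

lemma ln_two_minus_exp_upper:
  assumes "\<theta> \<ge> (0::real)"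
  shows "ln (2 - exp (- \<theta>)) \<le> \<theta> - \<theta>\<^sup>2 + 4 / 3 * \<theta> ^ 3"
proof -
  define f where "f = (\<lambda>t::real. (t - t\<^sup>2 + 4 / 3 * t ^ 3) - ln (2 - exp (- t)))"
  have "f 0 \<le> f \<theta>"
  proof (rule DERIV_nonneg_imp_nondecreasing[OF assms])
    fix t :: real assume t: "0 \<le> t" "t \<le> \<theta>"
    define y where "y = exp (- t)"
    have y: "0 < y" "y \<le> 1" using t by (auto simp: y_def)
    have "y \<le> 1 / (1 + t)"
      using exp_ge_add_one_self[of t] t by (simp add: y_def exp_minus field_simps)
    have "exp (- t) < 2" using y by (simp add: y_def del: exp_le_one_iff)
    then have d: "(f has_real_derivative (1 - 2 * t + 4 * t\<^sup>2) - y / (2 - y)) (at t)"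
      unfolding f_def
      by (auto intro!: derivative_eq_intros simp: y_def power2_eq_square)
    have pos: "0 \<le> 1 - t + 2 * t\<^sup>2"
    proof -
      have "1 - t + 2 * t\<^sup>2 = (1 - t / 2)\<^sup>2 + 7 / 4 * t\<^sup>2" by (simp add: power2_eq_square algebra_simps)
      then show ?thesis by simp
    qed
    then have "y * (1 - t + 2 * t\<^sup>2) \<le> 1 / (1 + t) * (1 - t + 2 * t\<^sup>2)"
      using \<open>y \<le> 1 / (1 + t)\<close> by (intro mult_right_mono) auto
    also have "\<dots> \<le> 1 - 2 * t + 4 * t\<^sup>2"
    proof -
      have "1 - t + 2 * t\<^sup>2 \<le> (1 - 2 * t + 4 * t\<^sup>2) * (1 + t)"
        using t by (simp add: algebra_simps power2_eq_square)
      then show ?thesis using t by (simp add: divide_le_eq)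
    qed
    finally have "y \<le> (1 - 2 * t + 4 * t\<^sup>2) * (2 - y)" by (simp add: algebra_simps)
    then have "y / (2 - y) \<le> 1 - 2 * t + 4 * t\<^sup>2" using y by (simp add: pos_divide_le_eq)
    with d show "\<exists>y. (f has_real_derivative y) (at t) \<and> 0 \<le> y" by force
  qed
  then show ?thesis by (simp add: f_def)
qed

lemma lik_ratio_eq_exp:
  assumes "\<theta> \<ge> 0"
  shows "lik_ratio n k \<theta> = exp (real k * ln (2 - exp (- \<theta>)) - real (n - k) * \<theta>)"
proof -
  have "exp (-\<theta>) \<le> 1" using assms by simp
  then have "0 < 2 - exp (-\<theta>)" by linarith
  moreover have "exp (- \<theta>) ^ (n - k) = exp (- (real (n - k) * \<theta>))"
    by (simp flip: exp_of_nat_mult)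
  ultimately show ?thesis
    by (simp add: lik_ratio_def exp_diff exp_of_nat_mult exp_minus divide_inverse)
qed

text \<open>Twice the distance of \<open>k\<close> from the null mean \<open>n/2\<close>; the standardised deviation of \<open>k\<close> is
\<open>excess n k / sqrt n\<close>.\<close>

definition excess :: "nat \<Rightarrow> nat \<Rightarrow> real" where
  "excess n k = 2 * real k - real n"

lemma lik_ratio_lower:
  assumes "\<theta> \<ge> 0" "k \<le> n"
  shows "exp (excess n k * \<theta> - real k * \<theta>\<^sup>2) \<le> lik_ratio n k \<theta>"
proof -
  have "real k * (\<theta> - \<theta>\<^sup>2) \<le> real k * ln (2 - exp (- \<theta>))"
    using ln_two_minus_exp_lower[OF assms(1)] by (intro mult_left_mono) auto
  then show ?thesis using assms
    by (simp add: lik_ratio_eq_exp excess_def of_nat_diff algebra_simps)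
qed

lemma lik_ratio_upper:
  assumes "\<theta> \<ge> 0" "k \<le> n"
  shows "lik_ratio n k \<theta> \<le> exp (excess n k * \<theta> - real k * \<theta>\<^sup>2 + 4 / 3 * real k * \<theta> ^ 3)"
proof -
  have "real k * ln (2 - exp (- \<theta>)) \<le> real k * (\<theta> - \<theta>\<^sup>2 + 4 / 3 * \<theta> ^ 3)"
    using ln_two_minus_exp_upper[OF assms(1)] by (intro mult_left_mono) auto
  then show ?thesis using assms
    by (simp add: lik_ratio_eq_exp excess_def of_nat_diff algebra_simps)
qed

text \<open>The range in which Gaussian approximation holds up to constant factors: the cubic term of the
log-likelihood ratio at its peak is of order \<open>d\<^sup>3/n\<^sup>2\<close>, and the peak \<open>d/n\<close> is at least as far
from \<open>0\<close> as its width \<open>1/sqrt n\<close>. Thresholds of order \<open>sqrt (n log n)\<close> fall well inside for large \<open>n\<close>.\<close>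

definition moderate_dev :: "nat \<Rightarrow> nat \<Rightarrow> bool" where
  "moderate_dev n k \<longleftrightarrow> 0 < n \<and> k \<le> n \<and> sqrt (real n) \<le> excess n k
     \<and> 2 * excess n k \<le> real n \<and> excess n k ^ 3 \<le> (real n)\<^sup>2"

lemma moderate_devD:
  assumes "moderate_dev n k"
  defines "m \<equiv> excess n k / n"
  shows "0 < n" "k \<le> n" "0 < excess n k" "0 < m" "m \<le> 1 / 2" "1 / sqrt n \<le> m"
    "real n \<le> 2 * real k" "real n * m ^ 3 \<le> 1" "excess n k * m\<^sup>2 \<le> 1" "excess n k = m * n"
proof -
  show n: "0 < n" and k: "k \<le> n" using assms(1) by (auto simp: moderate_dev_def)
  have s: "sqrt n > 0" using n by simp
  then show d: "0 < excess n k" using assms(1) unfolding moderate_dev_def by linarith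
  then show "0 < m" using n by (simp add: m_def)
  show "m \<le> 1 / 2" using n assms(1) by (auto simp: moderate_dev_def m_def field_simps)
  have "sqrt n / n \<le> m" using assms(1) n
    unfolding m_def by (intro divide_right_mono) (auto simp: moderate_dev_def)
  moreover have "sqrt n / n = 1 / sqrt n" using n by (simp add: field_simps)
  ultimately show "1 / sqrt n \<le> m" by simp
  show "real n \<le> 2 * real k" using d by (simp add: excess_def)
  have "real n * m ^ 3 = excess n k ^ 3 / (real n)\<^sup>2"
    using n by (simp add: m_def power_divide power2_eq_square power3_eq_cube)
  also have "\<dots> \<le> 1" using assms(1) n by (simp add: moderate_dev_def)
  finally show "real n * m ^ 3 \<le> 1" .
  then show "excess n k * m\<^sup>2 \<le> 1"
    using n by (simp add: m_def power_divide power2_eq_square power3_eq_cube field_simps)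
  show "excess n k = m * n" using n by (simp add: m_def)
qed

lemma complete_square:
  fixes d n x :: real
  assumes "n \<noteq> 0"
  shows "d * x - n / 2 * x\<^sup>2 = d\<^sup>2 / (2 * n) - n / 2 * (x - d / n)\<^sup>2"
  using assms by (simp add: field_simps power2_eq_square)

text \<open>Completing the square, the exponent drops by at most \<open>1/2\<close> within one width \<open>1/sqrt n\<close> of the
peak; the term \<open>d\<theta>\<^sup>2/2\<close> by which \<open>k\<theta>\<^sup>2\<close> exceeds \<open>n\<theta>\<^sup>2/2\<close> costs at most \<open>2\<close> more. The window is taken
to the right of the peak so that it stays inside \<open>\<theta> > 0\<close>.\<close>

lemma lik_ratio_near_peak:
  assumes md: "moderate_dev n k"
    and \<theta>: "excess n k / n \<le> \<theta>" "\<theta> \<le> excess n k / n + 1 / sqrt n"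
  shows "exp (- 5 / 2) * exp ((excess n k)\<^sup>2 / (2 * real n)) \<le> lik_ratio n k \<theta>"
proof -
  define d m where "d = excess n k" and "m = excess n k / n"
  note D = moderate_devD[OF md, folded m_def d_def]
  have \<theta>': "m \<le> \<theta>" "\<theta> \<le> m + 1 / sqrt n" using \<theta> by (auto simp: m_def)
  have "(\<theta> - d / n)\<^sup>2 \<le> (1 / sqrt n)\<^sup>2"
    using \<theta> by (intro power_mono) (auto simp: d_def)
  then have "n / 2 * (\<theta> - d / n)\<^sup>2 \<le> n / 2 * (1 / sqrt n)\<^sup>2"
    by (intro mult_left_mono) auto
  also have "\<dots> = 1 / 2" using D(1) by (simp add: power_divide)
  finally have 1: "d\<^sup>2 / (2 * real n) - 1 / 2 \<le> d * \<theta> - n / 2 * \<theta>\<^sup>2"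
    using complete_square[of "real n" d \<theta>] D(1) by simp
  have "d / 2 * \<theta>\<^sup>2 \<le> d / 2 * (2 * m)\<^sup>2"
    using D \<theta>' by (intro mult_left_mono power_mono) auto
  also have "\<dots> \<le> 2" using D by simp
  finally have 2: "d / 2 * \<theta>\<^sup>2 \<le> 2" .
  have k: "real k = n / 2 + d / 2" by (simp add: d_def excess_def field_simps)
  have "d * \<theta> - real k * \<theta>\<^sup>2 = (d * \<theta> - n / 2 * \<theta>\<^sup>2) - d / 2 * \<theta>\<^sup>2"
    unfolding k by (simp add: algebra_simps)
  then have "- 5 / 2 + d\<^sup>2 / (2 * real n) \<le> d * \<theta> - real k * \<theta>\<^sup>2"
    using 1 2 by simp
  then have "exp (- 5 / 2 + d\<^sup>2 / (2 * real n)) \<le> exp (d * \<theta> - real k * \<theta>\<^sup>2)" by simp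
  also have "\<dots> \<le> lik_ratio n k \<theta>"
    unfolding d_def using \<theta>' D by (intro lik_ratio_lower) auto
  finally show ?thesis unfolding d_def exp_add[symmetric] .
qed

lemma lik_ratio_le_gauss:
  assumes md: "moderate_dev n k"
    and \<theta>: "0 \<le> \<theta>" "\<theta> \<le> 4 * (excess n k / n)"
  shows "lik_ratio n k \<theta> \<le> exp 86 * exp (excess n k * \<theta> - n / 2 * \<theta>\<^sup>2)"
proof -
  define d m where "d = excess n k" and "m = excess n k / n"
  note D = moderate_devD[OF md, folded m_def d_def]
  \<comment> \<open>The constant 86 is the cubic error at the right end of the range: \<open>4/3 * 4\<^sup>3 = 256/3 < 86\<close>.\<close>
  have "4 / 3 * real k * \<theta> ^ 3 \<le> 4 / 3 * real n * (4 * m) ^ 3"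
    using \<theta> D by (intro mult_mono power_mono) (auto simp: m_def)
  also have "\<dots> = 256 / 3 * (real n * m ^ 3)" by (simp add: power_mult_distrib)
  also have "\<dots> \<le> 256 / 3 * 1" using D by (intro mult_left_mono) auto
  finally have 1: "4 / 3 * real k * \<theta> ^ 3 \<le> 86" by simp
  have "n / 2 * \<theta>\<^sup>2 \<le> real k * \<theta>\<^sup>2" using D by (intro mult_right_mono) auto
  with 1 have "d * \<theta> - real k * \<theta>\<^sup>2 + 4 / 3 * real k * \<theta> ^ 3 \<le> 86 + (d * \<theta> - n / 2 * \<theta>\<^sup>2)"
    by simp
  then have "exp (d * \<theta> - real k * \<theta>\<^sup>2 + 4 / 3 * real k * \<theta> ^ 3) \<le> exp (86 + (d * \<theta> - n / 2 * \<theta>\<^sup>2))"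
    by simp
  moreover have "lik_ratio n k \<theta> \<le> exp (d * \<theta> - real k * \<theta>\<^sup>2 + 4 / 3 * real k * \<theta> ^ 3)"
    unfolding d_def using \<theta> D by (intro lik_ratio_upper) auto
  ultimately show ?thesis unfolding d_def exp_add[symmetric] by linarith
qed

text \<open>With \<open>y = e\<^bsup>-\<theta>\<^esup>\<close>, the logarithm of the likelihood ratio decreases in \<open>\<theta>\<close> once
\<open>y \<le> 1 - d/n\<close>, in particular from \<open>4d/n\<close> on. This
controls arbitrarily large \<open>\<theta>\<close>, where the cubic bound is useless.\<close>

lemma lik_ratio_decreasing:
  assumes md: "moderate_dev n k"
    and \<theta>: "4 * (excess n k / n) \<le> \<theta>" "\<theta> \<le> \<theta>'"
  shows "lik_ratio n k \<theta>' \<le> lik_ratio n k \<theta>"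
proof -
  define m where "m = excess n k / n"
  note D = moderate_devD[OF md, folded m_def]
  have "4 * m \<le> \<theta>" using \<theta> by (simp add: m_def)
  define f where "f = (\<lambda>t. real k * ln (2 - exp (- t)) - real (n - k) * t)"
  have "f \<theta>' \<le> f \<theta>"
  proof (rule DERIV_nonpos_imp_nonincreasing[OF \<theta>(2)])
    fix t assume t: "\<theta> \<le> t" "t \<le> \<theta>'"
    have t4: "4 * m \<le> t" using t \<open>4 * m \<le> \<theta>\<close> by simp
    define y where "y = exp (- t)"
    have y: "0 < y" "y \<le> 1" using t4 D by (auto simp: y_def)
    have "y \<le> exp (- (4 * m))" using t4 by (simp add: y_def)
    also have "\<dots> \<le> 1 / (1 + 4 * m)"
      using exp_ge_add_one_self[of "4 * m"] D by (simp add: exp_minus field_simps)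
    also have "\<dots> \<le> 1 - m"
    proof -
      have "m * m \<le> m * (1 / 2)" using D by (intro mult_left_mono) auto
      then have "1 \<le> (1 - m) * (1 + 4 * m)" using D(4) by (simp add: algebra_simps)
      then show ?thesis using D(4) by (simp add: pos_divide_le_eq)
    qed
    finally have "n * y \<le> n * (1 - m)" by (intro mult_left_mono) auto
    also have "\<dots> = 2 * real (n - k)"
    proof -
      have "n * m = excess n k" using D by simp
      then show ?thesis using D by (simp add: excess_def of_nat_diff algebra_simps)
    qed
    finally have "real k * y \<le> real (n - k) * (2 - y)"
      using D by (simp add: of_nat_diff algebra_simps)
    then have "real k * (y / (2 - y)) - real (n - k) \<le> 0"
      using y by (simp add: divide_le_eq)
    moreover have "exp (- t) < 2" using y by (simp add: y_def del: exp_le_one_iff)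
    then have "(f has_real_derivative real k * (y / (2 - y)) - real (n - k)) (at t)"
      unfolding f_def by (auto intro!: derivative_eq_intros simp: y_def)
    ultimately show "\<exists>y. (f has_real_derivative y) (at t) \<and> y \<le> 0" by blast
  qed
  moreover have "\<theta> \<ge> 0" using \<open>4 * m \<le> \<theta>\<close> D by simp
  ultimately show ?thesis using \<theta> by (simp add: lik_ratio_eq_exp f_def)
qed

text \<open>By monotonicity the value at \<open>4d/n\<close> is an upper bound, and there the quadratic exponent is already
negative: \<open>4d\<^sup>2/n - 8d\<^sup>2/n\<close>.\<close>

lemma lik_ratio_tail:
  assumes md: "moderate_dev n k" and \<theta>: "4 * (excess n k / n) \<le> \<theta>"
  shows "lik_ratio n k \<theta> \<le> exp 86 * exp (- 4 * (excess n k)\<^sup>2 / n)"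
proof -
  note D = moderate_devD[OF md]
  have "lik_ratio n k \<theta> \<le> lik_ratio n k (4 * (excess n k / n))"
    by (rule lik_ratio_decreasing[OF md]) (use \<theta> in auto)
  also have "\<dots> \<le> exp 86 * exp (excess n k * (4 * (excess n k / n)) - n / 2 * (4 * (excess n k / n))\<^sup>2)"
    using D by (intro lik_ratio_le_gauss[OF md]) auto
  also have "excess n k * (4 * (excess n k / n)) - n / 2 * (4 * (excess n k / n))\<^sup>2
     = - 4 * (excess n k)\<^sup>2 / n"
    using D(1) by (simp add: power2_eq_square field_simps)
  finally show ?thesis .
qed

text \<open>At half the peak location the exponent has reached \<open>3/4\<close> of its maximum \<open>d\<^sup>2/(2n)\<close>. The loss
\<open>exp (-d\<^sup>2/(8n))\<close> compensates the prior mass near \<open>0\<close>, where the prior density is unbounded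
if \<open>\<lambda> < 1\<close>.\<close>

lemma lik_ratio_left:
  assumes md: "moderate_dev n k" and \<theta>: "0 \<le> \<theta>" "\<theta> \<le> (excess n k / n) / 2"
  shows "lik_ratio n k \<theta> \<le> exp 86 * exp (3 / 8 * ((excess n k)\<^sup>2 / n))"
proof -
  define d m where "d = excess n k" and "m = excess n k / n"
  note D = moderate_devD[OF md, folded m_def d_def]
  have "lik_ratio n k \<theta> \<le> exp 86 * exp (d * \<theta> - n / 2 * \<theta>\<^sup>2)"
    unfolding d_def using \<theta> D by (intro lik_ratio_le_gauss[OF md]) (auto simp: m_def)
  also have "d * \<theta> - n / 2 * \<theta>\<^sup>2 \<le> 3 / 8 * (d\<^sup>2 / n)"
  proof -
    have "(m / 2)\<^sup>2 \<le> (m - \<theta>)\<^sup>2" using \<theta> D by (intro power_mono) (auto simp: m_def)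
    then have "n / 2 * (m / 2)\<^sup>2 \<le> n / 2 * (\<theta> - d / n)\<^sup>2"
      by (intro mult_left_mono) (auto simp: m_def d_def power2_commute)
    moreover have "d\<^sup>2 / n = n * m\<^sup>2" using D by (simp add: m_def d_def power2_eq_square)
    moreover have "n / 2 * (m / 2)\<^sup>2 = n * m\<^sup>2 / 8" by (simp add: power_divide)
    moreover have "d\<^sup>2 / (2 * real n) = (d\<^sup>2 / n) / 2" by simp
    ultimately show ?thesis using complete_square[of "real n" d \<theta>] D(1) by linarith
  qed
  finally show ?thesis by (simp add: d_def)
qed

section \<open>The gamma prior near the origin\<close>

definition gamma_density :: "real \<Rightarrow> real \<Rightarrow> real \<Rightarrow> real" where
  "gamma_density lam gam \<theta> =
     indicator {0<..} \<theta> * (gam powr lam / Gamma lam * \<theta> powr (lam - 1) * exp (- gam * \<theta>))"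

lemma gamma_density_measurable[measurable]: "gamma_density lam gam \<in> borel_measurable borel"
  unfolding gamma_density_def[abs_def] by measurable

lemma gamma_density_nonneg: "lam > 0 \<Longrightarrow> 0 \<le> gamma_density lam gam \<theta>"
  by (auto simp: gamma_density_def intro!: mult_nonneg_nonneg divide_nonneg_nonneg less_imp_le[OF Gamma_real_pos])

lemma gamma_prior_eq_density: "gamma_prior lam gam = density lborel (\<lambda>\<theta>. ennreal (gamma_density lam gam \<theta>))"
  by (simp add: gamma_prior_def gamma_density_def)

lemma sets_gamma_prior[simp, measurable_cong]: "sets (gamma_prior lam gam) = sets borel"
  by (simp add: gamma_prior_def)

lemma space_gamma_prior[simp]: "space (gamma_prior lam gam) = UNIV"
  by (simp add: gamma_prior_def)

text \<open>The substitution \<open>t = \<gamma>\<theta>\<close> turns the total mass into Euler's integral for \<open>Gamma \<lambda>\<close>.\<close>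

lemma prob_space_gamma_prior:
  assumes "lam > 0" "gam > 0"
  shows "prob_space (gamma_prior lam gam)"
proof
  let ?G = "\<lambda>t. ennreal (indicator {0..} t * t powr (lam - 1) / exp t)"
  have G: "Gamma lam > 0" using assms by simp
  have "ennreal (Gamma lam) = (\<integral>\<^sup>+t. ?G t \<partial>lborel)"
    by (rule Gamma_conv_nn_integral_real[OF assms(1)])
  also have "\<dots> = ennreal \<bar>gam\<bar> * (\<integral>\<^sup>+\<theta>. ?G (0 + gam * \<theta>) \<partial>lborel)"
    using assms by (intro nn_integral_real_affine) auto
  finally have eq: "ennreal (Gamma lam) = ennreal gam * (\<integral>\<^sup>+\<theta>. ?G (gam * \<theta>) \<partial>lborel)"
    using assms by simp
  have pt: "ennreal (gamma_density lam gam \<theta>) = ennreal (1 / Gamma lam) * (ennreal gam * ?G (gam * \<theta>))" for \<theta>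
  proof -
    have "gamma_density lam gam \<theta>
        = 1 / Gamma lam * (gam * (indicator {0..} (gam * \<theta>) * (gam * \<theta>) powr (lam - 1) / exp (gam * \<theta>)))"
    proof (cases "\<theta> > 0")
      case True
      then show ?thesis using assms
        by (simp add: gamma_density_def powr_mult powr_diff exp_minus field_simps)
    next
      case False
      then show ?thesis using assms
        by (cases "\<theta> = 0") (auto simp: gamma_density_def indicator_def zero_le_mult_iff)
    qed
    then show ?thesis using assms G by (simp only: ennreal_mult'[symmetric]) (simp add: ennreal_mult' flip: ennreal_mult)
  qed
  have "emeasure (gamma_prior lam gam) UNIV = (\<integral>\<^sup>+\<theta>. ennreal (gamma_density lam gam \<theta>) \<partial>lborel)"
    by (simp add: gamma_prior_eq_density emeasure_density)
  also have "\<dots> = ennreal (1 / Gamma lam) * (ennreal gam * (\<integral>\<^sup>+\<theta>. ?G (gam * \<theta>) \<partial>lborel))"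
    unfolding pt by (simp add: nn_integral_cmult)
  also have "\<dots> = ennreal (1 / Gamma lam) * ennreal (Gamma lam)" by (simp only: eq[symmetric])
  also have "\<dots> = 1" using G by (simp flip: ennreal_mult)
  finally show "emeasure (gamma_prior lam gam) (space (gamma_prior lam gam)) = 1" by simp
qed

lemma integral_gamma_prior:
  fixes f :: "real \<Rightarrow> real"
  assumes "lam > 0" and [measurable]: "f \<in> borel_measurable borel"
  shows "(\<integral>\<theta>. f \<theta> \<partial>gamma_prior lam gam) = (\<integral>\<theta>. gamma_density lam gam \<theta> * f \<theta> \<partial>lborel)"
    and "integrable (gamma_prior lam gam) f \<longleftrightarrow> integrable lborel (\<lambda>\<theta>. gamma_density lam gam \<theta> * f \<theta>)"
  using gamma_density_nonneg[OF assms(1)] unfolding gamma_prior_eq_density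
  by (simp_all add: integral_density integrable_density)

text \<open>Near the origin the density is \<open>\<theta>\<^bsup>\<lambda>-1\<^esup>\<close> up to constants, which integrates to
\<open>\<epsilon>\<^sup>\<lambda>/\<lambda>\<close>. Explicit constants valid on all of \<open>[0, 1]\<close> are needed below, where \<open>\<epsilon>\<close> is a multiple
of \<open>sqrt (log n / n)\<close>.\<close>

lemma gamma_prior_ball_measure:
  assumes "lam > 0" "gam > 0"
  obtains c C where "c > 0" "C > 0"
    "\<And>\<epsilon>. 0 \<le> \<epsilon> \<Longrightarrow> \<epsilon> \<le> 1 \<Longrightarrow> c * \<epsilon> powr lam \<le> measure (gamma_prior lam gam) {0..\<epsilon>}"
    "\<And>\<epsilon>. 0 \<le> \<epsilon> \<Longrightarrow> \<epsilon> \<le> 1 \<Longrightarrow> measure (gamma_prior lam gam) {0..\<epsilon>} \<le> C * \<epsilon> powr lam"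
proof -
  interpret Q: prob_space "gamma_prior lam gam" by (rule prob_space_gamma_prior[OF assms])
  define K where "K = gam powr lam / Gamma lam"
  have K: "K > 0" using assms by (simp add: K_def)
  have int: "(\<integral>\<^sup>+\<theta>. ennreal (\<theta> powr (lam - 1)) * indicator {0..\<epsilon>} \<theta> \<partial>lborel) = ennreal (\<epsilon> powr lam / lam)"
    if "0 \<le> \<epsilon>" for \<epsilon>
  proof (rule nn_integral_has_integral_lebesgue')
    show "((\<lambda>\<theta>. \<theta> powr (lam - 1)) has_integral \<epsilon> powr lam / lam) {0..\<epsilon>}"
      using has_integral_powr_from_0[of "lam - 1" \<epsilon>] that assms by simp
  qed auto
  have em: "emeasure (gamma_prior lam gam) {0..\<epsilon>}
      = (\<integral>\<^sup>+\<theta>. ennreal (gamma_density lam gam \<theta>) * indicator {0..\<epsilon>} \<theta> \<partial>lborel)" for \<epsilon>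
    by (simp add: gamma_prior_eq_density emeasure_density)
  show ?thesis
  proof (rule that[of "K * exp (- gam) / lam" "K / lam"])
    show "K * exp (- gam) / lam > 0" "K / lam > 0" using K assms by auto
  next
    fix \<epsilon> :: real assume e: "0 \<le> \<epsilon>" "\<epsilon> \<le> 1"
    have "ennreal (K * exp (- gam) / lam * \<epsilon> powr lam) = ennreal (K * exp (- gam)) * ennreal (\<epsilon> powr lam / lam)"
      using K assms by (simp flip: ennreal_mult)
    also have "\<dots> = (\<integral>\<^sup>+\<theta>. ennreal (K * exp (- gam)) * (ennreal (\<theta> powr (lam - 1)) * indicator {0..\<epsilon>} \<theta>) \<partial>lborel)"
      using e by (simp add: nn_integral_cmult int)
    also have "\<dots> \<le> (\<integral>\<^sup>+\<theta>. ennreal (gamma_density lam gam \<theta>) * indicator {0..\<epsilon>} \<theta> \<partial>lborel)"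
    proof (intro nn_integral_mono)
      fix \<theta> :: real
      show "ennreal (K * exp (- gam)) * (ennreal (\<theta> powr (lam - 1)) * indicator {0..\<epsilon>} \<theta>)
         \<le> ennreal (gamma_density lam gam \<theta>) * indicator {0..\<epsilon>} \<theta>"
      proof (cases "0 < \<theta> \<and> \<theta> \<le> \<epsilon>")
        case True
        then have "gam * \<theta> \<le> gam * 1" using e assms by (intro mult_left_mono) auto
        then have "K * exp (- gam) * \<theta> powr (lam - 1) \<le> K * exp (- gam * \<theta>) * \<theta> powr (lam - 1)"
          using K by (intro mult_right_mono mult_left_mono) auto
        also have "\<dots> = gamma_density lam gam \<theta>" using True by (simp add: gamma_density_def K_def)
        finally show ?thesis using True K by (simp add: ennreal_leI flip: ennreal_mult)
      next
        case False
        then show ?thesis by (cases "\<theta> = 0") (auto simp: indicator_def)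
      qed
    qed
    finally show "K * exp (- gam) / lam * \<epsilon> powr lam \<le> measure (gamma_prior lam gam) {0..\<epsilon>}"
      unfolding em[symmetric] Q.emeasure_eq_measure by (subst (asm) ennreal_le_iff) auto
  next
    fix \<epsilon> :: real assume e: "0 \<le> \<epsilon>" "\<epsilon> \<le> 1"
    have "(\<integral>\<^sup>+\<theta>. ennreal (gamma_density lam gam \<theta>) * indicator {0..\<epsilon>} \<theta> \<partial>lborel)
        \<le> (\<integral>\<^sup>+\<theta>. ennreal K * (ennreal (\<theta> powr (lam - 1)) * indicator {0..\<epsilon>} \<theta>) \<partial>lborel)"
    proof (intro nn_integral_mono)
      fix \<theta> :: real
      have "gamma_density lam gam \<theta> \<le> K * \<theta> powr (lam - 1)"
      proof (cases "\<theta> > 0")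
        case True
        then have "K * \<theta> powr (lam - 1) * exp (- gam * \<theta>) \<le> K * \<theta> powr (lam - 1) * 1"
          using K assms by (intro mult_left_mono) auto
        then show ?thesis using True by (simp add: gamma_density_def K_def)
      qed (use K in \<open>auto simp: gamma_density_def\<close>)
      then have "ennreal (gamma_density lam gam \<theta>) \<le> ennreal K * ennreal (\<theta> powr (lam - 1))"
        using K by (simp add: ennreal_leI flip: ennreal_mult)
      then show "ennreal (gamma_density lam gam \<theta>) * indicator {0..\<epsilon>} \<theta>
          \<le> ennreal K * (ennreal (\<theta> powr (lam - 1)) * indicator {0..\<epsilon>} \<theta>)"
        by (auto simp: indicator_def)
    qed
    also have "\<dots> = ennreal K * ennreal (\<epsilon> powr lam / lam)"
      using e by (simp add: nn_integral_cmult int)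
    also have "\<dots> = ennreal (K / lam * \<epsilon> powr lam)" using K assms by (simp flip: ennreal_mult)
    finally show "measure (gamma_prior lam gam) {0..\<epsilon>} \<le> K / lam * \<epsilon> powr lam"
      unfolding em[symmetric] Q.emeasure_eq_measure using K assms by (subst (asm) ennreal_le_iff) auto
  qed
qed

lemma powr_comparable:
  fixes x y s :: real
  assumes "0 < x" "x / 4 \<le> y" "y \<le> 4 * x"
  shows "4 powr - \<bar>s\<bar> * x powr s \<le> y powr s" and "y powr s \<le> 4 powr \<bar>s\<bar> * x powr s"
proof -
  have y: "0 < y" using assms by linarith
  define r where "r = y / x"
  have r: "0 < r" "1 / 4 \<le> r" "r \<le> 4" using assms y by (auto simp: r_def field_simps)
  have yr: "y powr s = r powr s * x powr s"
    using assms y by (simp add: r_def powr_divide)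
  have "\<bar>ln r\<bar> \<le> ln 4"
    using r ln_mono[of r 4] ln_mono[of "1/4" r] by (simp add: ln_div abs_le_iff)
  then have "\<bar>s * ln r\<bar> \<le> \<bar>s\<bar> * ln 4" by (simp add: abs_mult mult_left_mono)
  then have "4 powr - \<bar>s\<bar> \<le> r powr s" "r powr s \<le> 4 powr \<bar>s\<bar>"
    using r by (auto simp: powr_def abs_le_iff)
  then show "4 powr - \<bar>s\<bar> * x powr s \<le> y powr s" "y powr s \<le> 4 powr \<bar>s\<bar> * x powr s"
    unfolding yr by (auto intro!: mult_right_mono)
qed

text \<open>On a window around \<open>x\<close> whose ends are within a factor 4 of \<open>x\<close> the prior density may be treated
as the constant \<open>x\<^bsup>\<lambda>-1\<^esup>\<close>.\<close>

lemma gamma_density_comparable: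
  assumes "lam > 0" "gam > 0"
  obtains c C where "c > 0" "C > 0"
    "\<And>x \<theta>. 0 < x \<Longrightarrow> x \<le> 1 \<Longrightarrow> x / 4 \<le> \<theta> \<Longrightarrow> \<theta> \<le> 4 * x \<Longrightarrow> c * x powr (lam - 1) \<le> gamma_density lam gam \<theta>"
    "\<And>x \<theta>. 0 < x \<Longrightarrow> x \<le> 1 \<Longrightarrow> x / 4 \<le> \<theta> \<Longrightarrow> \<theta> \<le> 4 * x \<Longrightarrow> gamma_density lam gam \<theta> \<le> C * x powr (lam - 1)"
proof -
  define K where "K = gam powr lam / Gamma lam"
  have K: "K > 0" using assms by (simp add: K_def)
  show ?thesis
  proof (rule that[of "K * exp (- (4 * gam)) * 4 powr - \<bar>lam - 1\<bar>" "K * 4 powr \<bar>lam - 1\<bar>"])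
    fix x \<theta> :: real assume x: "0 < x" "x \<le> 1" "x / 4 \<le> \<theta>" "\<theta> \<le> 4 * x"
    then have t: "0 < \<theta>" by linarith
    have g: "gamma_density lam gam \<theta> = K * exp (- gam * \<theta>) * \<theta> powr (lam - 1)"
      using t by (simp add: gamma_density_def K_def)
    have "gam * \<theta> \<le> gam * 4" using x assms by (intro mult_left_mono) auto
    then have "K * exp (- (4 * gam)) * (4 powr - \<bar>lam - 1\<bar> * x powr (lam - 1))
       \<le> K * exp (- gam * \<theta>) * \<theta> powr (lam - 1)"
      using K x by (intro mult_mono powr_comparable(1)) auto
    then show "K * exp (- (4 * gam)) * 4 powr - \<bar>lam - 1\<bar> * x powr (lam - 1) \<le> gamma_density lam gam \<theta>"
      by (simp add: g mult.assoc)
    have "K * exp (- gam * \<theta>) * \<theta> powr (lam - 1) \<le> K * 1 * (4 powr \<bar>lam - 1\<bar> * x powr (lam - 1))"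
      using K x t assms by (intro mult_mono powr_comparable(2)) auto
    then show "gamma_density lam gam \<theta> \<le> K * 4 powr \<bar>lam - 1\<bar> * x powr (lam - 1)"
      by (simp add: g mult.assoc)
  qed (use K in auto)
qed

section \<open>Laplace estimates for the Bayes factor\<close>

lemma lik_ratio_measurable[measurable]: "lik_ratio n k \<in> borel_measurable borel"
  unfolding lik_ratio_def[abs_def] by measurable

lemma lik_ratio_le_power: "\<theta> \<ge> 0 \<Longrightarrow> lik_ratio n k \<theta> \<le> 2 ^ k"
proof -
  assume "\<theta> \<ge> 0"
  then have e: "exp (-\<theta>) \<le> 1" by simp
  then have "exp (-\<theta>) \<le> 2" by linarith
  with e have "(2 - exp (- \<theta>)) ^ k * exp (- \<theta>) ^ (n - k) \<le> 2 ^ k * 1 ^ (n - k)"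
    by (intro mult_mono power_mono) (auto intro: zero_le_power)
  then show ?thesis by (simp add: lik_ratio_def)
qed

definition bayes_factor :: "real measure \<Rightarrow> nat \<Rightarrow> nat \<Rightarrow> real" where
  "bayes_factor Q n k = (LINT \<theta>:{0<..}|Q. lik_ratio n k \<theta>)"

lemma set_integrable_lik_ratio:
  assumes "finite_measure Q" and [measurable_cong]: "sets Q = sets borel"
  shows "set_integrable Q {0<..} (lik_ratio n k)"
proof -
  interpret finite_measure Q by fact
  show ?thesis unfolding set_integrable_def
  proof (rule integrable_const_bound)
    show "AE x in Q. norm (indicator {0<..} x *\<^sub>R lik_ratio n k x) \<le> 2 ^ k"
      using lik_ratio_le_power lik_ratio_nonneg by (auto simp: indicator_def)
  qed measurable
qed

text \<open>Only the window of width \<open>1/sqrt n\<close> to the right of the peak is kept.\<close>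

lemma bayes_factor_lower:
  assumes "lam > 0" "gam > 0"
  obtains c where "c > 0"
    "\<And>n k. moderate_dev n k \<Longrightarrow>
       c * ((excess n k / n) powr (lam - 1) * exp ((excess n k)\<^sup>2 / (2 * real n)) / sqrt n)
         \<le> bayes_factor (gamma_prior lam gam) n k"
proof -
  interpret Q: prob_space "gamma_prior lam gam" by (rule prob_space_gamma_prior[OF assms])
  obtain c C where c: "c > 0" "C > 0"
    "\<And>x \<theta>. 0 < x \<Longrightarrow> x \<le> 1 \<Longrightarrow> x / 4 \<le> \<theta> \<Longrightarrow> \<theta> \<le> 4 * x \<Longrightarrow> c * x powr (lam - 1) \<le> gamma_density lam gam \<theta>"
    "\<And>x \<theta>. 0 < x \<Longrightarrow> x \<le> 1 \<Longrightarrow> x / 4 \<le> \<theta> \<Longrightarrow> \<theta> \<le> 4 * x \<Longrightarrow> gamma_density lam gam \<theta> \<le> C * x powr (lam - 1)"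
    using gamma_density_comparable[OF assms] by metis
  have ind: "integrable (gamma_prior lam gam) (indicator {a..b} :: real \<Rightarrow> real)" for a b
    by (intro Q.integrable_const_bound[of _ 1]) (auto simp: indicator_def)
  show ?thesis
  proof (rule that[of "exp (- 5 / 2) * c"])
    fix n k assume md: "moderate_dev n k"
    define m where "m = excess n k / n"
    note D = moderate_devD[OF md, folded m_def]
    let ?I = "{m..m + 1 / sqrt n}"
    define E where "E = exp (- 5 / 2) * exp ((excess n k)\<^sup>2 / (2 * real n))"
    define w where "w = c * m powr (lam - 1)"
    have [simp]: "E \<ge> 0" "w \<ge> 0" using c by (auto simp: E_def w_def)
    have w: "w \<le> gamma_density lam gam \<theta>" if "\<theta> \<in> ?I" for \<theta>
    proof -
      have "m \<le> \<theta>" "\<theta> \<le> 2 * m" using that D(6) by auto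
      then show ?thesis unfolding w_def using D(4,5) by (intro c(3)) auto
    qed
    have "ennreal (w * (1 / sqrt n)) = (\<integral>\<^sup>+\<theta>. ennreal w * indicator ?I \<theta> \<partial>lborel)"
      using D by (simp add: nn_integral_cmult_indicator flip: ennreal_mult)
    also have "\<dots> \<le> (\<integral>\<^sup>+\<theta>. ennreal (gamma_density lam gam \<theta>) * indicator ?I \<theta> \<partial>lborel)"
      using w by (intro nn_integral_mono) (auto simp: indicator_def intro!: ennreal_leI)
    also have "\<dots> = emeasure (gamma_prior lam gam) ?I"
      by (simp add: gamma_prior_eq_density emeasure_density)
    finally have meas: "w * (1 / sqrt n) \<le> measure (gamma_prior lam gam) ?I"
      unfolding Q.emeasure_eq_measure by (subst (asm) ennreal_le_iff) auto
    have "E * (w * (1 / sqrt n)) \<le> E * measure (gamma_prior lam gam) ?I"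
      using meas by (intro mult_left_mono) auto
    also have "\<dots> = (\<integral>\<theta>. indicator ?I \<theta> * E \<partial>gamma_prior lam gam)" by simp
    also have "\<dots> \<le> (\<integral>\<theta>. indicator {0<..} \<theta> *\<^sub>R lik_ratio n k \<theta> \<partial>gamma_prior lam gam)"
    proof (rule integral_mono)
      show "integrable (gamma_prior lam gam) (\<lambda>\<theta>. indicator {0<..} \<theta> *\<^sub>R lik_ratio n k \<theta>)"
        using set_integrable_lik_ratio[of "gamma_prior lam gam" n k] Q.finite_measure_axioms
        by (simp add: set_integrable_def)
      show "indicator ?I \<theta> * E \<le> indicator {0<..} \<theta> *\<^sub>R lik_ratio n k \<theta>" for \<theta>
      proof (cases "\<theta> \<in> ?I")
        case True
        then have "E \<le> lik_ratio n k \<theta>" unfolding E_def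
          by (intro lik_ratio_near_peak[OF md]) (auto simp: m_def)
        moreover have "0 < \<theta>" using True D(4) by simp
        ultimately show ?thesis using True by simp
      next
        case False
        then show ?thesis using lik_ratio_nonneg[of \<theta> n k] by (auto simp: indicator_def)
      qed
    qed (use ind in \<open>auto intro!: integrable_mult_left\<close>)
    also have "\<dots> = bayes_factor (gamma_prior lam gam) n k"
      by (simp add: bayes_factor_def set_lebesgue_integral_def)
    finally show "exp (- 5 / 2) * c * ((excess n k / n) powr (lam - 1)
        * exp ((excess n k)\<^sup>2 / (2 * real n)) / sqrt n) \<le> bayes_factor (gamma_prior lam gam) n k"
      by (simp add: E_def w_def m_def ac_simps)
  qed (use c in auto)
qed

lemma gauss_integral:
  fixes d n :: real
  assumes "n > 0"
  shows "integrable lborel (\<lambda>x. exp (d * x - n / 2 * x\<^sup>2))"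
    and "(\<integral>x. exp (d * x - n / 2 * x\<^sup>2) \<partial>lborel) = sqrt (2 * pi / n) * exp (d\<^sup>2 / (2 * n))"
proof -
  have eq: "exp (d * x - n / 2 * x\<^sup>2)
      = sqrt (2 * pi / n) * exp (d\<^sup>2 / (2 * n)) * normal_density (d / n) (1 / sqrt n) x" for x
  proof -
    have "sqrt (2 * pi * (1 / sqrt n)\<^sup>2) = sqrt (2 * pi / n)"
      using assms by (simp add: power_divide)
    moreover have "- (x - d / n)\<^sup>2 / (2 * (1 / sqrt n)\<^sup>2) = - (n / 2 * (x - d / n)\<^sup>2)"
      using assms by (simp add: power_divide)
    moreover have "d * x - n / 2 * x\<^sup>2 = d\<^sup>2 / (2 * n) + - (n / 2 * (x - d / n)\<^sup>2)"
      using complete_square[of n d x] assms by simp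
    ultimately show ?thesis
      using assms by (simp only: normal_density_def exp_add) simp
  qed
  have s: "0 < 1 / sqrt n" using assms by simp
  show "integrable lborel (\<lambda>x. exp (d * x - n / 2 * x\<^sup>2))"
    unfolding eq using s by (intro integrable_mult_right integrable_normal_density)
  show "(\<integral>x. exp (d * x - n / 2 * x\<^sup>2) \<partial>lborel) = sqrt (2 * pi / n) * exp (d\<^sup>2 / (2 * n))"
    unfolding eq using s by simp
qed

text \<open>Three regions of \<open>\<theta>\<close>: to the left of half the peak, where small likelihood beats the possibly
singular prior; between \<open>d/(2n)\<close> and \<open>4d/n\<close>, where the prior density is essentially constant and a
Gaussian integral remains; and the far tail, where the likelihood ratio is at most
\<open>exp (-4d\<^sup>2/n)\<close> up to a constant. The left region is absorbed into the Gaussian term, the tail is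
kept as a separate summand.\<close>

lemma bayes_factor_upper:
  assumes "lam > 0" "gam > 0"
  obtains C where "C > 0"
    "\<And>n k. moderate_dev n k \<Longrightarrow>
       bayes_factor (gamma_prior lam gam) n k
       \<le> C * ((excess n k / n) powr (lam - 1) * exp ((excess n k)\<^sup>2 / (2 * real n)) / sqrt n
              + exp (- 4 * (excess n k)\<^sup>2 / n))"
proof -
  let ?Q = "gamma_prior lam gam"
  interpret Q: prob_space ?Q by (rule prob_space_gamma_prior[OF assms])
  obtain c1 C1 where c1: "c1 > 0" "C1 > 0"
    "\<And>x \<theta>. 0 < x \<Longrightarrow> x \<le> 1 \<Longrightarrow> x / 4 \<le> \<theta> \<Longrightarrow> \<theta> \<le> 4 * x \<Longrightarrow> c1 * x powr (lam - 1) \<le> gamma_density lam gam \<theta>"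
    "\<And>x \<theta>. 0 < x \<Longrightarrow> x \<le> 1 \<Longrightarrow> x / 4 \<le> \<theta> \<Longrightarrow> \<theta> \<le> 4 * x \<Longrightarrow> gamma_density lam gam \<theta> \<le> C1 * x powr (lam - 1)"
    using gamma_density_comparable[OF assms] by metis
  obtain c2 C2 where c2: "c2 > 0" "C2 > 0"
    "\<And>\<epsilon>. 0 \<le> \<epsilon> \<Longrightarrow> \<epsilon> \<le> 1 \<Longrightarrow> c2 * \<epsilon> powr lam \<le> measure ?Q {0..\<epsilon>}"
    "\<And>\<epsilon>. 0 \<le> \<epsilon> \<Longrightarrow> \<epsilon> \<le> 1 \<Longrightarrow> measure ?Q {0..\<epsilon>} \<le> C2 * \<epsilon> powr lam"
    using gamma_prior_ball_measure[OF assms] by metis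
  have ind: "integrable (gamma_prior lam gam) (indicator {a..b} :: real \<Rightarrow> real)" for a b
    by (intro Q.integrable_const_bound[of _ 1]) (auto simp: indicator_def)
  define C where "C = exp 86 * (2 * C2 + C1 * sqrt (2 * pi) + 1)"
  have "0 \<le> C1 * sqrt (2 * pi)" using c1 by simp
  then have C: "C > 0" unfolding C_def using c2(2) by (intro mult_pos_pos) auto
  show ?thesis
  proof (rule that[OF C])
    fix n k assume md: "moderate_dev n k"
    define d m where "d = excess n k" and "m = excess n k / n"
    note D = moderate_devD[OF md, folded m_def d_def]
    define M where "M = m powr (lam - 1) * exp (d\<^sup>2 / (2 * real n)) / sqrt n"
    define T where "T = exp (- 4 * d\<^sup>2 / n)"
    define A where "A = exp (3 / 8 * (d\<^sup>2 / n))"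
    define g where "g = (\<lambda>\<theta>. exp (d * \<theta> - n / 2 * \<theta>\<^sup>2))"
    have n0: "real n > 0" using D by simp
    have [measurable]: "g \<in> borel_measurable borel" unfolding g_def by measurable
    have gi: "integrable lborel g" and gI: "(\<integral>x. g x \<partial>lborel) = sqrt (2 * pi / n) * exp (d\<^sup>2 / (2 * real n))"
      using gauss_integral[OF n0, of d] unfolding g_def by simp_all
    let ?J = "{m / 2..4 * m}"
    have wJ: "gamma_density lam gam \<theta> \<le> C1 * m powr (lam - 1)" if "\<theta> \<in> ?J" for \<theta>
      using that D by (intro c1(4)) auto
    have [simp]: "0 \<le> gamma_density lam gam \<theta>" for \<theta> using gamma_density_nonneg assms by simp
    have bnd: "gamma_density lam gam \<theta> * (indicator ?J \<theta> * g \<theta>) \<le> C1 * m powr (lam - 1) * g \<theta>" for \<theta>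
      using wJ[of \<theta>] c1(2) by (auto simp: indicator_def g_def mult_right_mono)
    have int2: "integrable lborel (\<lambda>\<theta>. gamma_density lam gam \<theta> * (indicator ?J \<theta> * g \<theta>))"
    proof (rule Bochner_Integration.integrable_bound)
      show "integrable lborel (\<lambda>\<theta>. C1 * m powr (lam - 1) * g \<theta>)" using gi by simp
      show "AE \<theta> in lborel. norm (gamma_density lam gam \<theta> * (indicator ?J \<theta> * g \<theta>)) \<le> norm (C1 * m powr (lam - 1) * g \<theta>)"
        using bnd c1(2) by (auto simp: g_def abs_mult)
    qed measurable
    have I2: "integrable ?Q (\<lambda>\<theta>. indicator ?J \<theta> * g \<theta>)"
      using int2 by (subst integral_gamma_prior(2)) (use assms in auto)
    have J2: "(\<integral>\<theta>. indicator ?J \<theta> * g \<theta> \<partial>?Q) \<le> C1 * m powr (lam - 1) * (\<integral>x. g x \<partial>lborel)"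
    proof -
      have "(\<integral>\<theta>. indicator ?J \<theta> * g \<theta> \<partial>?Q) = (\<integral>\<theta>. gamma_density lam gam \<theta> * (indicator ?J \<theta> * g \<theta>) \<partial>lborel)"
        by (subst integral_gamma_prior(1)) (use assms in auto)
      also have "\<dots> \<le> (\<integral>\<theta>. C1 * m powr (lam - 1) * g \<theta> \<partial>lborel)"
        using int2 gi bnd by (intro integral_mono) auto
      finally show ?thesis by simp
    qed
    have "bayes_factor ?Q n k = (\<integral>\<theta>. indicator {0<..} \<theta> *\<^sub>R lik_ratio n k \<theta> \<partial>?Q)"
      by (simp add: bayes_factor_def set_lebesgue_integral_def)
    also have "\<dots> \<le> (\<integral>\<theta>. exp 86 * (A * indicator {0..m / 2} \<theta> + indicator ?J \<theta> * g \<theta> + T) \<partial>?Q)"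
    proof (rule integral_mono)
      show "integrable ?Q (\<lambda>\<theta>. indicator {0<..} \<theta> *\<^sub>R lik_ratio n k \<theta>)"
        using set_integrable_lik_ratio[of ?Q n k] Q.finite_measure_axioms
        by (simp add: set_integrable_def)
      show "integrable ?Q (\<lambda>\<theta>. exp 86 * (A * indicator {0..m / 2} \<theta> + indicator ?J \<theta> * g \<theta> + T))"
        using I2 ind by (intro integrable_mult_right Bochner_Integration.integrable_add) auto
      fix \<theta> :: real
      have nn: "0 \<le> A * indicator {0..m / 2} \<theta>" "0 \<le> indicator ?J \<theta> * g \<theta>" "0 \<le> T"
        by (auto simp: A_def g_def T_def)
      consider "\<theta> \<le> 0" | "0 < \<theta>" "\<theta> \<le> m / 2" | "m / 2 < \<theta>" "\<theta> \<le> 4 * m" | "0 < \<theta>" "4 * m < \<theta>" using D by linarith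
      then show "indicator {0<..} \<theta> *\<^sub>R lik_ratio n k \<theta>
          \<le> exp 86 * (A * indicator {0..m / 2} \<theta> + indicator ?J \<theta> * g \<theta> + T)"
      proof cases
        case 1
        then show ?thesis using nn by simp
      next
        case 2
        then have "lik_ratio n k \<theta> \<le> exp 86 * A"
          unfolding A_def d_def by (intro lik_ratio_left[OF md]) (auto simp: m_def)
        also have "\<dots> \<le> exp 86 * (A * indicator {0..m / 2} \<theta> + indicator ?J \<theta> * g \<theta> + T)"
          using nn 2 by (intro mult_left_mono) auto
        finally show ?thesis using 2 by simp
      next
        case 3
        have pos: "0 < \<theta>" using 3 D(4) by linarith
        have "lik_ratio n k \<theta> \<le> exp 86 * g \<theta>"
          unfolding g_def d_def using pos 3 by (intro lik_ratio_le_gauss[OF md]) (auto simp: m_def)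
        also have "\<dots> \<le> exp 86 * (A * indicator {0..m / 2} \<theta> + indicator ?J \<theta> * g \<theta> + T)"
          using nn 3 by (intro mult_left_mono) auto
        finally show ?thesis using pos by simp
      next
        case 4
        then have "lik_ratio n k \<theta> \<le> exp 86 * T"
          unfolding T_def d_def by (intro lik_ratio_tail[OF md]) (auto simp: m_def)
        also have "\<dots> \<le> exp 86 * (A * indicator {0..m / 2} \<theta> + indicator ?J \<theta> * g \<theta> + T)"
          using nn by (intro mult_left_mono) auto
        finally show ?thesis using 4 by simp
      qed
    qed
    also have "\<dots> = exp 86 * (A * measure ?Q {0..m / 2} + (\<integral>\<theta>. indicator ?J \<theta> * g \<theta> \<partial>?Q) + T)"
      using I2 ind Q.prob_space by simp
    also have "\<dots> \<le> exp 86 * (2 * C2 * M + C1 * sqrt (2 * pi) * M + T)"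
    proof (intro mult_left_mono add_mono order_refl)
      show "A * measure ?Q {0..m / 2} \<le> 2 * C2 * M"
      proof -
        define z where "z = d / sqrt n"
        have z0: "0 \<le> z" using D by (simp add: z_def)
        have z2: "z\<^sup>2 = d\<^sup>2 / n" using D by (simp add: z_def power_divide)
        \<comment> \<open>The prior mass \<open>m\<^sup>\<lambda>\<close> exceeds \<open>m\<^bsup>\<lambda>-1\<^esup>/sqrt n\<close> by the factor \<open>z\<close>, which the loss
            \<open>exp (-z\<^sup>2/8)\<close> in the likelihood compensates.\<close>
        have "z \<le> 2 * exp (z\<^sup>2 / 8)"
        proof -
          have "0 \<le> (z / 2 - 1)\<^sup>2" by simp
          then have "z \<le> 2 * (1 + z\<^sup>2 / 8)" by (simp add: power2_eq_square field_simps)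
          also have "\<dots> \<le> 2 * exp (z\<^sup>2 / 8)" by (intro mult_left_mono exp_ge_add_one_self) simp
          finally show ?thesis .
        qed
        then have "z * A \<le> 2 * exp (z\<^sup>2 / 8) * A" by (intro mult_right_mono) (auto simp: A_def)
        also have "\<dots> = 2 * exp (d\<^sup>2 / (2 * real n))"
          unfolding A_def z2 mult.assoc exp_add[symmetric] by (simp add: field_simps)
        finally have zA: "z * A \<le> 2 * exp (d\<^sup>2 / (2 * real n))" .
        have "measure ?Q {0..m / 2} \<le> C2 * (m / 2) powr lam" using D by (intro c2(4)) auto
        also have "\<dots> \<le> C2 * m powr lam"
          using D c2(2) assms by (intro mult_left_mono powr_mono2) auto
        finally have "A * measure ?Q {0..m / 2} \<le> A * (C2 * m powr lam)"
          by (intro mult_left_mono) (auto simp: A_def)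
        also have "m powr lam = m powr (lam - 1) * (z / sqrt n)"
        proof -
          have "m = z / sqrt n" using D(1) by (simp add: m_def z_def d_def field_simps)
          moreover have "m powr lam = m powr (lam - 1) * m"
            using D(4) by (simp add: powr_diff)
          ultimately show ?thesis by simp
        qed
        also have "A * (C2 * (m powr (lam - 1) * (z / sqrt n))) = C2 * (m powr (lam - 1) / sqrt n) * (z * A)"
          by simp
        also have "\<dots> \<le> C2 * (m powr (lam - 1) / sqrt n) * (2 * exp (d\<^sup>2 / (2 * real n)))"
          using zA c2(2) by (intro mult_left_mono) auto
        also have "\<dots> = 2 * C2 * M" by (simp add: M_def)
        finally show ?thesis .
      qed
      have "(\<integral>\<theta>. indicator ?J \<theta> * g \<theta> \<partial>?Q) \<le> C1 * m powr (lam - 1) * (sqrt (2 * pi / n) * exp (d\<^sup>2 / (2 * real n)))"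
        using J2 by (simp add: gI)
      also have "\<dots> = C1 * sqrt (2 * pi) * M"
        by (simp add: M_def real_sqrt_divide)
      finally show "(\<integral>\<theta>. indicator ?J \<theta> * g \<theta> \<partial>?Q) \<le> C1 * sqrt (2 * pi) * M" .
    qed auto
    also have "\<dots> \<le> C * (M + T)"
    proof -
      have "0 \<le> M" "0 \<le> T" by (auto simp: M_def T_def)
      then have "2 * C2 * M + C1 * sqrt (2 * pi) * M + T \<le> (2 * C2 + C1 * sqrt (2 * pi) + 1) * (M + T)"
        using c1(2) c2(2) by (simp add: algebra_simps)
      then show ?thesis unfolding C_def mult.assoc by (intro mult_left_mono) auto
    qed
    finally show "bayes_factor ?Q n k
       \<le> C * ((excess n k / n) powr (lam - 1) * exp ((excess n k)\<^sup>2 / (2 * real n)) / sqrt n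
              + exp (- 4 * (excess n k)\<^sup>2 / n))"
      by (simp add: M_def T_def m_def d_def)
  qed
qed

section \<open>Moderate deviations of the null distribution\<close>

text \<open>If the success probability is uniform on \<open>[0, 1]\<close>, the number of successes is uniform on
\<open>{0..n}\<close>. This expresses the symmetric binomial probabilities through an integral that Laplace's
method can evaluate, and so replaces Stirling's formula.\<close>

lemma null_pmf_mult_beta_integral:
  assumes "k \<le> n"
  shows "null_pmf n k * (LINT p:{0..1}|lborel. 2 ^ n * (p ^ k * (1 - p) ^ (n - k))) = 1 / (real n + 1)"
proof -
  have "((\<lambda>p::real. p powr (real (Suc k) - 1) * (1 - p) powr (real (Suc (n - k)) - 1))
      has_integral Beta (real (Suc k)) (real (Suc (n - k)))) {0<..<1}"
    using has_integral_Beta_real[of "real (Suc k)" "real (Suc (n - k))"]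
    by (simp add: has_integral_Icc_iff_Ioo)
  also have "?this \<longleftrightarrow> ((\<lambda>p::real. p ^ k * (1 - p) ^ (n - k))
      has_integral Beta (real (Suc k)) (real (Suc (n - k)))) {0<..<1}"
    by (intro has_integral_cong) (auto simp: powr_realpow)
  finally have B: "((\<lambda>p::real. p ^ k * (1 - p) ^ (n - k))
      has_integral Beta (real (Suc k)) (real (Suc (n - k)))) {0..1}"
    by (simp add: has_integral_Icc_iff_Ioo)
  have "Beta (real (Suc k)) (real (Suc (n - k))) = fact k * fact (n - k) / fact (Suc n)"
  proof -
    have "real (Suc k) + real (Suc (n - k)) = 1 + real (Suc n)" using assms by simp
    then show ?thesis unfolding Beta_def
      using Gamma_fact[of k, where 'a = real] Gamma_fact[of "n - k", where 'a = real]
        Gamma_fact[of "Suc n", where 'a = real] by (simp add: add.commute)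
  qed
  also have "\<dots> = 1 / (real (n choose k) * (real n + 1))"
    using assms by (simp add: binomial_fact field_simps)
  finally have B': "Beta (real (Suc k)) (real (Suc (n - k))) = 1 / (real (n choose k) * (real n + 1))" .
  have "set_integrable lborel {0..1} (\<lambda>p::real. p ^ k * (1 - p) ^ (n - k))"
    by (intro borel_integrable_atLeastAtMost') (auto intro!: continuous_intros)
  then have "(LINT p:{0..1}|lborel. p ^ k * (1 - p) ^ (n - k)) = 1 / (real (n choose k) * (real n + 1))"
    using B B' by (simp add: set_borel_integral_eq_integral(2) integral_unique)
  then show ?thesis using assms by (simp add: null_pmf_def)
qed

text \<open>Stated for both signs of \<open>y\<close>, so that it applies to \<open>1 + x\<close> and to \<open>1 - x\<close>; the cubic terms of
the two then nearly cancel.\<close>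

lemma one_plus_le_exp_cubic:
  assumes "y \<ge> (-1::real)"
  shows "1 + y \<le> exp (y - y\<^sup>2 / 2 + y ^ 3 / 3)"
proof (cases "y = -1")
  case False
  define g where "g = (\<lambda>t::real. t - t\<^sup>2 / 2 + t ^ 3 / 3 - ln (1 + t))"
  have deriv: "(g has_real_derivative t ^ 3 / (1 + t)) (at t)" if "t > -1" for t
    unfolding g_def using that
    by (auto intro!: derivative_eq_intros simp: field_simps power2_eq_square power3_eq_cube)
  have "g 0 \<le> g y"
  proof (cases "y \<ge> 0")
    case True
    show ?thesis
    proof (rule DERIV_nonneg_imp_nondecreasing[of 0 y g])
      show "0 \<le> y" by (rule True)
      fix t :: real assume "0 \<le> t" "t \<le> y"
      then show "\<exists>z. (g has_real_derivative z) (at t) \<and> 0 \<le> z"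
        using deriv[of t] by (intro exI[of _ "t ^ 3 / (1 + t)"]) auto
    qed
  next
    case neg: False
    show ?thesis
    proof (rule DERIV_nonpos_imp_nonincreasing[of y 0 g])
      show "y \<le> 0" using neg by simp
      fix t :: real assume t: "y \<le> t" "t \<le> 0"
      then have "t > -1" using assms False by simp
      moreover have "t ^ 3 \<le> 0"
        using t by (simp add: power3_eq_cube mult_nonneg_nonpos)
      ultimately show "\<exists>z. (g has_real_derivative z) (at t) \<and> z \<le> 0"
        using deriv[of t] by (intro exI[of _ "t ^ 3 / (1 + t)"]) (auto simp: divide_nonpos_pos)
    qed
  qed
  then have "ln (1 + y) \<le> y - y\<^sup>2 / 2 + y ^ 3 / 3" by (simp add: g_def)
  then have "exp (ln (1 + y)) \<le> exp (y - y\<^sup>2 / 2 + y ^ 3 / 3)" by simp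
  then show ?thesis using assms False by simp
qed simp

text \<open>The cubic remainder is \<open>d x\<^sup>3/3\<close>, with the small factor \<open>d\<close> instead of \<open>n\<close>. Bounding
\<open>x\<^sup>3\<close> by \<open>x\<^sup>2\<close> absorbs it into the variance, so one Gaussian dominates on the whole interval.\<close>

lemma binomial_weight_le_gauss:
  assumes "k \<le> n" "0 \<le> excess n k" "-1 \<le> x" "x \<le> 1"
  shows "(1 + x) ^ k * (1 - x) ^ (n - k)
     \<le> exp (excess n k * x - (real n - 2 / 3 * excess n k) / 2 * x\<^sup>2)"
proof -
  define d where "d = excess n k"
  have "(1 + x) ^ k \<le> exp (x - x\<^sup>2 / 2 + x ^ 3 / 3) ^ k"
    using assms by (intro power_mono one_plus_le_exp_cubic) auto
  moreover have "(1 - x) ^ (n - k) \<le> exp (- x - x\<^sup>2 / 2 - x ^ 3 / 3) ^ (n - k)"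
    using assms one_plus_le_exp_cubic[of "-x"] by (intro power_mono) auto
  ultimately have "(1 + x) ^ k * (1 - x) ^ (n - k)
      \<le> exp (x - x\<^sup>2 / 2 + x ^ 3 / 3) ^ k * exp (- x - x\<^sup>2 / 2 - x ^ 3 / 3) ^ (n - k)"
    using assms by (intro mult_mono) auto
  also have "\<dots> = exp (real k * (x - x\<^sup>2 / 2 + x ^ 3 / 3) + real (n - k) * (- x - x\<^sup>2 / 2 - x ^ 3 / 3))"
    by (simp add: exp_add exp_of_nat_mult)
  also have "real k * (x - x\<^sup>2 / 2 + x ^ 3 / 3) + real (n - k) * (- x - x\<^sup>2 / 2 - x ^ 3 / 3)
      = d * x - n / 2 * x\<^sup>2 + d / 3 * x ^ 3"
    using assms by (simp add: d_def excess_def of_nat_diff field_simps)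
  also have "\<dots> \<le> d * x - (real n - 2 / 3 * d) / 2 * x\<^sup>2"
  proof -
    have "x ^ 3 = x * x\<^sup>2" by (simp add: power2_eq_square power3_eq_cube)
    also have "\<dots> \<le> 1 * x\<^sup>2" using assms by (intro mult_right_mono) auto
    finally have "d / 3 * x ^ 3 \<le> d / 3 * x\<^sup>2" using assms by (intro mult_left_mono) (auto simp: d_def)
    then show ?thesis by (simp add: field_simps)
  qed
  finally show ?thesis by (simp add: d_def)
qed

text \<open>In the variable \<open>x = 2p - 1\<close> this is a Gaussian integral. Replacing \<open>n\<close> by \<open>n - 2d/3\<close>
changes the exponent \<open>d\<^sup>2/(2n)\<close> by at most \<open>d\<^sup>3/(2n\<^sup>2) \<le> 1/2\<close>.\<close>

lemma beta_integral_upper: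
  assumes md: "moderate_dev n k"
  shows "(LINT p:{0..1}|lborel. 2 ^ n * (p ^ k * (1 - p) ^ (n - k)))
     \<le> sqrt (3 * pi) / 2 * exp (1 / 2) * (exp ((excess n k)\<^sup>2 / (2 * real n)) / sqrt n)"
proof -
  define d where "d = excess n k"
  note D = moderate_devD[OF md, folded d_def]
  define N where "N = real n - 2 / 3 * d"
  have d2: "2 * d \<le> n" and d3: "d ^ 3 \<le> (real n)\<^sup>2" using md by (auto simp: moderate_dev_def d_def)
  have N: "2 / 3 * real n \<le> N" "N > 0" using d2 D(1) by (auto simp: N_def)
  let ?f = "\<lambda>x. exp (d * x - N / 2 * x\<^sup>2)"
  have "(LINT p:{0..1}|lborel. 2 ^ n * (p ^ k * (1 - p) ^ (n - k)))
     \<le> (\<integral>p. ?f (-1 + 2 * p) \<partial>lborel)"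
    unfolding set_lebesgue_integral_def
  proof (rule integral_mono)
    show "integrable lborel (\<lambda>p::real. indicator {0..1} p *\<^sub>R (2 ^ n * (p ^ k * (1 - p) ^ (n - k))))"
      unfolding set_integrable_def[symmetric]
      by (intro borel_integrable_atLeastAtMost' continuous_intros)
    show "integrable lborel (\<lambda>p. ?f (-1 + 2 * p))"
      using lborel_integrable_real_affine[OF gauss_integral(1)[OF N(2), of d], of 2 "-1"] by simp
    fix p :: real
    show "indicator {0..1} p *\<^sub>R (2 ^ n * (p ^ k * (1 - p) ^ (n - k))) \<le> ?f (-1 + 2 * p)"
    proof (cases "p \<in> {0..1}")
      case True
      have "(2::real) ^ n = 2 ^ k * 2 ^ (n - k)" using D(2) by (simp flip: power_add)
      then have "2 ^ n * (p ^ k * (1 - p) ^ (n - k)) = (1 + (-1 + 2 * p)) ^ k * (1 - (-1 + 2 * p)) ^ (n - k)"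
        by (simp add: power_mult_distrib flip: right_diff_distrib)
           (simp add: algebra_simps flip: power_mult_distrib)
      also have "\<dots> \<le> ?f (-1 + 2 * p)"
        unfolding N_def d_def by (rule binomial_weight_le_gauss) (use True D in \<open>auto simp: d_def\<close>)
      finally show ?thesis using True by simp
    qed simp
  qed
  also have "\<dots> = (\<integral>x. ?f x \<partial>lborel) / 2"
    using lborel_integral_real_affine[of 2 ?f "-1"] by simp
  also have "\<dots> = sqrt (2 * pi / N) * exp (d\<^sup>2 / (2 * N)) / 2"
    using gauss_integral(2)[OF N(2), of d] by simp
  also have "\<dots> \<le> sqrt (3 * pi / n) * exp (1 / 2 + d\<^sup>2 / (2 * real n)) / 2"
  proof (intro divide_right_mono mult_mono)
    have "2 * pi / N \<le> 2 * pi / (2 / 3 * real n)"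
      using N D(1) by (intro divide_left_mono) auto
    then show "sqrt (2 * pi / N) \<le> sqrt (3 * pi / n)" by simp
    have "d\<^sup>2 / (2 * N) - d\<^sup>2 / (2 * real n) = d ^ 3 / (3 * n * N)"
      using N D(1) by (simp add: N_def field_simps power2_eq_square power3_eq_cube)
    also have "\<dots> \<le> (real n)\<^sup>2 / (3 * n * (2 / 3 * n))"
      using N D(1) d3 by (intro frac_le mult_left_mono) auto
    also have "\<dots> = 1 / 2" using D(1) by (simp add: power2_eq_square)
    finally show "exp (d\<^sup>2 / (2 * N)) \<le> exp (1 / 2 + d\<^sup>2 / (2 * real n))" by simp
  qed (use N in auto)
  also have "\<dots> = sqrt (3 * pi) / 2 * exp (1 / 2) * (exp (d\<^sup>2 / (2 * real n)) / sqrt n)"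
    by (simp add: exp_add real_sqrt_divide)
  finally show ?thesis by (simp add: d_def)
qed

text \<open>The substitution \<open>p = 1 - e\<^bsup>-\<theta>\<^esup>/2\<close> turns the integrand into the likelihood ratio, whose lower
bound near the peak applies to an interval of \<open>p\<close> of length comparable with \<open>1/sqrt n\<close>.\<close>

lemma beta_integral_lower:
  assumes md: "moderate_dev n k"
  shows "exp (- 7 / 2) / 4 * (exp ((excess n k)\<^sup>2 / (2 * real n)) / sqrt n)
    \<le> (LINT p:{0..1}|lborel. 2 ^ n * (p ^ k * (1 - p) ^ (n - k)))"
proof -
  define m where "m = excess n k / n"
  note D = moderate_devD[OF md, folded m_def]
  define s where "s = 1 / sqrt (real n)"
  have s: "0 < s" "s \<le> 1" using D(1) by (auto simp: s_def)
  define p0 p1 where "p0 = 1 - exp (- m) / 2" and "p1 = 1 - exp (- (m + s)) / 2"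
  define E where "E = exp (- 5 / 2) * exp ((excess n k)\<^sup>2 / (2 * real n))"
  have p01: "0 \<le> p0" "p1 \<le> 1"
    using prob_pos_in_unit[of m] prob_pos_in_unit[of "m + s"] D(4) s by (auto simp: p0_def p1_def)
  have len: "exp (- 1) / 4 * s \<le> p1 - p0"
  proof -
    have "exp s * (1 - s / 2) \<ge> 1"
    proof -
      have "(1 + s) * (1 - s / 2) \<le> exp s * (1 - s / 2)"
        using s by (intro mult_right_mono) auto
      moreover have "s * s \<le> s * 1" using s by (intro mult_left_mono) auto
      then have "1 \<le> (1 + s) * (1 - s / 2)" by (simp add: algebra_simps)
      ultimately show ?thesis by linarith
    qed
    then have "exp (- s) \<le> 1 - s / 2" by (simp add: exp_minus field_simps)
    then have "exp (- 1) * (s / 2) \<le> exp (- m) * (1 - exp (- s))"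
      using D(5) s by (intro mult_mono) auto
    then show ?thesis by (simp add: p0_def p1_def exp_add algebra_simps flip: exp_add)
  qed
  then have p01': "p0 \<le> p1" using s by (smt (verit) divide_nonneg_pos exp_ge_zero mult_nonneg_nonneg)
  have "exp (- 7 / 2) / 4 * (exp ((excess n k)\<^sup>2 / (2 * real n)) / sqrt n) = E * (exp (- 1) / 4 * s)"
    unfolding E_def s_def by (simp flip: exp_add)
  also have "\<dots> \<le> E * (p1 - p0)"
    using len by (intro mult_left_mono) (auto simp: E_def)
  also have "\<dots> = (\<integral>p. indicator {p0..p1} p * E \<partial>lborel)" using p01' by simp
  also have "\<dots> \<le> (LINT p:{0..1}|lborel. 2 ^ n * (p ^ k * (1 - p) ^ (n - k)))"
    unfolding set_lebesgue_integral_def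
  proof (rule integral_mono)
    show "integrable lborel (\<lambda>p. indicator {p0..p1} p * E)"
      by (intro integrable_mult_left integrable_real_indicator) (use p01' in auto)
    show "integrable lborel (\<lambda>p::real. indicator {0..1} p *\<^sub>R (2 ^ n * (p ^ k * (1 - p) ^ (n - k))))"
      unfolding set_integrable_def[symmetric]
      by (intro borel_integrable_atLeastAtMost' continuous_intros)
    fix p :: real
    show "indicator {p0..p1} p * E \<le> indicator {0..1} p *\<^sub>R (2 ^ n * (p ^ k * (1 - p) ^ (n - k)))"
    proof (cases "p \<in> {p0..p1}")
      case True
      then have p: "p \<in> {0..1}" using p01 by auto
      have q: "exp (- (m + s)) \<le> 2 * (1 - p)" "2 * (1 - p) \<le> exp (- m)"
        using True by (auto simp: p0_def p1_def)
      then have q0: "0 < 2 * (1 - p)" by (meson exp_gt_zero less_le_trans)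
      define \<theta> where "\<theta> = - ln (2 * (1 - p))"
      have e: "exp (- \<theta>) = 2 * (1 - p)" using q0 by (simp add: \<theta>_def)
      have \<theta>: "m \<le> \<theta>" "\<theta> \<le> m + s" using q unfolding e[symmetric] by auto
      have "E \<le> lik_ratio n k \<theta>"
        unfolding E_def by (rule lik_ratio_near_peak[OF md]) (use \<theta> in \<open>auto simp: m_def s_def\<close>)
      also have "\<dots> = (2 * p) ^ k * (2 * (1 - p)) ^ (n - k)"
        unfolding lik_ratio_def e by (simp add: algebra_simps)
      also have "\<dots> = 2 ^ n * (p ^ k * (1 - p) ^ (n - k))"
        using D(2) by (simp only: power_mult_distrib) (simp flip: power_add)
      finally show ?thesis using True p by simp
    next
      case False
      then show ?thesis by (auto simp: indicator_def)
    qed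
  qed
  finally show ?thesis .
qed

lemma null_pmf_local_limit:
  obtains c C where "c > 0" "C > 0"
    "\<And>n k. moderate_dev n k \<Longrightarrow> c * (exp (- (excess n k)\<^sup>2 / (2 * real n)) / sqrt n) \<le> null_pmf n k"
    "\<And>n k. moderate_dev n k \<Longrightarrow> null_pmf n k \<le> C * (exp (- (excess n k)\<^sup>2 / (2 * real n)) / sqrt n)"
proof -
  define K1 where "K1 = sqrt (3 * pi) / 2 * exp (1 / 2)"
  define K2 :: real where "K2 = exp (- 7 / 2) / 4"
  have K: "K1 > 0" "K2 > 0" by (auto simp: K1_def K2_def)
  show ?thesis
  proof (rule that[of "1 / (2 * K1)" "1 / K2"])
    show "1 / (2 * K1) > 0" "1 / K2 > 0" using K by auto
  next
    fix n k assume md: "moderate_dev n k"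
    note D = moderate_devD[OF md]
    define J where "J = (LINT p:{0..1}|lborel. 2 ^ n * (p ^ k * (1 - p) ^ (n - k)) :: real)"
    define E where "E = exp ((excess n k)\<^sup>2 / (2 * real n))"
    have E: "E > 0" "exp (- (excess n k)\<^sup>2 / (2 * real n)) = 1 / E"
      by (auto simp: E_def exp_minus field_simps)
    have JU: "J \<le> K1 * (E / sqrt n)" and JL: "K2 * (E / sqrt n) \<le> J"
      using beta_integral_upper[OF md] beta_integral_lower[OF md]
      by (simp_all add: J_def E_def K1_def K2_def)
    have J0: "J > 0" using JL K E D(1) by (smt (verit) divide_pos_pos mult_pos_pos of_nat_0_less_iff real_sqrt_gt_zero)
    have b: "null_pmf n k = 1 / ((real n + 1) * J)"
    proof -
      have "null_pmf n k * J = 1 / (real n + 1)"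
        using null_pmf_mult_beta_integral[OF D(2)] by (simp add: J_def)
      then show ?thesis using J0 nonzero_eq_divide_eq[of J "null_pmf n k" "1 / (real n + 1)"] by simp
    qed
    have sq: "sqrt n * sqrt n = n" by simp
    have "(real n + 1) * J \<le> (2 * real n) * (K1 * (E / sqrt n))"
      using JU J0 D(1) by (intro mult_mono) auto
    also have "\<dots> = 2 * K1 * E * sqrt n" using D(1) sq by (simp add: field_simps)
    finally have "1 / (2 * K1 * E * sqrt n) \<le> 1 / ((real n + 1) * J)"
      using J0 by (intro divide_left_mono) (auto simp: K E D(1))
    then show "1 / (2 * K1) * (exp (- (excess n k)\<^sup>2 / (2 * real n)) / sqrt n) \<le> null_pmf n k"
      unfolding b E by simp
    have "K2 * E * sqrt n = real n * (K2 * (E / sqrt n))" using D(1) sq by (simp add: field_simps)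
    also have "\<dots> \<le> (real n + 1) * J" using JL K E by (intro mult_mono) auto
    finally have "1 / ((real n + 1) * J) \<le> 1 / (K2 * E * sqrt n)"
      using K E D(1) J0 by (intro divide_left_mono) auto
    then show "null_pmf n k \<le> 1 / K2 * (exp (- (excess n k)\<^sup>2 / (2 * real n)) / sqrt n)"
      unfolding b E by simp
  qed
qed

lemma null_pmf_Suc: "k < n \<Longrightarrow> null_pmf n (Suc k) * real (Suc k) = null_pmf n k * real (n - k)"
proof -
  assume "k < n"
  have "real (Suc k * (n choose Suc k)) = real ((n - k) * (n choose k))"
    by (metis binomial_absorb_comp binomial_absorption mult.commute)
  then show ?thesis by (simp add: null_pmf_def field_simps)
qed

text \<open>Beyond \<open>k\<close> consecutive probabilities have ratio at most \<open>1 - d/n\<close>, so a geometric series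
dominates the tail.\<close>

lemma null_tail_upper:
  assumes "k \<le> n" "0 < excess n k"
  shows "(\<Sum>j\<in>{k..n}. null_pmf n j) \<le> null_pmf n k * (real n / excess n k)"
proof -
  define d where "d = excess n k"
  have n: "0 < n" using assms by (auto simp: excess_def)
  define r where "r = 1 - d / n"
  have r: "0 \<le> r" "r < 1" "r = 2 * (real n - real k) / n"
    using assms n by (auto simp: r_def d_def excess_def field_simps)
  have geo: "null_pmf n (k + i) \<le> null_pmf n k * r ^ i" if "k + i \<le> n" for i
    using that
  proof (induction i)
    case (Suc i)
    have "null_pmf n (Suc (k + i)) = null_pmf n (k + i) * (real (n - (k + i)) / real (Suc (k + i)))"
      using null_pmf_Suc[of "k + i" n] Suc.prems by (simp add: field_simps del: of_nat_Suc)
    also have "\<dots> \<le> null_pmf n (k + i) * r"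
    proof (intro mult_left_mono)
      have "real (n - (k + i)) / real (Suc (k + i)) \<le> (real n - real k) / (real n / 2)"
        using Suc.prems assms n by (intro frac_le) (auto simp: of_nat_diff excess_def)
      also have "\<dots> = r" unfolding r(3) using n by (simp add: field_simps)
      finally show "real (n - (k + i)) / real (Suc (k + i)) \<le> r" .
    qed (simp add: null_pmf_def)
    also have "\<dots> \<le> null_pmf n k * r ^ i * r"
      using Suc r by (intro mult_right_mono) auto
    finally show ?case by (simp add: ac_simps)
  qed simp
  have "(\<Sum>j\<in>{k..n}. null_pmf n j) = (\<Sum>i\<le>n - k. null_pmf n (k + i))"
    using assms(1) by (intro sum.reindex_bij_witness[of _ "\<lambda>i. k + i" "\<lambda>j. j - k"]) auto
  also have "\<dots> \<le> (\<Sum>i\<le>n - k. null_pmf n k * r ^ i)"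
    using assms(1) by (intro sum_mono geo) auto
  also have "\<dots> = null_pmf n k * (\<Sum>i<Suc (n - k). r ^ i)"
    by (simp only: sum_distrib_left lessThan_Suc_atMost)
  also have "\<dots> \<le> null_pmf n k * (1 / (1 - r))"
  proof (intro mult_left_mono)
    have "(\<Sum>i<Suc (n - k). r ^ i) = (1 - r ^ Suc (n - k)) / (1 - r)"
      using r by (intro sum_gp_strict[THEN trans]) auto
    also have "\<dots> \<le> 1 / (1 - r)"
    proof (intro divide_right_mono)
      have "0 \<le> r ^ Suc (n - k)" using r(1) by (rule zero_le_power)
      then show "1 - r ^ Suc (n - k) \<le> 1" by linarith
    qed (use r in linarith)
    finally show "(\<Sum>i<Suc (n - k). r ^ i) \<le> 1 / (1 - r)" .
  qed (simp add: null_pmf_def)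
  also have "1 / (1 - r) = n / d" by (simp add: r_def)
  finally show ?thesis by (simp add: d_def)
qed

text \<open>The lower bound keeps about \<open>n/d\<close> terms: moving \<open>k\<close> by \<open>i \<le> n/d\<close> increases \<open>d\<^sup>2/(2n)\<close> by at most
\<open>4\<close>, so these terms are all comparable with the first. The extra hypotheses keep
the shifted points, whose excess is at most \<open>3d\<close>, in the moderate range.\<close>

lemma null_tail_moderate:
  obtains c C where "c > 0" "C > 0"
    "\<And>n k. moderate_dev n k \<Longrightarrow> 6 * excess n k \<le> n \<Longrightarrow> 27 * excess n k ^ 3 \<le> (real n)\<^sup>2 \<Longrightarrow>
      c * (sqrt n / excess n k * exp (- (excess n k)\<^sup>2 / (2 * real n))) \<le> (\<Sum>j\<in>{k..n}. null_pmf n j)"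
    "\<And>n k. moderate_dev n k \<Longrightarrow>
      (\<Sum>j\<in>{k..n}. null_pmf n j) \<le> C * (sqrt n / excess n k * exp (- (excess n k)\<^sup>2 / (2 * real n)))"
proof -
  obtain c C where c: "c > 0" "C > 0"
    "\<And>n k. moderate_dev n k \<Longrightarrow> c * (exp (- (excess n k)\<^sup>2 / (2 * real n)) / sqrt n) \<le> null_pmf n k"
    "\<And>n k. moderate_dev n k \<Longrightarrow> null_pmf n k \<le> C * (exp (- (excess n k)\<^sup>2 / (2 * real n)) / sqrt n)"
    using null_pmf_local_limit by metis
  show ?thesis
  proof (rule that[of "c * exp (- 4)" C])
    show "c * exp (- 4) > 0" "C > 0" using c by auto
  next
    fix n k assume md: "moderate_dev n k"
    note D = moderate_devD[OF md]
    have "(\<Sum>j\<in>{k..n}. null_pmf n j) \<le> null_pmf n k * (real n / excess n k)"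
      using null_tail_upper D by blast
    also have "\<dots> \<le> C * (exp (- (excess n k)\<^sup>2 / (2 * real n)) / sqrt n) * (real n / excess n k)"
      using c(4)[OF md] D by (intro mult_right_mono) auto
    also have "\<dots> = C * (sqrt n / excess n k * exp (- (excess n k)\<^sup>2 / (2 * real n)))"
    proof -
      have "real n / sqrt n = sqrt n" using D(1) by (simp add: real_div_sqrt)
      moreover have "C * (e / sqrt n) * (real n / x) = C * (real n / sqrt n / x * e)" for e x :: real
        by simp
      ultimately show ?thesis by simp
    qed
    finally show "(\<Sum>j\<in>{k..n}. null_pmf n j) \<le> C * (sqrt n / excess n k * exp (- (excess n k)\<^sup>2 / (2 * real n)))" .
  next
    fix n k assume md: "moderate_dev n k" and d6: "6 * excess n k \<le> n" and d27: "27 * excess n k ^ 3 \<le> (real n)\<^sup>2"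
    define d where "d = excess n k"
    note D = moderate_devD[OF md, folded d_def]
    have dn: "n \<le> d\<^sup>2"
    proof -
      have "(sqrt n)\<^sup>2 \<le> d\<^sup>2" using md by (intro power_mono) (auto simp: moderate_dev_def d_def)
      then show ?thesis by simp
    qed
    define M where "M = nat \<lfloor>n / d\<rfloor>"
    have M: "real M \<le> n / d" "n / d \<le> real M + 1" using D by (auto simp: M_def)
    have nd: "n / d \<le> d" using dn D(3) by (simp add: divide_le_eq power2_eq_square)
    have ex: "excess n (k + i) = d + 2 * real i" for i by (simp add: excess_def d_def)
    have lower: "k + i \<le> n \<and> c * exp (- 4) * (exp (- d\<^sup>2 / (2 * real n)) / sqrt n) \<le> null_pmf n (k + i)" if "i \<le> M" for i
    proof -
      have i: "real i \<le> n / d" using that M by simp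
      have le3: "excess n (k + i) \<le> 3 * d" using i nd by (simp add: ex)
      have md': "moderate_dev n (k + i)"
        unfolding moderate_dev_def
      proof (intro conjI)
        show "0 < n" by (rule D(1))
        have "2 * real (k + i) - n \<le> n" using le3 d6 by (simp add: excess_def d_def)
        then show "k + i \<le> n" by simp
        show "sqrt n \<le> excess n (k + i)" using md unfolding ex by (simp add: moderate_dev_def d_def)
        show "2 * excess n (k + i) \<le> n" using le3 d6 by (simp add: d_def)
        have "excess n (k + i) ^ 3 \<le> (3 * d) ^ 3" using le3 D(3) by (intro power_mono) (auto simp: ex)
        also have "\<dots> \<le> (real n)\<^sup>2" using d27 by (simp add: d_def power_mult_distrib)
        finally show "excess n (k + i) ^ 3 \<le> (real n)\<^sup>2" .
      qed
      have id: "real i * d \<le> n" using i D(3) by (simp add: le_divide_eq)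
      have "real i * real i \<le> real i * d" using i nd by (intro mult_left_mono) auto
      then have "(d + 2 * real i)\<^sup>2 \<le> d\<^sup>2 + 8 * n"
        using id by (simp add: power2_eq_square algebra_simps)
      then have "(d + 2 * real i)\<^sup>2 / (2 * real n) \<le> (d\<^sup>2 + 8 * n) / (2 * real n)"
        by (intro divide_right_mono) auto
      also have "\<dots> = d\<^sup>2 / (2 * real n) + 4" using D(1) by (simp add: field_simps)
      finally have "exp (- 4 + - d\<^sup>2 / (2 * real n)) \<le> exp (- (excess n (k + i))\<^sup>2 / (2 * real n))"
        unfolding ex by simp
      then have "c * exp (- 4) * (exp (- d\<^sup>2 / (2 * real n)) / sqrt n)
          \<le> c * (exp (- (excess n (k + i))\<^sup>2 / (2 * real n)) / sqrt n)"
        unfolding exp_add using c(1) by (simp add: divide_right_mono mult_left_mono)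
      also have "\<dots> \<le> null_pmf n (k + i)" by (rule c(3)[OF md'])
      finally show ?thesis using md' by (simp add: moderate_dev_def)
    qed
    have "c * exp (- 4) * (sqrt n / d * exp (- d\<^sup>2 / (2 * real n)))
        = n / d * (c * exp (- 4) * (exp (- d\<^sup>2 / (2 * real n)) / sqrt n))"
    proof -
      have "real n / sqrt n = sqrt n" using D(1) by (simp add: real_div_sqrt)
      moreover have "c * exp (- 4) * (real n / sqrt n / x * e) = real n / x * (c * exp (- 4) * (e / sqrt n))"
        for e x :: real by (simp add: ac_simps)
      ultimately show ?thesis by simp
    qed
    also have "\<dots> \<le> (real M + 1) * (c * exp (- 4) * (exp (- d\<^sup>2 / (2 * real n)) / sqrt n))"
      using M c(1) by (intro mult_right_mono) auto
    also have "\<dots> = (\<Sum>i\<le>M. c * exp (- 4) * (exp (- d\<^sup>2 / (2 * real n)) / sqrt n))"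
      by (simp add: add.commute)
    also have "\<dots> \<le> (\<Sum>i\<le>M. null_pmf n (k + i))" using lower by (intro sum_mono) auto
    also have "\<dots> = (\<Sum>j\<in>(\<lambda>i. k + i) ` {..M}. null_pmf n j)"
      by (subst sum.reindex) (auto simp: inj_on_def)
    also have "\<dots> \<le> (\<Sum>j\<in>{k..n}. null_pmf n j)"
      using lower by (intro sum_mono2) (auto simp: null_pmf_def)
    finally show "c * exp (- 4) * (sqrt n / excess n k * exp (- (excess n k)\<^sup>2 / (2 * real n)))
        \<le> (\<Sum>j\<in>{k..n}. null_pmf n j)" by (simp add: d_def)
  qed
qed

section \<open>Bayes-optimal thresholds\<close>

lemma lik_ratio_mono:
  assumes "\<theta> \<ge> 0" "i \<le> j" "j \<le> n"
  shows "lik_ratio n i \<theta> \<le> lik_ratio n j \<theta>"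
proof -
  have e: "0 < exp (-\<theta>)" "exp (-\<theta>) \<le> 1" using assms by auto
  then have e2: "exp (-\<theta>) \<le> 2 - exp (-\<theta>)" "0 \<le> 2 - exp (-\<theta>)" by linarith+
  have "n - i = (j - i) + (n - j)" "j = i + (j - i)" using assms by auto
  then have "lik_ratio n i \<theta> = (2 - exp (-\<theta>)) ^ i * (exp (-\<theta>) ^ (j - i) * exp (-\<theta>) ^ (n - j))"
    unfolding lik_ratio_def by (simp only: power_add)
  also have "\<dots> \<le> (2 - exp (-\<theta>)) ^ i * ((2 - exp (-\<theta>)) ^ (j - i) * exp (-\<theta>) ^ (n - j))"
    using e e2 by (intro mult_left_mono mult_right_mono power_mono zero_le_power) auto
  also have "\<dots> = lik_ratio n j \<theta>"
    unfolding lik_ratio_def using \<open>j = i + (j - i)\<close> by (metis mult.assoc power_add)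
  finally show ?thesis .
qed

lemma bayes_factor_mono:
  assumes "finite_measure Q" "sets Q = sets borel" "i \<le> j" "j \<le> n"
  shows "bayes_factor Q n i \<le> bayes_factor Q n j"
  unfolding bayes_factor_def
  by (intro set_integral_mono set_integrable_lik_ratio assms lik_ratio_mono) auto

text \<open>Exchanging the prior average with the sum over the values of the statistic, every value \<open>j\<close> is
charged either for acceptance (\<open>j < v\<close>) or for rejection.\<close>

lemma bayes_risk_eq_sum:
  assumes "laplace_model P X" and Q: "finite_measure Q" "sets Q = sets borel"
  shows "bayes_risk P X Q p0 p1 L0 L1 n v
    = (\<Sum>j\<le>n. null_pmf n j * (if real j < v then p1 * L1 * bayes_factor Q n j else p0 * L0))"
proof -
  let ?S = "{j. j \<le> n \<and> real j < v}" and ?T = "{j. j \<le> n \<and> v \<le> real j}"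
  have "(LINT \<theta>:{0<..}|Q. type2_error P X n v \<theta>)
      = (\<integral>\<theta>. (\<Sum>j\<in>?S. null_pmf n j * (indicator {0<..} \<theta> *\<^sub>R lik_ratio n j \<theta>)) \<partial>Q)"
    unfolding set_lebesgue_integral_def
    by (intro Bochner_Integration.integral_cong)
       (auto simp: indicator_def type2_error_eq_sum[OF assms(1)])
  also have "\<dots> = (\<Sum>j\<in>?S. null_pmf n j * bayes_factor Q n j)"
    using set_integrable_lik_ratio[OF Q]
    unfolding bayes_factor_def set_integrable_def set_lebesgue_integral_def
    by (subst Bochner_Integration.integral_sum) auto
  finally have "bayes_risk P X Q p0 p1 L0 L1 n v
      = (\<Sum>j\<in>?T. null_pmf n j * (p0 * L0)) + (\<Sum>j\<in>?S. null_pmf n j * (p1 * L1 * bayes_factor Q n j))"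
    by (simp add: bayes_risk_def type1_error_eq_sum[OF assms(1)] sum_distrib_left ac_simps)
  also have "\<dots> = (\<Sum>j\<in>?T. null_pmf n j * (if real j < v then p1 * L1 * bayes_factor Q n j else p0 * L0))
      + (\<Sum>j\<in>?S. null_pmf n j * (if real j < v then p1 * L1 * bayes_factor Q n j else p0 * L0))"
    by (intro arg_cong2[where f = "(+)"] sum.cong) auto
  also have "\<dots> = (\<Sum>j\<in>?T \<union> ?S. null_pmf n j * (if real j < v then p1 * L1 * bayes_factor Q n j else p0 * L0))"
    by (intro sum.union_disjoint[symmetric]) auto
  also have "?T \<union> ?S = {..n}" by auto
  finally show ?thesis .
qed

text \<open>The risk depends on \<open>v\<close> only through the set of \<open>j \<le> n\<close> below \<open>v\<close>, so it takes finitely many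
values.\<close>

lemma bayes_threshold_exists:
  assumes "laplace_model P X" and Q: "finite_measure Q" "sets Q = sets borel"
  shows "\<exists>v. bayes_threshold P X Q p0 p1 L0 L1 n v"
proof -
  define R where "R = bayes_risk P X Q p0 p1 L0 L1 n"
  define g where "g = (\<lambda>S. \<Sum>j\<le>n. null_pmf n j * (if j \<in> S then p1 * L1 * bayes_factor Q n j else p0 * L0))"
  have "R v = g {j. j \<le> n \<and> real j < v}" for v
    unfolding R_def g_def bayes_risk_eq_sum[OF assms] by (intro sum.cong) auto
  then have "range R \<subseteq> g ` Pow {..n}" by auto
  then have fin: "finite (range R)" by (rule finite_subset) auto
  then have "Min (range R) \<in> range R" by (intro Min_in) auto
  then obtain v where v: "R v = Min (range R)" by auto
  then have "\<not> R w < R v" for w using fin Min_le[OF fin, of "R w"] by auto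
  then have "bayes_threshold P X Q p0 p1 L0 L1 n v"
    by (simp add: bayes_threshold_def is_arg_min_def R_def)
  then show ?thesis ..
qed

text \<open>If the Bayes factor at a rejected value \<open>j\<close> were too small, it would be too small at all smaller
values by monotonicity, and moving the threshold to \<open>j + 1\<close> would lower the risk.\<close>

lemma bayes_threshold_le_imp:
  assumes "laplace_model P X" and Q: "finite_measure Q" "sets Q = sets borel"
    and L: "0 < p1 * L1" and opt: "bayes_threshold P X Q p0 p1 L0 L1 n v"
    and j: "v \<le> real j" "j \<le> n"
  shows "p0 * L0 \<le> p1 * L1 * bayes_factor Q n j"
proof (rule ccontr)
  assume neg: "\<not> ?thesis"
  have "bayes_risk P X Q p0 p1 L0 L1 n (real j + 1) < bayes_risk P X Q p0 p1 L0 L1 n v"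
    unfolding bayes_risk_eq_sum[OF assms(1-3)]
  proof (rule sum_strict_mono_ex1)
    show "\<forall>i\<in>{..n}. null_pmf n i * (if real i < real j + 1 then p1 * L1 * bayes_factor Q n i else p0 * L0)
        \<le> null_pmf n i * (if real i < v then p1 * L1 * bayes_factor Q n i else p0 * L0)"
    proof
      fix i assume i: "i \<in> {..n}"
      have "p1 * L1 * bayes_factor Q n i \<le> p1 * L1 * bayes_factor Q n j" if "i \<le> j"
        using that j L by (intro mult_left_mono bayes_factor_mono[OF Q]) auto
      then show "null_pmf n i * (if real i < real j + 1 then p1 * L1 * bayes_factor Q n i else p0 * L0)
        \<le> null_pmf n i * (if real i < v then p1 * L1 * bayes_factor Q n i else p0 * L0)"
        using neg j i null_pmf_pos[of i n] by (intro mult_left_mono) (auto intro: less_imp_le)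
    qed
    show "\<exists>i\<in>{..n}. null_pmf n i * (if real i < real j + 1 then p1 * L1 * bayes_factor Q n i else p0 * L0)
        < null_pmf n i * (if real i < v then p1 * L1 * bayes_factor Q n i else p0 * L0)"
      using neg j null_pmf_pos[of j n] by (intro bexI[of _ j]) auto
  qed simp
  then show False using opt by (auto simp: bayes_threshold_def is_arg_min_def)
qed

text \<open>The mirror image: if the Bayes factor at an accepted value \<open>j\<close> were too large, moving the threshold down
to \<open>j\<close> would lower the risk.\<close>

lemma bayes_threshold_gt_imp:
  assumes "laplace_model P X" and Q: "finite_measure Q" "sets Q = sets borel"
    and L: "0 < p1 * L1" and opt: "bayes_threshold P X Q p0 p1 L0 L1 n v"
    and j: "real j < v" "j \<le> n"
  shows "p1 * L1 * bayes_factor Q n j \<le> p0 * L0"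
proof (rule ccontr)
  assume neg: "\<not> ?thesis"
  have "bayes_risk P X Q p0 p1 L0 L1 n (real j) < bayes_risk P X Q p0 p1 L0 L1 n v"
    unfolding bayes_risk_eq_sum[OF assms(1-3)]
  proof (rule sum_strict_mono_ex1)
    show "\<forall>i\<in>{..n}. null_pmf n i * (if real i < real j then p1 * L1 * bayes_factor Q n i else p0 * L0)
        \<le> null_pmf n i * (if real i < v then p1 * L1 * bayes_factor Q n i else p0 * L0)"
    proof
      fix i assume i: "i \<in> {..n}"
      have "p1 * L1 * bayes_factor Q n j \<le> p1 * L1 * bayes_factor Q n i" if "j \<le> i"
        using that i L by (intro mult_left_mono bayes_factor_mono[OF Q]) auto
      then show "null_pmf n i * (if real i < real j then p1 * L1 * bayes_factor Q n i else p0 * L0)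
        \<le> null_pmf n i * (if real i < v then p1 * L1 * bayes_factor Q n i else p0 * L0)"
        using neg j i null_pmf_pos[of i n] by (intro mult_left_mono) (auto intro: less_imp_le)
    qed
    show "\<exists>i\<in>{..n}. null_pmf n i * (if real i < real j then p1 * L1 * bayes_factor Q n i else p0 * L0)
        < null_pmf n i * (if real i < v then p1 * L1 * bayes_factor Q n i else p0 * L0)"
      using neg j null_pmf_pos[of j n] by (intro bexI[of _ j]) auto
  qed simp
  then show False using opt by (auto simp: bayes_threshold_def is_arg_min_def)
qed

section \<open>Location of the threshold and the Type I error\<close>

definition dev_scale :: "nat \<Rightarrow> real" where
  "dev_scale n = sqrt (real n * ln (real n))"

lemma dev_scale_pos: "n \<ge> 2 \<Longrightarrow> dev_scale n > 0"
  by (simp add: dev_scale_def)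

lemma dev_scale_powr:
  assumes "n \<ge> 2" "x > 0"
  shows "(x * dev_scale n / n) powr s = x powr s * (real n powr (- s / 2) * ln (real n) powr (s / 2))"
proof -
  have n: "0 < real n" "0 < ln (real n)" using assms(1) by auto
  have "dev_scale n / n = real n powr (- 1 / 2) * ln (real n) powr (1 / 2)"
  proof -
    have "dev_scale n = real n powr (1 / 2) * ln (real n) powr (1 / 2)"
      using n by (simp add: dev_scale_def powr_half_sqrt real_sqrt_mult)
    moreover have "real n powr (1 / 2) / n = real n powr (- 1 / 2)"
      using n powr_diff[of "real n" "1/2" 1] by simp
    moreover have "real n powr (1 / 2) * z / n = real n powr (1 / 2) / n * z" for z by simp
    ultimately show ?thesis by simp
  qed
  then have "(x * dev_scale n / n) powr s
      = (x * (real n powr (- 1 / 2) * ln (real n) powr (1 / 2))) powr s"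
    by (simp only: times_divide_eq_right[symmetric])
  also have "\<dots> = x powr s * (real n powr (- s / 2) * ln (real n) powr (s / 2))"
    using assms n by (simp add: powr_mult powr_powr)
  finally show ?thesis .
qed

lemma eventually_moderate_dev:
  assumes "0 < a" "0 < b"
  shows "\<forall>\<^sub>F n in sequentially. \<forall>k. a * dev_scale n \<le> excess n k \<and> excess n k \<le> b * dev_scale n
    \<longrightarrow> moderate_dev n k \<and> 6 * excess n k \<le> n \<and> 27 * excess n k ^ 3 \<le> (real n)\<^sup>2"
proof -
  have "\<forall>\<^sub>F n in sequentially. sqrt (real n) \<le> a * dev_scale n"
    unfolding dev_scale_def using assms by real_asymp
  moreover have "\<forall>\<^sub>F n in sequentially. 6 * (b * dev_scale n) \<le> n"
    unfolding dev_scale_def using assms by real_asymp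
  moreover have "\<forall>\<^sub>F n in sequentially. 27 * (b * dev_scale n) ^ 3 \<le> (real n)\<^sup>2"
    unfolding dev_scale_def using assms by real_asymp
  ultimately show ?thesis using eventually_gt_at_top[of 0]
  proof eventually_elim
    case (elim n)
    show ?case
    proof (intro allI impI)
      fix k assume k: "a * dev_scale n \<le> excess n k \<and> excess n k \<le> b * dev_scale n"
      have d: "sqrt n \<le> excess n k" "6 * excess n k \<le> n" using k elim by auto
      then have d0: "0 \<le> excess n k" using real_sqrt_ge_zero[of "real n"] by linarith
      then have "27 * excess n k ^ 3 \<le> 27 * (b * dev_scale n) ^ 3"
        using k by (intro mult_left_mono power_mono) auto
      then have d3: "27 * excess n k ^ 3 \<le> (real n)\<^sup>2" using elim by simp
      have "2 * excess n k \<le> n" using d d0 by linarith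
      moreover have "k \<le> n"
      proof -
        have "2 * real k - n \<le> n" using d d0 unfolding excess_def[symmetric] by linarith
        then show ?thesis by simp
      qed
      moreover have "excess n k ^ 3 \<le> (real n)\<^sup>2" using d3 d0 by (smt (verit) zero_le_power)
      ultimately show "moderate_dev n k \<and> 6 * excess n k \<le> n \<and> 27 * excess n k ^ 3 \<le> (real n)\<^sup>2"
        using elim d d3 by (auto simp: moderate_dev_def)
    qed
  qed
qed

text \<open>The order of the Bayes factor: prior density at the peak, peak value, width of the peak.\<close>

definition peak_mass :: "real \<Rightarrow> nat \<Rightarrow> nat \<Rightarrow> real" where
  "peak_mass lam n k = (excess n k / n) powr (lam - 1) * exp ((excess n k)\<^sup>2 / (2 * real n)) / sqrt n"

text \<open>For \<open>d\<close> close to \<open>sqrt (a n log n)\<close> the Gaussian factor is \<open>n\<^bsup>a/2\<^esup>\<close> and the prior factor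
\<open>(d/n)\<^bsup>\<lambda>-1\<^esup> / sqrt n\<close> is \<open>n\<^bsup>-\<lambda>/2\<^esup>\<close> up to powers of \<open>log n\<close>. The window of length 2
is as long as the spacing of the possible values of \<open>d\<close>; across it \<open>d\<^sup>2/(2n)\<close> changes by \<open>o(1)\<close>.\<close>

lemma eventually_peak_mass_le:
  assumes "0 < lam" "0 < a"
  obtains c C where "0 < c" "0 < C"
    "\<forall>\<^sub>F n in sequentially. \<forall>k. sqrt a * dev_scale n \<le> excess n k \<and> excess n k \<le> sqrt a * dev_scale n + 2
      \<longrightarrow> moderate_dev n k
        \<and> c * (real n powr ((a - lam) / 2) * ln (real n) powr ((lam - 1) / 2)) \<le> peak_mass lam n k
        \<and> peak_mass lam n k \<le> C * (real n powr ((a - lam) / 2) * ln (real n) powr ((lam - 1) / 2))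
        \<and> exp (- 4 * (excess n k)\<^sup>2 / n) \<le> real n powr (- 4 * a)"
proof (rule that)
  define K where "K = 4 powr \<bar>lam - 1\<bar>"
  define x where "x = sqrt a"
  have x: "x > 0" using assms by (simp add: x_def)
  have K: "K > 0" by (simp add: K_def)
  show "0 < x powr (lam - 1) / K" "0 < exp 1 * K * x powr (lam - 1)" using x K by auto
  have "\<forall>\<^sub>F n in sequentially. 2 \<le> x * dev_scale n"
    unfolding dev_scale_def using x by real_asymp
  moreover have "\<forall>\<^sub>F n in sequentially. 4 * (x * dev_scale n) + 4 \<le> 2 * real n"
    unfolding dev_scale_def using x by real_asymp
  moreover have "\<forall>\<^sub>F n in sequentially. \<forall>k. x * dev_scale n \<le> excess n k \<and> excess n k \<le> (2 * x) * dev_scale n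
    \<longrightarrow> moderate_dev n k \<and> 6 * excess n k \<le> n \<and> 27 * excess n k ^ 3 \<le> (real n)\<^sup>2"
    using x by (intro eventually_moderate_dev) auto
  ultimately show "\<forall>\<^sub>F n in sequentially. \<forall>k. sqrt a * dev_scale n \<le> excess n k \<and> excess n k \<le> sqrt a * dev_scale n + 2
      \<longrightarrow> moderate_dev n k
        \<and> x powr (lam - 1) / K * (real n powr ((a - lam) / 2) * ln (real n) powr ((lam - 1) / 2)) \<le> peak_mass lam n k
        \<and> peak_mass lam n k \<le> exp 1 * K * x powr (lam - 1) * (real n powr ((a - lam) / 2) * ln (real n) powr ((lam - 1) / 2))
        \<and> exp (- 4 * (excess n k)\<^sup>2 / n) \<le> real n powr (- 4 * a)"
    using eventually_ge_at_top[of 2]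
  proof eventually_elim
    case (elim n)
    show ?case
    proof (intro allI impI)
      fix k assume k: "sqrt a * dev_scale n \<le> excess n k \<and> excess n k \<le> sqrt a * dev_scale n + 2"
      define D d where "D = x * dev_scale n" and "d = excess n k"
      have d: "D \<le> d" "d \<le> D + 2" "d \<le> 2 * D" "0 < D"
        using k elim by (auto simp: D_def d_def x_def)
      have md: "moderate_dev n k" using elim d by (auto simp: D_def d_def mult.assoc)
      have n: "real n > 0" "ln (real n) > 0" using elim by auto
      have DD: "D\<^sup>2 = a * (n * ln n)"
        using assms n by (simp add: D_def x_def dev_scale_def power_mult_distrib)
      have d1: "D\<^sup>2 \<le> d\<^sup>2" using d by (intro power_mono) auto
      have "d\<^sup>2 \<le> (D + 2)\<^sup>2" using d by (intro power_mono) auto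
      also have "\<dots> \<le> D\<^sup>2 + 2 * n" using elim by (simp add: D_def power2_eq_square algebra_simps)
      finally have d2: "d\<^sup>2 \<le> D\<^sup>2 + 2 * n" .
      have ex1: "real n powr (a / 2) \<le> exp (d\<^sup>2 / (2 * real n))"
      proof -
        have "a / 2 * ln n = D\<^sup>2 / (2 * real n)" using n by (simp add: DD)
        also have "\<dots> \<le> d\<^sup>2 / (2 * real n)" using d1 by (intro divide_right_mono) auto
        finally show ?thesis using n by (simp add: powr_def)
      qed
      have ex2: "exp (d\<^sup>2 / (2 * real n)) \<le> exp 1 * real n powr (a / 2)"
      proof -
        have "d\<^sup>2 / (2 * real n) \<le> (D\<^sup>2 + 2 * n) / (2 * real n)" using d2 by (intro divide_right_mono) auto
        also have "\<dots> = 1 + a / 2 * ln n" using n by (simp add: DD field_simps)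
        finally have "exp (d\<^sup>2 / (2 * real n)) \<le> exp (1 + a / 2 * ln n)" by simp
        also have "\<dots> = exp 1 * real n powr (a / 2)" using n by (simp add: powr_def exp_add)
        finally show ?thesis .
      qed
      have cmp: "(D / n) / 4 \<le> d / n" "d / n \<le> 4 * (D / n)" "0 < D / n"
        using d n by (auto simp: divide_right_mono field_simps)
      have pw: "(D / n) powr (lam - 1) / K \<le> (d / n) powr (lam - 1)"
        "(d / n) powr (lam - 1) \<le> K * (D / n) powr (lam - 1)"
        using powr_comparable[OF cmp(3,1,2), of "lam - 1"] by (auto simp: K_def powr_minus field_simps)
      have eq: "(D / n) powr (lam - 1) * real n powr (a / 2) / sqrt n
          = x powr (lam - 1) * (real n powr ((a - lam) / 2) * ln (real n) powr ((lam - 1) / 2))"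
      proof -
        have "real n powr (- (lam - 1) / 2) * real n powr (a / 2) / sqrt n
            = real n powr (- (lam - 1) / 2 + a / 2 - 1 / 2)"
          using n by (simp add: powr_diff powr_add powr_half_sqrt)
        also have "- (lam - 1) / 2 + a / 2 - 1 / 2 = (a - lam) / 2" by (simp add: field_simps)
        finally have P: "real n powr (- (lam - 1) / 2) * real n powr (a / 2) / sqrt n
            = real n powr ((a - lam) / 2)" .
        have "X * (p * l) * r / s = X * ((p * r / s) * l)" for X p l r s :: real by simp
        then show ?thesis
          unfolding D_def dev_scale_powr[OF elim(4) x] P[symmetric] by blast
      qed
      have "x powr (lam - 1) / K * (real n powr ((a - lam) / 2) * ln (real n) powr ((lam - 1) / 2))
          = (D / n) powr (lam - 1) / K * real n powr (a / 2) / sqrt n"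
        using eq K by (simp add: field_simps)
      also have "\<dots> \<le> (d / n) powr (lam - 1) * exp (d\<^sup>2 / (2 * real n)) / sqrt n"
        using pw ex1 K by (intro divide_right_mono mult_mono) auto
      finally have lo: "x powr (lam - 1) / K * (real n powr ((a - lam) / 2) * ln (real n) powr ((lam - 1) / 2))
          \<le> peak_mass lam n k" by (simp add: peak_mass_def d_def)
      have "(d / n) powr (lam - 1) * exp (d\<^sup>2 / (2 * real n)) / sqrt n
          \<le> K * (D / n) powr (lam - 1) * (exp 1 * real n powr (a / 2)) / sqrt n"
        using pw ex2 K by (intro divide_right_mono mult_mono) auto
      also have "\<dots> = exp 1 * K * ((D / n) powr (lam - 1) * real n powr (a / 2) / sqrt n)" by simp
      finally have hi: "peak_mass lam n k
          \<le> exp 1 * K * x powr (lam - 1) * (real n powr ((a - lam) / 2) * ln (real n) powr ((lam - 1) / 2))"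
        unfolding eq by (simp add: peak_mass_def d_def mult.assoc)
      have "exp (- 4 * d\<^sup>2 / n) \<le> exp (- 4 * D\<^sup>2 / n)"
        using d1 n by (simp add: divide_right_mono)
      also have "\<dots> = real n powr (- 4 * a)" using n by (simp add: DD powr_def)
      finally have "exp (- 4 * (excess n k)\<^sup>2 / n) \<le> real n powr (- 4 * a)" by (simp add: d_def)
      with md lo hi show "moderate_dev n k
        \<and> x powr (lam - 1) / K * (real n powr ((a - lam) / 2) * ln (real n) powr ((lam - 1) / 2)) \<le> peak_mass lam n k
        \<and> peak_mass lam n k \<le> exp 1 * K * x powr (lam - 1) * (real n powr ((a - lam) / 2) * ln (real n) powr ((lam - 1) / 2))
        \<and> exp (- 4 * (excess n k)\<^sup>2 / n) \<le> real n powr (- 4 * a)" by blast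
    qed
  qed
qed

lemma exists_excess_in_window:
  assumes "0 \<le> D"
  obtains k where "D \<le> excess n k" "excess n k \<le> D + 2"
proof (rule that)
  define k where "k = nat \<lceil>(n + D) / 2\<rceil>"
  have "0 \<le> \<lceil>(n + D) / 2\<rceil>" using assms by simp
  then have "real k = of_int \<lceil>(n + D) / 2\<rceil>" by (simp add: k_def)
  then have "(n + D) / 2 \<le> real k" "real k \<le> (n + D) / 2 + 1" by linarith+
  then show "D \<le> excess n k" "excess n k \<le> D + 2" by (simp_all add: excess_def field_simps)
qed

context
  fixes lam gam A B :: real and v :: "nat \<Rightarrow> real"
  assumes lam: "0 < lam" and gam: "0 < gam" and A: "0 < A" and B: "0 < B"
    and ge: "\<And>n j. v n \<le> real j \<Longrightarrow> j \<le> n \<Longrightarrow> A \<le> B * bayes_factor (gamma_prior lam gam) n j"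
    and less: "\<And>n j. real j < v n \<Longrightarrow> j \<le> n \<Longrightarrow> B * bayes_factor (gamma_prior lam gam) n j \<le> A"
begin

text \<open>For \<open>a > \<lambda>\<close> the Bayes factor at deviation \<open>sqrt (a n log n)\<close> tends to infinity, so that value is
rejected.\<close>

lemma threshold_eventually_le:
  assumes "lam < a"
  shows "\<forall>\<^sub>F n in sequentially. 2 * v n - n \<le> sqrt a * dev_scale n + 2"
proof -
  have a: "0 < a" using assms lam by simp
  obtain c0 where c0: "c0 > 0" "\<And>n k. moderate_dev n k \<Longrightarrow>
      c0 * peak_mass lam n k \<le> bayes_factor (gamma_prior lam gam) n k"
    using bayes_factor_lower[OF lam gam] unfolding peak_mass_def by metis
  obtain c C where c: "0 < c" "0 < C" and ev:
    "\<forall>\<^sub>F n in sequentially. \<forall>k. sqrt a * dev_scale n \<le> excess n k \<and> excess n k \<le> sqrt a * dev_scale n + 2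
      \<longrightarrow> moderate_dev n k
        \<and> c * (real n powr ((a - lam) / 2) * ln (real n) powr ((lam - 1) / 2)) \<le> peak_mass lam n k
        \<and> peak_mass lam n k \<le> C * (real n powr ((a - lam) / 2) * ln (real n) powr ((lam - 1) / 2))
        \<and> exp (- 4 * (excess n k)\<^sup>2 / n) \<le> real n powr (- 4 * a)"
    using eventually_peak_mass_le[OF lam a] by blast
  have "filterlim (\<lambda>n. real n powr ((a - lam) / 2) * ln (real n) powr ((lam - 1) / 2)) at_top sequentially"
    using assms by real_asymp
  then have "\<forall>\<^sub>F n in sequentially. A / (B * c0 * c) < real n powr ((a - lam) / 2) * ln (real n) powr ((lam - 1) / 2)"
    by (simp add: filterlim_at_top_dense)
  with ev show ?thesis using eventually_ge_at_top[of 2]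
  proof eventually_elim
    case (elim n)
    have "0 \<le> sqrt a * dev_scale n" using a dev_scale_pos[OF elim(3)] by simp
    then obtain k where k: "sqrt a * dev_scale n \<le> excess n k" "excess n k \<le> sqrt a * dev_scale n + 2"
      by (rule exists_excess_in_window)
    with elim have md: "moderate_dev n k"
      and pm: "c * (real n powr ((a - lam) / 2) * ln (real n) powr ((lam - 1) / 2)) \<le> peak_mass lam n k"
      by auto
    have "A < B * (c0 * (c * (real n powr ((a - lam) / 2) * ln (real n) powr ((lam - 1) / 2))))"
      using elim(2) B c0 c by (simp add: pos_divide_less_eq mult.commute mult.left_commute)
    also have "\<dots> \<le> B * (c0 * peak_mass lam n k)"
      using pm B c0 by (intro mult_left_mono) auto
    also have "\<dots> \<le> B * bayes_factor (gamma_prior lam gam) n k"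
      using c0(2)[OF md] B by (intro mult_left_mono) auto
    finally have "\<not> real k < v n" using less[of k n] md by (auto simp: moderate_dev_def)
    then show ?case using k by (simp add: excess_def)
  qed
qed

text \<open>For \<open>a < \<lambda>\<close> the Bayes factor at deviation \<open>sqrt (a n log n)\<close> tends to \<open>0\<close>, so that value is accepted.\<close>

lemma threshold_eventually_ge:
  assumes "0 < a" "a < lam"
  shows "\<forall>\<^sub>F n in sequentially. sqrt a * dev_scale n \<le> 2 * v n - n"
proof -
  obtain C0 where C0: "C0 > 0" "\<And>n k. moderate_dev n k \<Longrightarrow>
      bayes_factor (gamma_prior lam gam) n k \<le> C0 * (peak_mass lam n k + exp (- 4 * (excess n k)\<^sup>2 / n))"
    using bayes_factor_upper[OF lam gam] unfolding peak_mass_def by metis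
  obtain c C where c: "0 < c" "0 < C" and ev:
    "\<forall>\<^sub>F n in sequentially. \<forall>k. sqrt a * dev_scale n \<le> excess n k \<and> excess n k \<le> sqrt a * dev_scale n + 2
      \<longrightarrow> moderate_dev n k
        \<and> c * (real n powr ((a - lam) / 2) * ln (real n) powr ((lam - 1) / 2)) \<le> peak_mass lam n k
        \<and> peak_mass lam n k \<le> C * (real n powr ((a - lam) / 2) * ln (real n) powr ((lam - 1) / 2))
        \<and> exp (- 4 * (excess n k)\<^sup>2 / n) \<le> real n powr (- 4 * a)"
    using eventually_peak_mass_le[OF lam assms(1)] by blast
  have "(\<lambda>n. real n powr ((a - lam) / 2) * ln (real n) powr ((lam - 1) / 2)) \<longlonglongrightarrow> 0"
    using assms by real_asymp
  moreover have "(\<lambda>n. real n powr (- 4 * a)) \<longlonglongrightarrow> 0"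
    using assms by real_asymp
  ultimately have "(\<lambda>n. C * (real n powr ((a - lam) / 2) * ln (real n) powr ((lam - 1) / 2)) + real n powr (- 4 * a)) \<longlonglongrightarrow> C * 0 + 0"
    by (intro tendsto_intros)
  then have "\<forall>\<^sub>F n in sequentially. C * (real n powr ((a - lam) / 2) * ln (real n) powr ((lam - 1) / 2))
      + real n powr (- 4 * a) < A / (B * C0)"
    using A B C0 by (intro order_tendstoD(2)) auto
  with ev show ?thesis using eventually_ge_at_top[of 2]
  proof eventually_elim
    case (elim n)
    have "0 \<le> sqrt a * dev_scale n" using assms dev_scale_pos[OF elim(3)] by simp
    then obtain k where k: "sqrt a * dev_scale n \<le> excess n k" "excess n k \<le> sqrt a * dev_scale n + 2"
      by (rule exists_excess_in_window)
    with elim have md: "moderate_dev n k"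
      and pm: "peak_mass lam n k \<le> C * (real n powr ((a - lam) / 2) * ln (real n) powr ((lam - 1) / 2))"
        "exp (- 4 * (excess n k)\<^sup>2 / n) \<le> real n powr (- 4 * a)"
      by auto
    have "B * bayes_factor (gamma_prior lam gam) n k
        \<le> B * (C0 * (peak_mass lam n k + exp (- 4 * (excess n k)\<^sup>2 / n)))"
      using C0(2)[OF md] B by (intro mult_left_mono) auto
    also have "\<dots> \<le> B * (C0 * (C * (real n powr ((a - lam) / 2) * ln (real n) powr ((lam - 1) / 2))
        + real n powr (- 4 * a)))"
      using pm B C0 by (intro mult_left_mono add_mono) auto
    also have "\<dots> < A"
      using elim(2) B C0 by (simp add: pos_less_divide_eq mult.commute mult.left_commute)
    finally have "\<not> v n \<le> real k" using ge[of n k] md by (auto simp: moderate_dev_def)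
    then show ?case using k by (simp add: excess_def)
  qed
qed

lemma threshold_limit: "(\<lambda>n. (2 * v n - n) / dev_scale n) \<longlonglongrightarrow> sqrt lam"
proof (rule order_tendstoI)
  fix y assume y: "y < sqrt lam"
  then obtain w where w: "0 \<le> w" "y \<le> w" "w < sqrt lam"
    using lam by (intro that[of "max y 0"]) auto
  define y0 where "y0 = (w + sqrt lam) / 2"
  have "0 < sqrt lam" using lam by simp
  with w have y0: "0 < y0" "y < y0" "y0 < sqrt lam" by (simp_all add: y0_def)
  have "y0\<^sup>2 < (sqrt lam)\<^sup>2" using y0 by (intro power_strict_mono) auto
  then have "y0\<^sup>2 < lam" using lam by simp
  then have "\<forall>\<^sub>F n in sequentially. sqrt (y0\<^sup>2) * dev_scale n \<le> 2 * v n - n"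
    using y0 by (intro threshold_eventually_ge) auto
  then show "\<forall>\<^sub>F n in sequentially. y < (2 * v n - n) / dev_scale n"
    using eventually_ge_at_top[of 2]
  proof eventually_elim
    case (elim n)
    then have "y0 \<le> (2 * v n - n) / dev_scale n"
      using y0 dev_scale_pos[of n] by (simp add: pos_le_divide_eq)
    then show ?case using y0 by simp
  qed
next
  fix y assume y: "sqrt lam < y"
  define y0 where "y0 = (y + sqrt lam) / 2"
  have y0: "y0 < y" "sqrt lam < y0" using y by (simp_all add: y0_def)
  then have "0 < y0" using real_sqrt_gt_zero[OF lam] by linarith
  have "(sqrt lam)\<^sup>2 < y0\<^sup>2" using y0(2) lam by (intro power_strict_mono) auto
  then have "lam < y0\<^sup>2" using lam by simp
  then have "\<forall>\<^sub>F n in sequentially. 2 * v n - n \<le> sqrt (y0\<^sup>2) * dev_scale n + 2"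
    by (intro threshold_eventually_le)
  moreover have "(\<lambda>n. 2 / dev_scale n) \<longlonglongrightarrow> 0" unfolding dev_scale_def by real_asymp
  then have "\<forall>\<^sub>F n in sequentially. 2 / dev_scale n < y - y0"
    using y0 by (intro order_tendstoD) auto
  ultimately show "\<forall>\<^sub>F n in sequentially. (2 * v n - n) / dev_scale n < y"
    using eventually_ge_at_top[of 2]
  proof eventually_elim
    case (elim n)
    then have "(2 * v n - n) / dev_scale n \<le> (y0 * dev_scale n + 2) / dev_scale n"
      using \<open>0 < y0\<close> dev_scale_pos[of n] by (intro divide_right_mono) auto
    also have "\<dots> = y0 + 2 / dev_scale n" using dev_scale_pos[of n] elim by (simp add: field_simps)
    finally show ?case using elim by simp
  qed
qed

text \<open>Let \<open>k\<close> be the smallest rejected value. Optimality at \<open>k\<close> and at \<open>k - 1\<close> bounds the Bayes factor from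
below and from above by constants, and the Laplace estimates translate this into two-sided bounds
for \<open>E = exp (-d\<^sup>2/(2n))\<close>. Passing from \<open>k - 1\<close> to \<open>k\<close> costs a bounded factor because
\<open>d\<close> is \<open>o(n)\<close>. Inserting the bounds into the tail estimate and using \<open>d\<close> of order
\<open>sqrt (n log n)\<close> gives the result.\<close>

lemma threshold_type1_bigtheta:
  "(\<lambda>n. \<Sum>j | j \<le> n \<and> v n \<le> real j. null_pmf n j)
     \<in> \<Theta>(\<lambda>n. real n powr (- lam / 2) * ln (real n) powr (lam / 2 - 1))"
proof -
  define x where "x = sqrt lam"
  have x: "x > 0" using lam by (simp add: x_def)
  define K where "K = 4 powr \<bar>lam - 1\<bar>"
  have K: "K > 0" by (simp add: K_def)
  obtain cl where cl: "cl > 0" "\<And>n k. moderate_dev n k \<Longrightarrow>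
      cl * peak_mass lam n k \<le> bayes_factor (gamma_prior lam gam) n k"
    using bayes_factor_lower[OF lam gam] unfolding peak_mass_def by metis
  obtain Cu where Cu: "Cu > 0" "\<And>n k. moderate_dev n k \<Longrightarrow>
      bayes_factor (gamma_prior lam gam) n k \<le> Cu * (peak_mass lam n k + exp (- 4 * (excess n k)\<^sup>2 / n))"
    using bayes_factor_upper[OF lam gam] unfolding peak_mass_def by metis
  obtain ct Ct where ct: "ct > 0" "Ct > 0"
    "\<And>n k. moderate_dev n k \<Longrightarrow> 6 * excess n k \<le> n \<Longrightarrow> 27 * excess n k ^ 3 \<le> (real n)\<^sup>2 \<Longrightarrow>
      ct * (sqrt n / excess n k * exp (- (excess n k)\<^sup>2 / (2 * real n))) \<le> (\<Sum>j\<in>{k..n}. null_pmf n j)"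
    "\<And>n k. moderate_dev n k \<Longrightarrow>
      (\<Sum>j\<in>{k..n}. null_pmf n j) \<le> Ct * (sqrt n / excess n k * exp (- (excess n k)\<^sup>2 / (2 * real n)))"
    using null_tail_moderate by metis
  define c' where "c' = A / (2 * (B * Cu))"
  define C' where "C' = A / (B * cl)"
  have c': "c' > 0" "C' > 0" using A B Cu cl by (auto simp: c'_def C'_def)
  have ev1: "\<forall>\<^sub>F n in sequentially. x / 2 < (2 * v n - n) / dev_scale n"
    using x by (intro order_tendstoD(1)[OF threshold_limit]) (simp add: x_def)
  have ev2: "\<forall>\<^sub>F n in sequentially. (2 * v n - n) / dev_scale n < 2 * x"
    using x by (intro order_tendstoD(2)[OF threshold_limit]) (simp add: x_def)
  have ev3: "\<forall>\<^sub>F n in sequentially. 8 \<le> x * dev_scale n"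
    unfolding dev_scale_def using x by real_asymp
  have ev4: "\<forall>\<^sub>F n in sequentially. \<forall>k. x / 4 * dev_scale n \<le> excess n k \<and> excess n k \<le> 4 * x * dev_scale n
    \<longrightarrow> moderate_dev n k \<and> 6 * excess n k \<le> n \<and> 27 * excess n k ^ 3 \<le> (real n)\<^sup>2"
    using x by (intro eventually_moderate_dev) auto
  have "(\<lambda>n. real n powr (- lam / 4)) \<longlonglongrightarrow> 0" using lam by real_asymp
  then have ev5: "\<forall>\<^sub>F n in sequentially. real n powr (- lam / 4) < c'"
    using c' by (intro order_tendstoD) auto
  define T where "T = (\<lambda>n. (x * dev_scale n / n) powr (lam - 1) / (x * dev_scale n))"
  have ev: "\<forall>\<^sub>F n in sequentially.
      ct * (exp (- 1) / (4 * K * C')) * T n \<le> (\<Sum>j | j \<le> n \<and> v n \<le> real j. null_pmf n j)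
      \<and> (\<Sum>j | j \<le> n \<and> v n \<le> real j. null_pmf n j) \<le> Ct * (4 * K / c') * T n"
    using ev1 ev2 ev3 ev4 ev5 eventually_ge_at_top[of 2]
  proof eventually_elim
    case (elim n)
    define S where "S = x * dev_scale n"
    have n: "real n > 0" "ln (real n) > 0" using elim by auto
    have dev: "dev_scale n > 0" using dev_scale_pos elim by simp
    have S: "S \<ge> 8" "S / 2 < 2 * v n - n" "2 * v n - n < 2 * S"
      using elim dev by (simp_all add: S_def pos_less_divide_eq pos_divide_less_eq)
    have v0: "0 < v n" using S n by linarith
    define k where "k = nat \<lceil>v n\<rceil>"
    have k: "v n \<le> real k" "real k < v n + 1" using v0 unfolding k_def by linarith+
    have k1: "k \<ge> 1" using k v0 by (cases k) auto
    define d where "d = excess n k"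
    have d: "S / 2 < d" "d < 2 * S + 2" using S k by (auto simp: d_def excess_def)
    have dk1: "excess n (k - 1) = d - 2" using k1 by (simp add: d_def excess_def of_nat_diff)
    have near: "S / 4 \<le> d" "d \<le> 4 * S" "S / 4 \<le> d - 2" "d - 2 \<le> 4 * S" using d S by linarith+
    have mk: "moderate_dev n k" "6 * d \<le> n" "27 * d ^ 3 \<le> (real n)\<^sup>2"
      using elim(4) near by (auto simp: d_def S_def ac_simps)
    have mk1: "moderate_dev n (k - 1)" using elim(4) near dk1 by (auto simp: S_def ac_simps)
    have kn: "k \<le> n" using mk by (simp add: moderate_dev_def)
    have tail: "{j. j \<le> n \<and> v n \<le> real j} = {k..n}"
      using k v0 by (auto simp: k_def le_nat_iff nat_le_iff ceiling_le_iff)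
    define w where "w = (S / n) powr (lam - 1)"
    have w: "w > 0" using S n by (auto simp: w_def)
    have cmp: "w / K \<le> (y / n) powr (lam - 1) \<and> (y / n) powr (lam - 1) \<le> K * w"
      if "S / 4 \<le> y" "y \<le> 4 * S" for y
    proof -
      have "0 < S / n" "(S / n) / 4 \<le> y / n" "y / n \<le> 4 * (S / n)"
        using that S n by (auto simp: divide_right_mono field_simps)
      from powr_comparable[OF this, of "lam - 1"] show ?thesis
        by (auto simp: K_def w_def powr_minus field_simps)
    qed
    define E where "E = exp (- d\<^sup>2 / (2 * real n))"
    \<comment> \<open>Since \<open>k\<close> is rejected, its Bayes factor is bounded below; the tail summand of the upper
        Laplace estimate vanishes, so the peak term is bounded below.\<close>
    have "A \<le> B * (Cu * (peak_mass lam n k + exp (- 4 * d\<^sup>2 / n)))"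
      using ge[OF k(1) kn] Cu(2)[OF mk(1)] B unfolding d_def by (smt (verit) mult_left_mono)
    moreover have "exp (- 4 * d\<^sup>2 / n) < c'"
    proof -
      have "(S / 4)\<^sup>2 \<le> d\<^sup>2" using near S by (intro power_mono) auto
      moreover have "S\<^sup>2 = lam * (n * ln n)"
        using lam n by (simp add: S_def x_def dev_scale_def power_mult_distrib)
      ultimately have "lam / 16 * (n * ln n) \<le> d\<^sup>2" by (simp add: power_divide)
      then have "4 * (lam / 16 * (n * ln n)) / n \<le> 4 * d\<^sup>2 / n" by (intro divide_right_mono mult_left_mono) auto
      then have "- 4 * d\<^sup>2 / n \<le> - lam / 4 * ln n" using n by simp
      then have "exp (- 4 * d\<^sup>2 / n) \<le> real n powr (- lam / 4)" using n by (simp add: powr_def)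
      then show ?thesis using elim(5) by simp
    qed
    moreover have "A = B * (Cu * (2 * c'))" using B Cu by (simp add: c'_def)
    ultimately have "B * Cu * (2 * c') \<le> B * Cu * (peak_mass lam n k + exp (- 4 * d\<^sup>2 / n))"
      by (simp add: mult.assoc)
    then have "2 * c' \<le> peak_mass lam n k + exp (- 4 * d\<^sup>2 / n)" using B Cu by simp
    then have pm: "c' \<le> peak_mass lam n k" using \<open>exp (- 4 * d\<^sup>2 / n) < c'\<close> by linarith
    have E_eq: "exp (d\<^sup>2 / (2 * real n)) = 1 / E" by (simp add: E_def exp_minus field_simps)
    have E0: "E > 0" by (simp add: E_def)
    have "c' * E \<le> ((d / n) powr (lam - 1) * (1 / E) / sqrt n) * E"
      using pm E0 unfolding peak_mass_def d_def[symmetric] E_eq by (intro mult_right_mono) auto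
    also have "\<dots> = (d / n) powr (lam - 1) / sqrt n" using E0 by simp
    also have "\<dots> \<le> K * w / sqrt n" using cmp near by (intro divide_right_mono) auto
    finally have E_up: "E \<le> K * w / (c' * sqrt n)" using c' n by (simp add: field_simps)
    \<comment> \<open>Since \<open>k - 1\<close> is accepted, its Bayes factor is bounded above.\<close>
    have "real (k - 1) < v n" using k k1 by (simp add: of_nat_diff)
    then have "B * (cl * peak_mass lam n (k - 1)) \<le> A"
      using less[of "k - 1" n] kn cl(2)[OF mk1] B by (smt (verit) diff_le_self le_trans mult_left_mono)
    then have pm1: "peak_mass lam n (k - 1) \<le> C'" using B cl by (simp add: C'_def field_simps)
    have "exp ((d - 2)\<^sup>2 / (2 * real n)) \<ge> exp (- 1) / E"
    proof -
      have "d\<^sup>2 \<le> (d - 2)\<^sup>2 + 2 * n" using mk(2) near S by (simp add: power2_eq_square algebra_simps)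
      then have "d\<^sup>2 / (2 * real n) \<le> ((d - 2)\<^sup>2 + 2 * n) / (2 * real n)" by (intro divide_right_mono) auto
      also have "\<dots> = (d - 2)\<^sup>2 / (2 * real n) + 1" using n by (simp add: field_simps)
      finally have "exp (- 1 + d\<^sup>2 / (2 * real n)) \<le> exp ((d - 2)\<^sup>2 / (2 * real n))" by simp
      then show ?thesis unfolding exp_add E_eq by simp
    qed
    then have "(w / K) * (exp (- 1) / E) / sqrt n
        \<le> ((d - 2) / n) powr (lam - 1) * exp ((d - 2)\<^sup>2 / (2 * real n)) / sqrt n"
      using cmp[of "d - 2"] near by (intro divide_right_mono mult_mono) (auto simp: E_def)
    also have "\<dots> \<le> C'" using pm1 unfolding peak_mass_def dk1 .
    finally have E_lo: "exp (- 1) * w / (K * C' * sqrt n) \<le> E"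
      using K c' n by (simp add: E_def field_simps)
    have T: "T n = w / S" by (simp add: T_def w_def S_def)
    have dpos: "0 < d" using near S by linarith
    have "(\<Sum>j\<in>{k..n}. null_pmf n j) \<le> Ct * (sqrt n / d * E)"
      using ct(4)[OF mk(1)] by (simp add: d_def E_def)
    also have "\<dots> \<le> Ct * (sqrt n / (S / 4) * (K * w / (c' * sqrt n)))"
      using near S E_up ct(2) dpos by (intro mult_left_mono mult_mono divide_left_mono) (auto simp: E_def)
    also have "\<dots> = Ct * (4 * K / c') * T n" using n by (simp add: T field_simps)
    finally have up: "(\<Sum>j\<in>{k..n}. null_pmf n j) \<le> Ct * (4 * K / c') * T n" .
    have "ct * (exp (- 1) / (4 * K * C')) * T n
        = ct * (sqrt n / (4 * S) * (exp (- 1) * w / (K * C' * sqrt n)))"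
      using n by (simp add: T field_simps)
    also have "\<dots> \<le> ct * (sqrt n / d * E)"
      using near S E_lo ct(1) dpos w K c' by (intro mult_left_mono mult_mono divide_left_mono) auto
    also have "\<dots> \<le> (\<Sum>j\<in>{k..n}. null_pmf n j)"
      using ct(3)[OF mk(1)] mk by (simp add: d_def E_def)
    finally show ?case using up by (simp add: tail)
  qed
  have T_eq: "\<forall>\<^sub>F n in sequentially. T n
      = x powr (lam - 2) * (real n powr (- lam / 2) * ln (real n) powr (lam / 2 - 1))"
    using eventually_ge_at_top[of 2]
  proof eventually_elim
    case (elim n)
    have n: "real n > 0" "ln (real n) > 0" using elim by auto
    have xd: "x * dev_scale n > 0" using x dev_scale_pos elim by simp
    then have S: "x * dev_scale n / n > 0" using n by simp
    have "T n = (x * dev_scale n / n) powr (lam - 2) / n"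
      using S xd n powr_diff[of "x * dev_scale n / n" "lam - 1" 1] by (simp add: T_def)
    also have "\<dots> = x powr (lam - 2) * ((real n powr (- (lam - 2) / 2) / n) * ln (real n) powr ((lam - 2) / 2))"
      unfolding dev_scale_powr[OF elim x] by simp
    also have "real n powr (- (lam - 2) / 2) / n = real n powr (- (lam - 2) / 2 - 1)"
      using n by (simp add: powr_diff)
    also have "- (lam - 2) / 2 - 1 = - lam / 2" by (simp add: field_simps)
    also have "(lam - 2) / 2 = lam / 2 - 1" by (simp add: field_simps)
    finally show ?case .
  qed
  have "(\<lambda>n. \<Sum>j | j \<le> n \<and> v n \<le> real j. null_pmf n j) \<in> \<Theta>(T)"
  proof (rule bigthetaI)
    have pos: "\<forall>\<^sub>F n in sequentially. 0 < T n"
      using eventually_ge_at_top[of 2]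
    proof eventually_elim
      case (elim n)
      have "x * dev_scale n > 0" using x dev_scale_pos[OF elim] by simp
      moreover have "x * dev_scale n / n \<noteq> 0" using calculation elim by auto
      ultimately show ?case unfolding T_def by (intro divide_pos_pos) (simp_all only: powr_gt_zero not_False_eq_True)
    qed
    have nn: "0 \<le> (\<Sum>j | j \<le> n \<and> v n \<le> real j. null_pmf n j)" for n
      by (auto simp: null_pmf_def intro!: sum_nonneg)
    show "(\<lambda>n. \<Sum>j | j \<le> n \<and> v n \<le> real j. null_pmf n j) \<in> O(T)"
      by (rule bigoI[of _ "Ct * (4 * K / c')"]) (use ev pos in eventually_elim, use nn in auto)
    show "(\<lambda>n. \<Sum>j | j \<le> n \<and> v n \<le> real j. null_pmf n j) \<in> \<Omega>(T)"
    proof (rule landau_omega.bigI)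
      show "ct * (exp (- 1) / (4 * K * C')) > 0" using ct K c' by simp
      show "\<forall>\<^sub>F n in sequentially. norm (\<Sum>j | j \<le> n \<and> v n \<le> real j. null_pmf n j)
          \<ge> ct * (exp (- 1) / (4 * K * C')) * norm (T n)"
        using ev pos by eventually_elim (use nn in auto)
    qed
  qed
  also have "\<Theta>(T) = \<Theta>(\<lambda>n. x powr (lam - 2) * (real n powr (- lam / 2) * ln (real n) powr (lam / 2 - 1)))"
    by (rule landau_theta.cong_bigtheta, rule bigthetaI_cong, rule T_eq)
  also have "\<dots> = \<Theta>(\<lambda>n. real n powr (- lam / 2) * ln (real n) powr (lam / 2 - 1))"
    using x by (intro landau_theta.cong_bigtheta) simp
  finally show ?thesis .
qed

end

section \<open>Type II error and the critical scale\<close>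

lemma gamma_prior_AE_pos: "AE \<theta> in gamma_prior lam gam. 0 < \<theta>"
  unfolding gamma_prior_eq_density
  by (subst AE_density) (auto simp: gamma_density_def indicator_def)

text \<open>The threshold exceeds \<open>n/2\<close> by about \<open>sqrt (\<lambda> n log n) / 2\<close>, while \<open>\<theta>\<close> moves the mean of the
statistic by at most \<open>n\<theta>/2\<close>. For the stated \<open>\<theta>\<close> a gap of order \<open>sqrt (n log n)\<close> remains, and Hoeffding's
inequality makes rejection unlikely.\<close>

lemma type2_error_ge_half_near_null:
  fixes v :: "nat \<Rightarrow> real"
  assumes model: "laplace_model P X" and lam: "0 < lam"
    and lim: "(\<lambda>n. (2 * v n - n) / dev_scale n) \<longlonglongrightarrow> sqrt lam"
  shows "\<forall>\<^sub>F n in sequentially. \<forall>\<theta>. 0 < \<theta> \<and> \<theta> \<le> sqrt lam / 4 * (dev_scale n / n)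
    \<longrightarrow> 1 / 2 \<le> type2_error P X n (v n) \<theta>"
proof -
  define x where "x = sqrt lam"
  have x: "x > 0" using lam by (simp add: x_def)
  have "\<forall>\<^sub>F n in sequentially. x / 2 < (2 * v n - n) / dev_scale n"
    using x by (intro order_tendstoD(1)[OF lim]) (simp add: x_def)
  moreover have "(\<lambda>n. real n powr (- lam / 32)) \<longlonglongrightarrow> 0" using lam by real_asymp
  then have "\<forall>\<^sub>F n in sequentially. real n powr (- lam / 32) < 1 / 2"
    by (intro order_tendstoD(2)) auto
  ultimately show ?thesis using eventually_ge_at_top[of 2]
  proof eventually_elim
    case (elim n)
    define D where "D = dev_scale n"
    have n: "real n > 0" "n > 0" "ln (real n) > 0" using elim by auto
    have D: "D > 0" using dev_scale_pos elim by (simp add: D_def)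
    have v: "x / 2 * D < 2 * v n - n" using elim D by (simp add: D_def pos_less_divide_eq)
    show ?case
    proof (intro allI impI)
      fix \<theta> assume \<theta>: "0 < \<theta> \<and> \<theta> \<le> sqrt lam / 4 * (dev_scale n / n)"
      then have \<theta>0: "0 \<le> \<theta>" by simp
      define p where "p = 1 - exp (- \<theta>) / 2"
      have p: "p \<in> {0..1}" using prob_pos_in_unit[OF \<theta>0] by (simp add: p_def)
      interpret bin: binomial_distribution n p by unfold_locales (rule p)
      have "p \<le> 1 / 2 + \<theta> / 2" using exp_ge_add_one_self[of "-\<theta>"] by (simp add: p_def)
      then have "n * p \<le> n * (1 / 2 + \<theta> / 2)" by (intro mult_left_mono) auto
      moreover have "n * \<theta> \<le> x / 4 * D" using \<theta> n by (simp add: x_def D_def field_simps)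
      ultimately have gap: "n * p + x / 8 * D \<le> v n" using v by (simp add: algebra_simps)
      have "measure_pmf.prob (binomial_pmf n p) {k. v n \<le> real k}
          \<le> measure_pmf.prob (binomial_pmf n p) {k. n * p + x / 8 * D \<le> real k}"
        using gap by (intro measure_pmf.finite_measure_mono) auto
      also have "\<dots> \<le> exp (- 2 * (x / 8 * D)\<^sup>2 / n)"
        using x D n by (intro bin.prob_ge) auto
      also have "- 2 * (x / 8 * D)\<^sup>2 / n = - lam / 32 * ln n"
      proof -
        have "x\<^sup>2 = lam" "D\<^sup>2 = n * ln n" using lam n by (auto simp: x_def D_def dev_scale_def)
        then show ?thesis using n by (simp add: power_mult_distrib power_divide)
      qed
      also have "exp \<dots> = real n powr (- lam / 32)" using n by (simp add: powr_def)
      finally have "measure_pmf.prob (binomial_pmf n p) {k. v n \<le> real k} < 1 / 2" using elim by simp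
      moreover have "measure_pmf.prob (binomial_pmf n p) {k. real k < v n}
          = 1 - measure_pmf.prob (binomial_pmf n p) {k. v n \<le> real k}"
      proof -
        have "{k. real k < v n} = UNIV - {k. v n \<le> real k}" by auto
        then show ?thesis using measure_pmf.prob_compl[of "{k. v n \<le> real k}" "binomial_pmf n p"] by simp
      qed
      ultimately show "1 / 2 \<le> type2_error P X n (v n) \<theta>"
        using prob_sign_stat_Collect(1)[OF model \<theta>0, of "\<lambda>s. s < v n" n]
        by (simp add: type2_error_def p_def)
    qed
  qed
qed

text \<open>For \<open>\<theta> \<ge> K sqrt (log n / n)\<close> the mean exceeds the threshold by at least \<open>K sqrt (n log n) / 8\<close>;
Hoeffding's inequality turns this into a power of \<open>n\<close> whose exponent grows with \<open>K\<close>. The bound is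
uniform in large \<open>\<theta>\<close> because the mean increases with \<open>\<theta>\<close>.\<close>

lemma type2_error_polynomially_small:
  fixes v :: "nat \<Rightarrow> real"
  assumes model: "laplace_model P X" and lam: "0 < lam"
    and lim: "(\<lambda>n. (2 * v n - n) / dev_scale n) \<longlonglongrightarrow> sqrt lam"
    and K: "8 * sqrt lam \<le> K"
  shows "\<forall>\<^sub>F n in sequentially. \<forall>\<theta>. K * (dev_scale n / n) \<le> \<theta>
    \<longrightarrow> type2_error P X n (v n) \<theta> \<le> real n powr (- K\<^sup>2 / 32)"
proof -
  define x where "x = sqrt lam"
  have x: "x > 0" using lam by (simp add: x_def)
  then have K0: "K > 0" using K unfolding x_def by linarith
  have "\<forall>\<^sub>F n in sequentially. (2 * v n - n) / dev_scale n < 2 * x"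
    using x by (intro order_tendstoD(2)[OF lim]) (simp add: x_def)
  moreover have "\<forall>\<^sub>F n in sequentially. K * (dev_scale n / n) \<le> 1"
    unfolding dev_scale_def using K0 by real_asymp
  ultimately show ?thesis using eventually_ge_at_top[of 2]
  proof eventually_elim
    case (elim n)
    define D u where "D = dev_scale n" and "u = K * (dev_scale n / n)"
    have n: "real n > 0" "n > 0" "ln (real n) > 0" using elim by auto
    have D: "D > 0" using dev_scale_pos elim by (simp add: D_def)
    have u: "0 < u" "u \<le> 1" using elim D K0 n by (auto simp: u_def D_def)
    have v: "2 * v n - n < 2 * x * D" using elim D by (simp add: D_def pos_divide_less_eq)
    show ?case
    proof (intro allI impI)
      fix \<theta> assume "K * (dev_scale n / n) \<le> \<theta>"
      then have \<theta>: "u \<le> \<theta>" "0 \<le> \<theta>" using u by (auto simp: u_def)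
      define p where "p = 1 - exp (- \<theta>) / 2"
      have p: "p \<in> {0..1}" using prob_pos_in_unit[OF \<theta>(2)] by (simp add: p_def)
      interpret bin: binomial_distribution n p by unfold_locales (rule p)
      have "exp (- \<theta>) \<le> exp (- u)" using \<theta> by simp
      also have "\<dots> \<le> 1 - u / 2"
      proof -
        have "u * u \<le> u * 1" using u by (intro mult_left_mono) auto
        then have "1 \<le> (1 + u) * (1 - u / 2)" by (simp add: algebra_simps)
        also have "\<dots> \<le> exp u * (1 - u / 2)" using u by (intro mult_right_mono) auto
        finally show ?thesis by (simp add: exp_minus field_simps)
      qed
      finally have "1 / 2 + u / 4 \<le> p" by (simp add: p_def)
      then have "n * (1 / 2 + u / 4) \<le> n * p" by (intro mult_left_mono) auto
      moreover have "n * u = K * D" using n by (simp add: u_def D_def)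
      moreover have "8 * x * D \<le> K * D" using K D by (intro mult_right_mono) (auto simp: x_def)
      ultimately have gap: "v n \<le> n * p - K / 8 * D" using v by (simp add: algebra_simps)
      have "type2_error P X n (v n) \<theta> = measure_pmf.prob (binomial_pmf n p) {k. real k < v n}"
        using prob_sign_stat_Collect(1)[OF model \<theta>(2), of "\<lambda>s. s < v n" n]
        by (simp add: type2_error_def p_def)
      also have "\<dots> \<le> measure_pmf.prob (binomial_pmf n p) {k. real k \<le> n * p - K / 8 * D}"
        using gap by (intro measure_pmf.finite_measure_mono) auto
      also have "\<dots> \<le> exp (- 2 * (K / 8 * D)\<^sup>2 / n)"
        using K0 D n by (intro bin.prob_le) auto
      also have "- 2 * (K / 8 * D)\<^sup>2 / n = - K\<^sup>2 / 32 * ln n"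
      proof -
        have "D\<^sup>2 = n * ln n" using n by (auto simp: D_def dev_scale_def)
        then show ?thesis using n by (simp add: power_mult_distrib power_divide)
      qed
      also have "exp \<dots> = real n powr (- K\<^sup>2 / 32)" using n by (simp add: powr_def)
      finally show "type2_error P X n (v n) \<theta> \<le> real n powr (- K\<^sup>2 / 32)" .
    qed
  qed
qed

lemma bigtheta_realI:
  fixes s t :: "nat \<Rightarrow> real"
  assumes "c > 0" "C > 0" and ev: "\<forall>\<^sub>F n in sequentially. 0 < t n \<and> c * t n \<le> s n \<and> s n \<le> C * t n"
  shows "s \<in> \<Theta>(t)"
proof -
  have "\<forall>\<^sub>F n in sequentially. norm (s n) \<le> C * norm (t n) \<and> c * norm (t n) \<le> norm (s n)"
    using ev
  proof eventually_elim
    case (elim n)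
    then have "0 < c * t n" using assms(1) by simp
    then have "0 < s n" using elim by linarith
    then show ?case using elim by simp
  qed
  then show ?thesis
    using assms(1,2) by (intro bigthetaI bigoI[of _ C] landau_omega.bigI[of c]) (auto elim: eventually_mono)
qed

lemma bigtheta_realD:
  fixes s t :: "nat \<Rightarrow> real"
  assumes "s \<in> \<Theta>(t)" and pos: "\<forall>\<^sub>F n in sequentially. 0 < s n" "\<forall>\<^sub>F n in sequentially. 0 < t n"
  obtains c C where "c > 0" "C > 0" "\<forall>\<^sub>F n in sequentially. c * t n \<le> s n \<and> s n \<le> C * t n"
proof -
  from assms(1) obtain C where C: "C > 0" "\<forall>\<^sub>F n in sequentially. norm (s n) \<le> C * norm (t n)"
    by (auto dest!: bigthetaD1 elim: landau_o.bigE)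
  from assms(1) obtain c where c: "c > 0" "\<forall>\<^sub>F n in sequentially. norm (s n) \<ge> c * norm (t n)"
    by (auto dest!: bigthetaD2 elim: landau_omega.bigE)
  have "\<forall>\<^sub>F n in sequentially. c * t n \<le> s n \<and> s n \<le> C * t n"
    using C(2) c(2) pos by eventually_elim auto
  with C(1) c(1) show ?thesis using that by blast
qed

text \<open>Necessity: if \<open>s\<close> were not of order \<open>t\<close>, then infinitely often either the region of error at least
\<open>\<delta>\<close> would contain a multiple of \<open>t\<close> at which the error vanishes, or the region of vanishing error
would contain a multiple of \<open>t\<close> at which the error is at least \<open>1/2\<close>.

Sufficiency of the order \<open>t\<close> for the concentration of the averaged error: \<open>\<theta> \<le> c0 t\<close> alone contributes at least a multiple of
\<open>t\<^sup>\<lambda>\<close>. Below \<open>a s\<close> the contribution is at most the prior mass, of order \<open>(a t)\<^sup>\<lambda>\<close>, hence a small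
fraction for small \<open>a\<close>; above \<open>b s\<close> it is at most \<open>n\<^bsup>-\<lambda>\<^esup>\<close> for large \<open>b\<close>, negligible
against \<open>t\<^sup>\<lambda>\<close>, which is at least of order \<open>n\<^bsup>-\<lambda>/2\<^esup>\<close>.\<close>

lemma critical_scale_gamma_prior_iff:
  fixes \<beta> :: "nat \<Rightarrow> real \<Rightarrow> real" and lam gam c0 K0 :: real
  defines "t \<equiv> \<lambda>n. dev_scale n / real n"
  assumes lam: "0 < lam" and gam: "0 < gam"
    and c0: "0 < c0" and small: "\<forall>\<^sub>F n in sequentially. \<forall>\<theta>. 0 < \<theta> \<and> \<theta> \<le> c0 * t n \<longrightarrow> 1 / 2 \<le> \<beta> n \<theta>"
    and K0: "0 < K0" and large: "\<And>K. K0 \<le> K \<Longrightarrow>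
      \<forall>\<^sub>F n in sequentially. \<forall>\<theta>. K * t n \<le> \<theta> \<longrightarrow> \<beta> n \<theta> \<le> real n powr (- K\<^sup>2 / 32)"
    and meas: "\<And>n. (\<lambda>\<theta>. indicator {0<..} \<theta> * \<beta> n \<theta>) \<in> borel_measurable borel"
    and bounds: "\<And>n \<theta>. 0 < \<theta> \<Longrightarrow> 0 \<le> \<beta> n \<theta>" "\<And>n \<theta>. 0 < \<theta> \<Longrightarrow> \<beta> n \<theta> \<le> 1"
  shows "critical_scale (gamma_prior lam gam) \<beta> s
    \<longleftrightarrow> (\<forall>\<^sub>F n in sequentially. 0 < s n) \<and> s \<in> \<Theta>(t)"
proof -
  let ?Q = "gamma_prior lam gam"
  interpret Q: prob_space ?Q by (rule prob_space_gamma_prior[OF lam gam])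
  have t_pos: "\<forall>\<^sub>F n in sequentially. 0 < t n"
    using eventually_ge_at_top[of 2] by eventually_elim (use dev_scale_pos in \<open>auto simp: t_def\<close>)
  have vanish: "(\<lambda>n. real n powr (- K\<^sup>2 / 32)) \<longlonglongrightarrow> 0" if "0 < K" for K :: real
  proof -
    have "0 < K\<^sup>2 / 32" using that by simp
    then have "(\<lambda>n. real n powr (- (K\<^sup>2 / 32))) \<longlonglongrightarrow> 0" by real_asymp
    then show ?thesis by simp
  qed
  show ?thesis
  proof
    assume cs: "critical_scale ?Q \<beta> s"
    then have s_pos: "\<forall>\<^sub>F n in sequentially. 0 < s n" by (simp add: critical_scale_def)
    from cs obtain c \<delta> where c: "c > 0" "\<delta> > 0"
      "\<forall>\<^sub>F n in sequentially. \<forall>\<theta>. 0 < \<theta> \<and> \<theta> \<le> c * s n \<longrightarrow> \<delta> \<le> \<beta> n \<theta>"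
      unfolding critical_scale_def by blast
    from cs obtain C where C: "C > 0"
      "\<And>\<epsilon>. \<epsilon> > 0 \<Longrightarrow> \<forall>\<^sub>F n in sequentially. \<forall>\<theta>. C * s n \<le> \<theta> \<longrightarrow> \<beta> n \<theta> \<le> \<epsilon>"
      unfolding critical_scale_def by blast
    have "\<forall>\<^sub>F n in sequentially. \<forall>\<theta>. C * s n \<le> \<theta> \<longrightarrow> \<beta> n \<theta> \<le> 1 / 4" by (rule C(2)) simp
    moreover have "\<forall>\<^sub>F n in sequentially. real n powr (- K0\<^sup>2 / 32) < \<delta>"
      using vanish[OF K0] c(2) by (rule order_tendstoD(2))
    ultimately have "\<forall>\<^sub>F n in sequentially. 0 < t n \<and> c0 / C * t n \<le> s n \<and> s n \<le> K0 / c * t n"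
      using c(3) small large[OF order_refl] t_pos
    proof eventually_elim
      case (elim n)
      have "c * s n < K0 * t n"
      proof (rule ccontr)
        assume "\<not> c * s n < K0 * t n"
        then have "\<delta> \<le> \<beta> n (K0 * t n)" using elim K0 by auto
        moreover have "\<beta> n (K0 * t n) \<le> real n powr (- K0\<^sup>2 / 32)" using elim(5) by blast
        ultimately show False using elim(2) by linarith
      qed
      moreover have "c0 * t n < C * s n"
      proof (rule ccontr)
        assume "\<not> c0 * t n < C * s n"
        then have "\<beta> n (c0 * t n) \<le> 1 / 4" using elim(1) by auto
        moreover have "1 / 2 \<le> \<beta> n (c0 * t n)" using elim c0 by auto
        ultimately show False by simp
      qed
      ultimately show ?case using elim(6) c(1) C(1) by (auto simp: field_simps)
    qed
    then have "s \<in> \<Theta>(t)" by (rule bigtheta_realI[rotated 2]) (use c C c0 K0 in auto)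
    with s_pos show "(\<forall>\<^sub>F n in sequentially. 0 < s n) \<and> s \<in> \<Theta>(t)" by simp
  next
    assume s: "(\<forall>\<^sub>F n in sequentially. 0 < s n) \<and> s \<in> \<Theta>(t)"
    then have s_pos: "\<forall>\<^sub>F n in sequentially. 0 < s n" by simp
    obtain cs Cs where cs: "cs > 0" "Cs > 0" "\<forall>\<^sub>F n in sequentially. cs * t n \<le> s n \<and> s n \<le> Cs * t n"
      using bigtheta_realD[of s t] s t_pos by blast
    have ex_c: "\<exists>c>0. \<exists>\<delta>>0. \<forall>\<^sub>F n in sequentially. \<forall>\<theta>. 0 < \<theta> \<and> \<theta> \<le> c * s n \<longrightarrow> \<delta> \<le> \<beta> n \<theta>"
    proof (intro exI conjI)
      show "0 < c0 / Cs" "(0::real) < 1 / 2" using c0 cs by auto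
      show "\<forall>\<^sub>F n in sequentially. \<forall>\<theta>. 0 < \<theta> \<and> \<theta> \<le> c0 / Cs * s n \<longrightarrow> 1 / 2 \<le> \<beta> n \<theta>"
        using small cs(3)
      proof eventually_elim
        case (elim n)
        have "c0 / Cs * s n \<le> c0 / Cs * (Cs * t n)" using elim c0 cs by (intro mult_left_mono) auto
        then have "c0 / Cs * s n \<le> c0 * t n" using cs by simp
        then show ?case using elim(1) by (meson order_trans)
      qed
    qed
    have ex_C: "\<exists>C>0. \<forall>\<epsilon>>0. \<forall>\<^sub>F n in sequentially. \<forall>\<theta>. C * s n \<le> \<theta> \<longrightarrow> \<beta> n \<theta> \<le> \<epsilon>"
    proof (intro exI conjI allI impI)
      show "0 < K0 / cs" using K0 cs by simp
      fix \<epsilon> :: real assume "\<epsilon> > 0"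
      with vanish[OF K0] have "\<forall>\<^sub>F n in sequentially. real n powr (- K0\<^sup>2 / 32) < \<epsilon>"
        by (rule order_tendstoD(2))
      with large[OF order_refl] cs(3)
      show "\<forall>\<^sub>F n in sequentially. \<forall>\<theta>. K0 / cs * s n \<le> \<theta> \<longrightarrow> \<beta> n \<theta> \<le> \<epsilon>"
      proof eventually_elim
        case (elim n)
        have "K0 / cs * (cs * t n) \<le> K0 / cs * s n" using elim K0 cs by (intro mult_left_mono) auto
        then have "K0 * t n \<le> K0 / cs * s n" using cs by simp
        then show ?case using elim(1,3) by (meson less_imp_le order_trans)
      qed
    qed
    obtain c1 C1 where c1: "c1 > 0" "C1 > 0"
      "\<And>\<epsilon>. 0 \<le> \<epsilon> \<Longrightarrow> \<epsilon> \<le> 1 \<Longrightarrow> c1 * \<epsilon> powr lam \<le> measure ?Q {0..\<epsilon>}"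
      "\<And>\<epsilon>. 0 \<le> \<epsilon> \<Longrightarrow> \<epsilon> \<le> 1 \<Longrightarrow> measure ?Q {0..\<epsilon>} \<le> C1 * \<epsilon> powr lam"
      using gamma_prior_ball_measure[OF lam gam] by metis
    have conc: "\<exists>a>0. \<exists>b>a. \<forall>\<^sub>F n in sequentially.
        (1 - \<epsilon>) * (LINT \<theta>:{0<..}|?Q. \<beta> n \<theta>) \<le> (LINT \<theta>:{a * s n..b * s n}|?Q. \<beta> n \<theta>)"
      if eps: "\<epsilon> > 0" for \<epsilon> :: real
    proof -
      \<comment> \<open>Both discarded parts are to be at most \<open>\<kappa> t\<^sup>\<lambda>\<close>, a quarter of \<open>\<epsilon>\<close> times \<open>c1 (c0 t)\<^sup>\<lambda>\<close>,
          where half of \<open>c1 (c0 t)\<^sup>\<lambda>\<close> is the lower bound for the whole.\<close>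
      define \<kappa> where "\<kappa> = \<epsilon> * c1 * c0 powr lam / 4"
      have \<kappa>: "\<kappa> > 0" using eps c1 c0 by (simp add: \<kappa>_def)
      define a where "a = (\<kappa> / C1) powr (1 / lam) / Cs"
      have a: "a > 0" using \<kappa> c1 cs by (simp add: a_def)
      have a_pow: "C1 * (a * Cs) powr lam = \<kappa>"
        using \<kappa> c1 cs lam by (simp add: a_def powr_powr)
      define K where "K = max K0 (sqrt (32 * lam))"
      have K: "K0 \<le> K" "lam \<le> K\<^sup>2 / 32"
      proof -
        have "(sqrt (32 * lam))\<^sup>2 \<le> K\<^sup>2" using lam by (intro power_mono) (auto simp: K_def)
        then show "lam \<le> K\<^sup>2 / 32" using lam by simp
      qed (simp add: K_def)
      define b where "b = max (K / cs) (a + 1)"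
      have b: "a < b" "K \<le> b * cs" using cs by (auto simp: b_def max_mult_distrib_right)
      have ev_small: "\<forall>\<^sub>F n in sequentially. a * Cs * t n \<le> 1" "\<forall>\<^sub>F n in sequentially. c0 * t n \<le> 1"
        unfolding t_def dev_scale_def using mult_pos_pos[OF a cs(2)] c0 by real_asymp+
      have ev_poly: "\<forall>\<^sub>F n in sequentially. real n powr (- lam) \<le> \<kappa> * (real n powr (- lam / 2) * ln (real n) powr (lam / 2))"
        using \<kappa> lam by real_asymp
      show ?thesis
      proof (intro exI conjI)
        show "0 < a" "a < b" by fact+
        show "\<forall>\<^sub>F n in sequentially.
          (1 - \<epsilon>) * (LINT \<theta>:{0<..}|?Q. \<beta> n \<theta>) \<le> (LINT \<theta>:{a * s n..b * s n}|?Q. \<beta> n \<theta>)"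
          using small large[OF K(1)] cs(3) s_pos t_pos ev_small ev_poly eventually_ge_at_top[of 2]
        proof eventually_elim
          case (elim n)
          define I where "I = (LINT \<theta>:{0<..}|?Q. \<beta> n \<theta>)"
          define \<eta> where "\<eta> = real n powr (- K\<^sup>2 / 32)"
          have [measurable]: "(\<lambda>\<theta>. indicator {0<..} \<theta> * \<beta> n \<theta>) \<in> borel_measurable ?Q"
            using meas[of n] by simp
          have int: "integrable ?Q (\<lambda>\<theta>. indicator {0<..} \<theta> * \<beta> n \<theta>)"
          proof (rule Q.integrable_const_bound[of _ 1])
            show "AE \<theta> in ?Q. norm (indicator {0<..} \<theta> * \<beta> n \<theta>) \<le> 1"
              using bounds by (auto simp: indicator_def)
          qed measurable
          have ind: "integrable ?Q (indicator {x..y} :: real \<Rightarrow> real)" for x y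
            by (intro Q.integrable_const_bound[of _ 1]) (auto simp: indicator_def)
          have as: "0 < a * s n" using a elim by simp
          have win: "indicator {a * s n..b * s n} \<theta> *\<^sub>R \<beta> n \<theta>
              = indicator {a * s n..b * s n} \<theta> * (indicator {0<..} \<theta> * \<beta> n \<theta>)" for \<theta>
            using as by (auto simp: indicator_def)
          have int_win: "integrable ?Q (\<lambda>\<theta>. indicator {a * s n..b * s n} \<theta> *\<^sub>R \<beta> n \<theta>)"
            unfolding win
          proof (rule Q.integrable_const_bound[of _ 1])
            show "AE \<theta> in ?Q. norm (indicator {a * s n..b * s n} \<theta> * (indicator {0<..} \<theta> * \<beta> n \<theta>)) \<le> 1"
              using bounds by (auto simp: indicator_def)
          qed measurable
          have t_lam: "t n powr lam = real n powr (- lam / 2) * ln (real n) powr (lam / 2)"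
            using dev_scale_powr[OF elim(9), of 1 lam] by (simp add: t_def)
          have "1 / 2 * (c1 * (c0 * t n) powr lam) \<le> 1 / 2 * measure ?Q {0..c0 * t n}"
            using c1(3)[of "c0 * t n"] c0 elim by simp
          also have "\<dots> = (\<integral>\<theta>. indicator {0..c0 * t n} \<theta> * (1 / 2) \<partial>?Q)" by simp
          also have "\<dots> \<le> (\<integral>\<theta>. indicator {0<..} \<theta> * \<beta> n \<theta> \<partial>?Q)"
          proof (rule integral_mono_AE)
            show "AE \<theta> in ?Q. indicator {0..c0 * t n} \<theta> * (1 / 2) \<le> indicator {0<..} \<theta> * \<beta> n \<theta>"
              using gamma_prior_AE_pos
              by eventually_elim (use elim(1) bounds in \<open>auto simp: indicator_def\<close>)
          qed (use int ind in auto)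
          also have "\<dots> = I" by (simp add: I_def set_lebesgue_integral_def)
          finally have I_lower: "1 / 2 * (c1 * (c0 powr lam * t n powr lam)) \<le> I"
            using c0 elim by (simp add: powr_mult)
          have "I = (\<integral>\<theta>. indicator {0<..} \<theta> * \<beta> n \<theta> \<partial>?Q)" by (simp add: I_def set_lebesgue_integral_def)
          also have "\<dots> \<le> (\<integral>\<theta>. indicator {a * s n..b * s n} \<theta> *\<^sub>R \<beta> n \<theta> + indicator {0..a * s n} \<theta> + \<eta> \<partial>?Q)"
          proof (rule integral_mono)
            fix \<theta> :: real
            have bs: "K * t n \<le> b * s n"
            proof -
              have "K * t n \<le> b * cs * t n" using b elim by (intro mult_right_mono) auto
              also have "\<dots> = b * (cs * t n)" by simp
              also have "\<dots> \<le> b * s n" using elim a b by (intro mult_left_mono) auto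
              finally show ?thesis .
            qed
            have "0 \<le> \<eta>" by (simp add: \<eta>_def)
            consider "\<theta> \<le> 0" | "0 < \<theta>" "\<theta> < a * s n" | "a * s n \<le> \<theta>" "\<theta> \<le> b * s n"
              | "0 < \<theta>" "b * s n < \<theta>" using as by linarith
            then show "indicator {0<..} \<theta> * \<beta> n \<theta>
              \<le> indicator {a * s n..b * s n} \<theta> *\<^sub>R \<beta> n \<theta> + indicator {0..a * s n} \<theta> + \<eta>"
            proof cases
              case 1
              then have "indicator {a * s n..b * s n} \<theta> = (0::real)" using as by (auto simp: indicator_def)
              then show ?thesis using 1 \<open>0 \<le> \<eta>\<close> by simp
            next
              case 2
              then show ?thesis using bounds[of \<theta> n] \<open>0 \<le> \<eta>\<close> by simp
            next
              case 3
              then show ?thesis using as \<open>0 \<le> \<eta>\<close> by simp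
            next
              case 4
              then have "\<beta> n \<theta> \<le> \<eta>" using elim(2) bs unfolding \<eta>_def by (meson less_imp_le order_trans)
              then show ?thesis using 4 by (simp add: indicator_def)
            qed
          qed (use int ind int_win in auto)
          also have "\<dots> = (LINT \<theta>:{a * s n..b * s n}|?Q. \<beta> n \<theta>) + measure ?Q {0..a * s n} + \<eta>"
            using ind int_win Q.prob_space by (simp add: set_lebesgue_integral_def)
          finally have I_upper: "I \<le> (LINT \<theta>:{a * s n..b * s n}|?Q. \<beta> n \<theta>) + measure ?Q {0..a * s n} + \<eta>" .
          have "measure ?Q {0..a * s n} \<le> measure ?Q {0..a * Cs * t n}"
            using elim a by (intro Q.finite_measure_mono) (auto intro: order_trans mult_left_mono)
          also have "\<dots> \<le> C1 * (a * Cs * t n) powr lam" using a cs elim by (intro c1(4)) auto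
          also have "\<dots> = \<kappa> * t n powr lam" using a cs elim by (simp add: powr_mult flip: a_pow)
          finally have m1: "measure ?Q {0..a * s n} \<le> \<kappa> * t n powr lam" .
          have "\<eta> \<le> real n powr (- lam)" unfolding \<eta>_def using K elim by (intro powr_mono) auto
          also have "\<dots> \<le> \<kappa> * t n powr lam" using elim by (simp add: t_lam)
          finally have "measure ?Q {0..a * s n} + \<eta> \<le> 2 * \<kappa> * t n powr lam" using m1 by simp
          also have "\<dots> = \<epsilon> * (1 / 2 * (c1 * (c0 powr lam * t n powr lam)))" by (simp add: \<kappa>_def)
          also have "\<dots> \<le> \<epsilon> * I" using I_lower eps by (intro mult_left_mono) auto
          finally show ?case using I_upper by (simp add: I_def algebra_simps)
        qed
      qed
    qed
    show "critical_scale ?Q \<beta> s"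
      unfolding critical_scale_def using s_pos ex_c ex_C conc by blast
  qed
qed

theorem theorem5p4:
  fixes P :: "real \<Rightarrow> 'a measure" and X :: "nat \<Rightarrow> 'a \<Rightarrow> real"
    and p0 p1 L0 L1 lam gam :: real and Q :: "real measure"
  assumes model: "laplace_model P X"
    and priors: "p0 > 0" "p1 > 0" "p0 + p1 = 1"
    and losses: "L0 > 0" "L1 > 0"
    and params: "lam > 0" "gam > 0"
    and prior: "Q = gamma_prior lam gam"
  shows "(\<lambda>\<epsilon>. measure Q {0..\<epsilon>}) \<in> \<Theta>[at_right 0](\<lambda>\<epsilon>. \<epsilon> powr lam)
    \<and> (\<forall>n. \<exists>v. bayes_threshold P X Q p0 p1 L0 L1 n v)
    \<and> (\<exists>\<kappa>::real. \<forall>v. (\<forall>n. bayes_threshold P X Q p0 p1 L0 L1 n (v n)) \<longrightarrow>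
         (\<exists>r. r \<in> o(\<lambda>_. 1) \<and> (\<forall>\<^sub>F n in sequentially.
              v n = real n / 2 + 1 / 2 * sqrt (lam * real n * ln (real n)) * (1 + r n)))
       \<and> (\<exists>r. r \<in> o(\<lambda>_. 1) \<and> (\<forall>\<^sub>F n in sequentially.
              standardised_threshold n (v n) = sqrt (lam * ln (real n)) * (1 + r n)))
       \<and> (\<lambda>n. type1_error P X n (v n))
            \<in> \<Theta>(\<lambda>n. real n powr (- lam / 2) * ln (real n) powr \<kappa>)
       \<and> (\<forall>s. critical_scale Q (\<lambda>n \<theta>. type2_error P X n (v n) \<theta>) s \<longleftrightarrow>
              (\<forall>\<^sub>F n in sequentially. 0 < s n) \<and> s \<in> \<Theta>(\<lambda>n. sqrt (ln (real n) / real n))))"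
proof (intro conjI)
  interpret Q: prob_space Q unfolding prior by (rule prob_space_gamma_prior[OF params])
  have Q: "finite_measure Q" "sets Q = sets borel"
    using Q.finite_measure_axioms by (auto simp: prior)
  obtain c C where c: "c > 0" "C > 0"
    "\<And>\<epsilon>. 0 \<le> \<epsilon> \<Longrightarrow> \<epsilon> \<le> 1 \<Longrightarrow> c * \<epsilon> powr lam \<le> measure Q {0..\<epsilon>}"
    "\<And>\<epsilon>. 0 \<le> \<epsilon> \<Longrightarrow> \<epsilon> \<le> 1 \<Longrightarrow> measure Q {0..\<epsilon>} \<le> C * \<epsilon> powr lam"
    using gamma_prior_ball_measure[OF params] unfolding prior by metis
  have near0: "\<forall>\<^sub>F \<epsilon> in at_right (0::real). 0 < \<epsilon> \<and> \<epsilon> \<le> 1"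
    using eventually_at_right_real[of 0 "1::real"] by (auto elim: eventually_mono)
  show "(\<lambda>\<epsilon>. measure Q {0..\<epsilon>}) \<in> \<Theta>[at_right 0](\<lambda>\<epsilon>. \<epsilon> powr lam)"
  proof (rule bigthetaI)
    show "(\<lambda>\<epsilon>. measure Q {0..\<epsilon>}) \<in> O[at_right 0](\<lambda>\<epsilon>. \<epsilon> powr lam)"
      by (rule bigoI[of _ C], use near0 in eventually_elim) (use c in auto)
    show "(\<lambda>\<epsilon>. measure Q {0..\<epsilon>}) \<in> \<Omega>[at_right 0](\<lambda>\<epsilon>. \<epsilon> powr lam)"
      by (rule landau_omega.bigI[OF c(1)], use near0 in eventually_elim) (use c in auto)
  qed
  show "\<forall>n. \<exists>v. bayes_threshold P X Q p0 p1 L0 L1 n v"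
    using bayes_threshold_exists[OF model Q] by blast
  show "\<exists>\<kappa>::real. \<forall>v. (\<forall>n. bayes_threshold P X Q p0 p1 L0 L1 n (v n)) \<longrightarrow>
         (\<exists>r. r \<in> o(\<lambda>_. 1) \<and> (\<forall>\<^sub>F n in sequentially.
              v n = real n / 2 + 1 / 2 * sqrt (lam * real n * ln (real n)) * (1 + r n)))
       \<and> (\<exists>r. r \<in> o(\<lambda>_. 1) \<and> (\<forall>\<^sub>F n in sequentially.
              standardised_threshold n (v n) = sqrt (lam * ln (real n)) * (1 + r n)))
       \<and> (\<lambda>n. type1_error P X n (v n))
            \<in> \<Theta>(\<lambda>n. real n powr (- lam / 2) * ln (real n) powr \<kappa>)
       \<and> (\<forall>s. critical_scale Q (\<lambda>n \<theta>. type2_error P X n (v n) \<theta>) s \<longleftrightarrow>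
              (\<forall>\<^sub>F n in sequentially. 0 < s n) \<and> s \<in> \<Theta>(\<lambda>n. sqrt (ln (real n) / real n)))"
  proof (intro exI[of _ "lam / 2 - 1"] allI impI)
    fix v assume "\<forall>n. bayes_threshold P X Q p0 p1 L0 L1 n (v n)"
    then have opt: "bayes_threshold P X Q p0 p1 L0 L1 n (v n)" for n by blast
    have A: "0 < p0 * L0" and B: "0 < p1 * L1" using priors losses by auto
    have ge: "p0 * L0 \<le> p1 * L1 * bayes_factor (gamma_prior lam gam) n j" if "v n \<le> real j" "j \<le> n" for n j
      using bayes_threshold_le_imp[OF model Q B opt that] by (simp add: prior)
    have less: "p1 * L1 * bayes_factor (gamma_prior lam gam) n j \<le> p0 * L0" if "real j < v n" "j \<le> n" for n j
      using bayes_threshold_gt_imp[OF model Q B opt that] by (simp add: prior)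
    have lim: "(\<lambda>n. (2 * v n - n) / dev_scale n) \<longlonglongrightarrow> sqrt lam"
      by (rule threshold_limit[OF params A B ge less])
    define r where "r = (\<lambda>n. (2 * v n - n) / dev_scale n / sqrt lam - 1)"
    have "r \<longlonglongrightarrow> sqrt lam / sqrt lam - 1"
      unfolding r_def by (intro tendsto_intros lim) (use params in auto)
    then have r0: "r \<in> o(\<lambda>_. 1)" using params by (intro smalloI_tendsto) auto
    have r_eq: "2 * v n - n = sqrt lam * dev_scale n * (1 + r n)" if "n \<ge> 2" for n
      using dev_scale_pos[OF that] params by (simp add: r_def)
    have "\<forall>\<^sub>F n in sequentially. v n = real n / 2 + 1 / 2 * sqrt (lam * real n * ln (real n)) * (1 + r n)"
      using eventually_ge_at_top[of 2]
    proof eventually_elim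
      case (elim n)
      have "sqrt (lam * real n * ln (real n)) = sqrt lam * dev_scale n"
        by (simp add: dev_scale_def real_sqrt_mult)
      then show ?case using r_eq[OF elim] by simp
    qed
    then have part1: "\<exists>r. r \<in> o(\<lambda>_. 1) \<and> (\<forall>\<^sub>F n in sequentially.
              v n = real n / 2 + 1 / 2 * sqrt (lam * real n * ln (real n)) * (1 + r n))"
      using r0 by blast
    have "\<forall>\<^sub>F n in sequentially. standardised_threshold n (v n) = sqrt (lam * ln (real n)) * (1 + r n)"
      using eventually_ge_at_top[of 2]
    proof eventually_elim
      case (elim n)
      have "standardised_threshold n (v n) = (2 * v n - n) / sqrt n"
        using elim by (simp add: standardised_threshold_def field_simps)
      also have "\<dots> = sqrt (lam * ln n) * (1 + r n)"
        unfolding r_eq[OF elim] using elim by (simp add: dev_scale_def real_sqrt_mult)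
      finally show ?case .
    qed
    then have part2: "\<exists>r. r \<in> o(\<lambda>_. 1) \<and> (\<forall>\<^sub>F n in sequentially.
              standardised_threshold n (v n) = sqrt (lam * ln (real n)) * (1 + r n))"
      using r0 by blast
    have part3: "(\<lambda>n. type1_error P X n (v n))
        \<in> \<Theta>(\<lambda>n. real n powr (- lam / 2) * ln (real n) powr (lam / 2 - 1))"
      unfolding type1_error_eq_sum[OF model]
      by (rule threshold_type1_bigtheta[OF params A B ge less])
    have t: "(\<lambda>n. dev_scale n / real n) = (\<lambda>n. sqrt (ln (real n) / real n))"
    proof
      fix n
      have "dev_scale n / real n = sqrt (real n * ln (real n) / (real n)\<^sup>2)"
        by (simp add: dev_scale_def real_sqrt_divide)
      also have "real n * ln (real n) / (real n)\<^sup>2 = ln (real n) / real n"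
        by (simp add: power2_eq_square)
      finally show "dev_scale n / real n = sqrt (ln (real n) / real n)" .
    qed
    have part4: "critical_scale Q (\<lambda>n \<theta>. type2_error P X n (v n) \<theta>) s \<longleftrightarrow>
              (\<forall>\<^sub>F n in sequentially. 0 < s n) \<and> s \<in> \<Theta>(\<lambda>n. sqrt (ln (real n) / real n))" for s
      unfolding prior t[symmetric]
    proof (rule critical_scale_gamma_prior_iff[OF params, of "sqrt lam / 4" _ "8 * sqrt lam"])
      show "\<forall>\<^sub>F n in sequentially. \<forall>\<theta>. 0 < \<theta> \<and> \<theta> \<le> sqrt lam / 4 * (dev_scale n / n)
          \<longrightarrow> 1 / 2 \<le> type2_error P X n (v n) \<theta>"
        by (rule type2_error_ge_half_near_null[OF model params(1) lim])
      show "\<forall>\<^sub>F n in sequentially. \<forall>\<theta>. K * (dev_scale n / n) \<le> \<theta>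
          \<longrightarrow> type2_error P X n (v n) \<theta> \<le> real n powr (- K\<^sup>2 / 32)" if "8 * sqrt lam \<le> K" for K
        by (rule type2_error_polynomially_small[OF model params(1) lim that])
      fix n
      have "(\<lambda>\<theta>. indicator {0<..} \<theta> * type2_error P X n (v n) \<theta>)
        = (\<lambda>\<theta>. indicator {0<..} \<theta> * (\<Sum>k | k \<le> n \<and> real k < v n. null_pmf n k * lik_ratio n k \<theta>))"
        by (auto simp: fun_eq_iff indicator_def type2_error_eq_sum[OF model])
      also have "\<dots> \<in> borel_measurable borel" by measurable
      finally show "(\<lambda>\<theta>. indicator {0<..} \<theta> * type2_error P X n (v n) \<theta>) \<in> borel_measurable borel" .
      fix \<theta> :: real assume "0 < \<theta>"
      then interpret prob_space "P \<theta>" using model by (simp add: laplace_model_def)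
      show "0 \<le> type2_error P X n (v n) \<theta>" "type2_error P X n (v n) \<theta> \<le> 1"
        by (simp_all add: type2_error_def)
    qed (use params in auto)
    show "(\<exists>r. r \<in> o(\<lambda>_. 1) \<and> (\<forall>\<^sub>F n in sequentially.
              v n = real n / 2 + 1 / 2 * sqrt (lam * real n * ln (real n)) * (1 + r n)))
       \<and> (\<exists>r. r \<in> o(\<lambda>_. 1) \<and> (\<forall>\<^sub>F n in sequentially.
              standardised_threshold n (v n) = sqrt (lam * ln (real n)) * (1 + r n)))
       \<and> (\<lambda>n. type1_error P X n (v n))
            \<in> \<Theta>(\<lambda>n. real n powr (- lam / 2) * ln (real n) powr (lam / 2 - 1))
       \<and> (\<forall>s. critical_scale Q (\<lambda>n \<theta>. type2_error P X n (v n) \<theta>) s \<longleftrightarrow>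
              (\<forall>\<^sub>F n in sequentially. 0 < s n) \<and> s \<in> \<Theta>(\<lambda>n. sqrt (ln (real n) / real n)))"
      using part1 part2 part3 part4 by blast
  qed
qed

end
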